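(* Let $n\ge 1$, $2-n<b\le 0$, $b-2<c<b-2+2n$, and let $p=\frac{2(2-b+c)}{n}$ (mass-critical case). Let $u$ be a radial $W_b^{1,2}$-solution of $$i\partial_t u+\nabla\cdot(|x|^b\nabla u)=-|x|^c|u|^pu$$ which blows up in finite time $T^\ast>0$ and satisfies $$\|\nabla u(t)\|_{b,2}\ge \frac{C}{\sqrt{T^\ast-t}}$$ for some universal constant $C>0$ and all $t$ close enough to $T^\ast$. If $\lambda\in C([0,T^\ast))$ is a positive function with $\lambda(t)\|\nabla u(t)\|_{b,2}^{\frac{2}{2-b}}\to+\infty$ as $t\to T^\ast$, then (1) $\displaystyle\liminf_{t\to T^\ast}\int_{|x|\le\lambda(t)}|u(x,t)|^2\,dx\ge \|Q\|_2^2$, where $Q$ is the ground state solution of $\nabla\cdot(|x|^b\nabla Q)+|x|^c|Q|^pQ-Q=0$; (2) there is no sequence $t_n\to T^\ast$ such that $u(t_n)$ converges strongly in $L^2(\mathbb{R}^n)$.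
   Context: Notation: $\|f\|_{a,q}=\left(\int_{\mathbb{R}^n}|x|^a|f|^q\,dx\right)^{1/q}$, $\|f\|_q=\|f\|_{0,q}$; $W_b^{1,2}$ has norm $\|\nabla u\|_{b,2}+\|u\|_2$. Standing assumption: local well-posedness in $W_b^{1,2}$, with a maximal solution $u\in C([0,T^\ast);W_b^{1,2})$; "blows up in finite time" means $T^\ast<\infty$ and $\|u(t)\|_{W_b^{1,2}}\to\infty$. Solutions conserve mass $\|u\|_2^2$ and energy $E(u)=\frac12\|\nabla u\|_{b,2}^2-\frac1{p+2}\|u\|_{c,p+2}^{p+2}$. The ground state $Q$ is the solution of the elliptic equation giving the optimal constant in the sharp radial Gagliardo–Nirenberg inequality $\int|x|^c|u|^{p+2}\le C_{GN}\|\nabla u\|_{b,2}^{\mathbf{p}_c/(2-b)}\|u\|_2^{((2-b)(p+2)-\mathbf{p}_c)/(2-b)}$ with $\mathbf{p}_c=np-2c$; in the mass-critical case this reads $\int|x|^c|u|^{p+2}\le \frac{p+2}{2\|Q\|_2^p}\|\nabla u\|_{b,2}^2\|u\|_2^p$. *)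

theory Defs
  imports "HOL-Analysis.Analysis" "HOL-Library.Liminf_Limsup"
begin

definition wnorm :: "real \<Rightarrow> real \<Rightarrow> (real^'n \<Rightarrow> 'v::real_normed_vector) \<Rightarrow> real" where
  "wnorm a q f = (integral\<^sup>L lborel (\<lambda>x. norm x powr a * norm (f x) powr q)) powr (1/q)"

definition wint :: "real \<Rightarrow> real \<Rightarrow> (real^'n \<Rightarrow> 'v::real_normed_vector) \<Rightarrow> bool" where
  "wint a q f \<longleftrightarrow> f \<in> borel_measurable lborel \<and>
     integrable lborel (\<lambda>x. norm x powr a * norm (f x) powr q)"

definition test_fun :: "(real^'n \<Rightarrow> real) \<Rightarrow> ('n \<Rightarrow> real^'n \<Rightarrow> real) \<Rightarrow> bool" where
  "test_fun phi dphi \<longleftrightarrow>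
     (\<forall>x. (phi has_derivative (\<lambda>h. \<Sum>j\<in>UNIV. h $ j * dphi j x)) (at x)) \<and>
     (\<forall>j. continuous_on UNIV (dphi j)) \<and>
     (\<exists>R. \<forall>x. norm x > R \<longrightarrow> phi x = 0)"

definition weak_grad :: "(real^'n \<Rightarrow> complex) \<Rightarrow> (real^'n \<Rightarrow> complex^'n) \<Rightarrow> bool" where
  "weak_grad u g \<longleftrightarrow>
     (\<forall>K. compact K \<longrightarrow> set_integrable lborel K u) \<and>
     (\<forall>K j. compact K \<longrightarrow> set_integrable lborel K (\<lambda>x. g x $ j)) \<and>
     (\<forall>phi dphi j. test_fun phi dphi \<longrightarrow>
        integral\<^sup>L lborel (\<lambda>x. dphi j x *\<^sub>R u x) = - integral\<^sup>L lborel (\<lambda>x. phi x *\<^sub>R g x $ j))"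

definition in_Wb :: "real \<Rightarrow> (real^'n \<Rightarrow> complex) \<Rightarrow> bool" where
  "in_Wb b u \<longleftrightarrow> wint 0 2 u \<and> (\<exists>g. weak_grad u g \<and> wint b 2 g)"

definition wgrad :: "real \<Rightarrow> (real^'n \<Rightarrow> complex) \<Rightarrow> (real^'n \<Rightarrow> complex^'n)" where
  "wgrad b u = (SOME g. weak_grad u g \<and> wint b 2 g)"

definition grad_norm :: "real \<Rightarrow> (real^'n \<Rightarrow> complex) \<Rightarrow> real" where
  "grad_norm b u = wnorm b 2 (wgrad b u)"

definition W_norm :: "real \<Rightarrow> (real^'n \<Rightarrow> complex) \<Rightarrow> real" where
  "W_norm b u = grad_norm b u + wnorm 0 2 u"

definition radial :: "(real^'n \<Rightarrow> 'v) \<Rightarrow> bool" where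
  "radial u \<longleftrightarrow> (\<forall>x y. norm x = norm y \<longrightarrow> u x = u y)"

definition energy :: "real \<Rightarrow> real \<Rightarrow> real \<Rightarrow> (real^'n \<Rightarrow> complex) \<Rightarrow> real" where
  "energy b c p u = 1/2 * (grad_norm b u)\<^sup>2
     - 1/(p+2) * integral\<^sup>L lborel (\<lambda>x. norm x powr c * cmod (u x) powr (p+2))"

text \<open>Weak (distributional in x) formulation of
  i u_t + div(|x|^b grad u) = -|x|^c |u|^p u on [0,T), with u in C([0,T); W_b^{1,2}):
  for each test function phi, i d/dt <u,phi> = int |x|^b grad u . grad phi - int |x|^c |u|^p u phi.\<close>
definition is_solution :: "real \<Rightarrow> real \<Rightarrow> real \<Rightarrow> (real \<Rightarrow> real^'n \<Rightarrow> complex) \<Rightarrow> real \<Rightarrow> bool" where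
  "is_solution b c p u T \<longleftrightarrow>
     (\<forall>t\<in>{0..<T}. in_Wb b (u t)) \<and>
     (\<forall>t\<in>{0..<T}. ((\<lambda>s. W_norm b (\<lambda>x. u s x - u t x)) \<longlongrightarrow> 0) (at t within {0..<T})) \<and>
     (\<forall>phi dphi. test_fun phi dphi \<longrightarrow> (\<forall>t\<in>{0..<T}.
        ((\<lambda>s. integral\<^sup>L lborel (\<lambda>x. phi x *\<^sub>R u s x)) has_vector_derivative
          (- \<i>) * (integral\<^sup>L lborel (\<lambda>x. norm x powr b *\<^sub>R (\<Sum>j\<in>UNIV. dphi j x *\<^sub>R wgrad b (u t) x $ j))
                  - integral\<^sup>L lborel (\<lambda>x. (norm x powr c * cmod (u t x) powr p * phi x) *\<^sub>R u t x)))
        (at t within {0..<T})))"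

definition gn_ratio :: "real \<Rightarrow> real \<Rightarrow> real \<Rightarrow> (real^'n \<Rightarrow> complex) \<Rightarrow> real" where
  "gn_ratio b c p u =
     (let pc = real CARD('n) * p - 2 * c in
      integral\<^sup>L lborel (\<lambda>x. norm x powr c * cmod (u x) powr (p+2)) /
      (grad_norm b u powr (pc / (2 - b)) * wnorm 0 2 u powr (((2 - b) * (p + 2) - pc) / (2 - b))))"

definition C_GN :: "real \<Rightarrow> real \<Rightarrow> real \<Rightarrow> ('n::finite) itself \<Rightarrow> real" where
  "C_GN b c p _ = Sup {gn_ratio b c p (u :: real^'n \<Rightarrow> complex) | u. in_Wb b u \<and> radial u \<and> wnorm 0 2 u > 0}"

text \<open>Ground state: nonzero radial W_b^{1,2} weak solution of
  div(|x|^b grad Q) + |x|^c |Q|^p Q - Q = 0 which attains the optimal GN constant.\<close>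
definition ground_state :: "real \<Rightarrow> real \<Rightarrow> real \<Rightarrow> (real^'n \<Rightarrow> complex) \<Rightarrow> bool" where
  "ground_state b c p Q \<longleftrightarrow>
     in_Wb b Q \<and> radial Q \<and> wnorm 0 2 Q > 0 \<and>
     (\<forall>phi dphi. test_fun phi dphi \<longrightarrow>
        - integral\<^sup>L lborel (\<lambda>x. norm x powr b *\<^sub>R (\<Sum>j\<in>UNIV. dphi j x *\<^sub>R wgrad b Q x $ j))
        + integral\<^sup>L lborel (\<lambda>x. (norm x powr c * cmod (Q x) powr p * phi x) *\<^sub>R Q x)
        - integral\<^sup>L lborel (\<lambda>x. phi x *\<^sub>R Q x) = 0) \<and>
     gn_ratio b c p Q = C_GN b c p TYPE('n)"

end

theory Submission
  imports Defs
begin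

text \<open>
  A radial function of class \<open>W\<^sub>b\<close> agrees almost everywhere with a continuous profile \<open>F(|x|)\<close>, where
  \<open>F(r)\<close> is a multiple of the integral of the radial flux of the weak gradient over \<open>|x| > r\<close>.
  Cauchy--Schwarz bounds \<open>|F|\<close> by the gradient norm \<open>G\<close>, and averaging over shells gives the Strauss bound
  \<open>|F(r)|\<^sup>2 \<le> K r\<^bsup>1-n-b/2\<^esup> M G\<close> with \<open>M\<close> the \<open>L\<^sup>2\<close> norm. Together they yield the Gagliardo--Nirenberg
  inequality and, because \<open>c < b - 2 + 2n\<close>, smallness of the potential energy outside any ball whose radius is
  large compared with \<open>G\<^bsup>-2/(2-b)\<^esup>\<close>.

  Concentration then needs no compactness. As the energy is conserved and \<open>G\<close> blows up, the potential energy is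
  asymptotic to \<open>(p+2) G\<^sup>2 / 2\<close>; it is carried by the ball of radius \<open>\<lambda>(t)\<close>, and the Gagliardo--Nirenberg
  inequality for \<open>u(t)\<close> times a cutoff to that ball bounds the mass in the ball from below.

  That the optimal constant equals \<open>(p+2) / (2 M\<^sup>p)\<close> for the mass norm \<open>M\<close> of \<open>Q\<close> is obtained without Pohozaev's identity. The Euler--Lagrange
  equation of the maximiser and the elliptic equation for \<open>Q\<close> are two linear relations between the same three
  terms. If the potential energy were not \<open>(p+2) G\<^sup>2 / 2\<close>, they would force \<open>|x|\<^sup>c |Q|\<^sup>p\<close> to be constant where
  \<open>Q\<close> does not vanish, hence everywhere by continuity of the profile, which contradicts the Strauss bound.

  The second claim applies the lower bound on the shrinking balls of radius \<open>G\<^bsup>-1/(2-b)\<^esup>\<close>.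
\<close>

section \<open>Polar coordinates for radial integrals\<close>

text \<open>Two features of the definitions shape the work. \<open>wgrad\<close> is an arbitrary
  choice among weak gradients, so computing \<open>grad_norm\<close> goes through almost-everywhere
  uniqueness of weak gradients; and \<open>C_GN\<close> is a real supremum, which bounds anything
  only once the ratios are known to be bounded. Hence a Gagliardo-Nirenberg inequality with a crude
  constant comes before the optimal one; the crude constant also serves the second claim, where no
  ground state is given. Test functions are only C^1 with compact support, and u is never
  approximated by smooth functions: identities are read off from the defining formulas of the weak
  gradient and of the ground state. Mass criticality enters as c = n p / 2 - 2 + b, and the two
  bounds on c say exactly 0 < p < 4. The exponent 2 / (2 - b) comes from the mass-preserving
  scaling: compressing lengths by a factor s multiplies G by s to the power (2 - b) / 2, so the
  product of a length with G to the power 2 / (2 - b) is scale invariant.\<close>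

definition sphere_area :: "'a::euclidean_space itself \<Rightarrow> real" where
  "sphere_area _ = real DIM('a) * unit_ball_vol (real DIM('a))"

lemma sphere_area_pos: "sphere_area TYPE('a::euclidean_space) > 0"
  by (simp add: sphere_area_def)

text \<open>Half-lines \<open>{..a}\<close> generate the Borel sets and are stable under
  intersection, so the law of the norm is determined by the volumes of balls; the density is the
  derivative of that volume in the radius. For radial integrands this replaces integration over the
  sphere.\<close>

lemma distr_norm_lborel:
  "distr lborel borel (norm :: 'a::euclidean_space \<Rightarrow> real) =
   density lborel (\<lambda>r. ennreal (sphere_area TYPE('a) * r ^ (DIM('a) - 1)) * indicator {0..} r)"
  (is "?M = ?N")
proof (rule measure_eqI_generator_eq[where E = "range (\<lambda>a. {..a::real})" and \<Omega> = UNIV and A = "\<lambda>i. {..real i}"])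
  show "Int_stable (range (\<lambda>a. {..a::real}))"
    by (auto simp: Int_stable_def intro!: image_eqI[where x="min _ _"])
  show "sets ?M = sigma_sets UNIV (range (\<lambda>a. {..a::real}))"
    by (simp, subst borel_eq_atMost, simp)
  then show "sets ?N = sigma_sets UNIV (range (\<lambda>a. {..a::real}))" by simp
  have eqM: "emeasure ?M {..a} = ennreal (unit_ball_vol (real DIM('a)) * a ^ DIM('a))" if "a \<ge> 0" for a
  proof -
    have "norm -` {..a} = cball (0::'a) a" by auto
    then show ?thesis by (subst emeasure_distr) (simp_all add: emeasure_cball that)
  qed
  have M0: "emeasure ?M {..a} = 0" if "a < 0" for a
  proof -
    have "norm -` {..a} = ({} :: 'a set)" using that by auto (meson norm_ge_zero not_le order_trans)
    then show ?thesis by (subst emeasure_distr) simp_all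
  qed
  have eqN: "emeasure ?N {..a} = ennreal (unit_ball_vol (real DIM('a)) * a ^ DIM('a))" if "a \<ge> 0" for a
  proof -
    have "emeasure ?N {..a} = (\<integral>\<^sup>+r. ennreal (sphere_area TYPE('a) * r ^ (DIM('a) - 1)) * indicator {0..a} r \<partial>lborel)"
      by (subst emeasure_density) (auto intro!: nn_integral_cong simp: indicator_def)
    also have "\<dots> = ennreal (unit_ball_vol (real DIM('a)) * a ^ DIM('a) - unit_ball_vol (real DIM('a)) * 0 ^ DIM('a))"
    proof (rule nn_integral_FTC_Icc)
      fix r :: real assume "r \<in> {0..a}"
      then have "0 \<le> r" by simp
      show "((\<lambda>r. unit_ball_vol (real DIM('a)) * r ^ DIM('a)) has_real_derivative sphere_area TYPE('a) * r ^ (DIM('a) - 1)) (at r)"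
        by (auto intro!: derivative_eq_intros simp: sphere_area_def)
      show "0 \<le> sphere_area TYPE('a) * r ^ (DIM('a) - 1)"
        using sphere_area_pos[where 'a='a] \<open>0 \<le> r\<close> by auto
    qed (use that in auto)
    finally show ?thesis by (simp add: zero_power)
  qed
  show "emeasure ?M X = emeasure ?N X" if X: "X \<in> range (\<lambda>a. {..a::real})" for X
  proof -
    obtain a where a: "X = {..a}" using X by auto
    show ?thesis
    proof (cases "a \<ge> 0")
      case True then show ?thesis using a eqM eqN by simp
    next
      case False
      then have "emeasure ?N {..a} = (\<integral>\<^sup>+r. 0 \<partial>(lborel :: real measure))"
        by (subst emeasure_density, simp, simp, intro nn_integral_cong) (auto simp: indicator_def)
      then show ?thesis using a M0 False by simp
    qed
  qed
  show "emeasure ?M {..real i} \<noteq> \<infinity>" for i by (simp add: eqM)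
  show "(\<Union>i. {..real i}) = UNIV" using real_arch_simple by auto
qed auto

lemma nn_integral_norm:
  fixes f :: "real \<Rightarrow> ennreal"
  assumes [measurable]: "f \<in> borel_measurable borel"
  shows "(\<integral>\<^sup>+(x::'a::euclidean_space). f (norm x) \<partial>lborel)
    = (\<integral>\<^sup>+r. f r * ennreal (sphere_area TYPE('a) * r ^ (DIM('a) - 1)) * indicator {0..} r \<partial>lborel)"
proof -
  have "(\<integral>\<^sup>+(x::'a). f (norm x) \<partial>lborel) = (\<integral>\<^sup>+r. f r \<partial>distr lborel borel (norm :: 'a \<Rightarrow> real))"
    by (subst nn_integral_distr) auto
  also have "\<dots> = (\<integral>\<^sup>+r. f r * ennreal (sphere_area TYPE('a) * r ^ (DIM('a) - 1)) * indicator {0..} r \<partial>lborel)"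
    unfolding distr_norm_lborel by (subst nn_integral_density) (auto simp: ac_simps)
  finally show ?thesis .
qed

lemma polar_density_eq: "(\<lambda>r. ennreal (k * r ^ m) * indicator {0..} r) = (\<lambda>r::real. ennreal (k * r ^ m * indicator {0..} r))"
  by (auto simp: indicator_def)

lemma integrable_norm_iff:
  fixes f :: "real \<Rightarrow> 'b::{banach, second_countable_topology}"
  assumes [measurable]: "f \<in> borel_measurable borel"
  shows "integrable lborel (\<lambda>x::'a::euclidean_space. f (norm x))
    \<longleftrightarrow> integrable lborel (\<lambda>r. (sphere_area TYPE('a) * r ^ (DIM('a) - 1) * indicator {0..} r) *\<^sub>R f r)"
proof -
  have "integrable lborel (\<lambda>x::'a. f (norm x)) \<longleftrightarrow> integrable (distr lborel borel (norm :: 'a \<Rightarrow> real)) f"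
    by (subst integrable_distr_eq) auto
  also have "\<dots> \<longleftrightarrow> integrable lborel (\<lambda>r. (sphere_area TYPE('a) * r ^ (DIM('a) - 1) * indicator {0..} r) *\<^sub>R f r)"
    unfolding distr_norm_lborel polar_density_eq
    using sphere_area_pos[where 'a='a]
    by (subst integrable_density) (auto simp: indicator_def)
  finally show ?thesis .
qed

lemma integral_norm:
  fixes f :: "real \<Rightarrow> 'b::{banach, second_countable_topology}"
  assumes [measurable]: "f \<in> borel_measurable borel"
  shows "(\<integral>(x::'a::euclidean_space). f (norm x) \<partial>lborel)
    = (\<integral>r. (sphere_area TYPE('a) * r ^ (DIM('a) - 1) * indicator {0..} r) *\<^sub>R f r \<partial>lborel)"
proof -
  have "(\<integral>(x::'a). f (norm x) \<partial>lborel) = (\<integral>r. f r \<partial>distr lborel borel (norm :: 'a \<Rightarrow> real))"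
    by (subst integral_distr) auto
  also have "\<dots> = (\<integral>r. (sphere_area TYPE('a) * r ^ (DIM('a) - 1) * indicator {0..} r) *\<^sub>R f r \<partial>lborel)"
    unfolding distr_norm_lborel polar_density_eq
    using sphere_area_pos[where 'a='a]
    by (subst integral_density) (auto simp: indicator_def)
  finally show ?thesis .
qed

text \<open>The law of the norm has a density and is carried, up to a null set, by the positive
  half-line, so a null set of positive radii pulls back to a null set of points.\<close>

lemma AE_norm:
  assumes "AE r in lborel. r > 0 \<longrightarrow> P r" and [measurable]: "Measurable.pred borel P"
  shows "AE x in (lborel :: 'a::euclidean_space measure). P (norm x)"
proof -
  have "AE r in distr lborel borel (norm :: 'a \<Rightarrow> real). P r"
    unfolding distr_norm_lborel
  proof (subst AE_density)
    show "AE r in lborel. 0 < ennreal (sphere_area TYPE('a) * r ^ (DIM('a) - 1)) * indicator {0..} r \<longrightarrow> P r"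
      using assms(1) AE_lborel_singleton[of 0] by eventually_elim (auto simp: indicator_def split: if_splits)
  qed auto
  then show ?thesis by (subst (asm) AE_distr_iff) auto
qed

lemma nn_integral_norm_powr_outside:
  assumes "r > 0" "s < - real DIM('a)"
  shows "(\<integral>\<^sup>+(x::'a::euclidean_space). ennreal (norm x powr s) * indicator {r..} (norm x) \<partial>lborel)
    = ennreal (sphere_area TYPE('a) / (- (s + real DIM('a))) * r powr (s + real DIM('a)))"
proof -
  define n where "n = real DIM('a)"
  let ?k = "sphere_area TYPE('a)"
  have k: "?k > 0" by (rule sphere_area_pos)
  have "(\<integral>\<^sup>+(x::'a). ennreal (norm x powr s) * indicator {r..} (norm x) \<partial>lborel)
     = (\<integral>\<^sup>+t. ennreal (?k * t powr (s + n - 1)) * indicator {r..} t \<partial>lborel)"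
    apply (subst nn_integral_norm)
     apply measurable
    apply (rule nn_integral_cong)
    using assms(1) k
    by (auto simp: indicator_def ennreal_mult[symmetric] powr_add powr_diff n_def of_nat_diff
             simp flip: powr_realpow  split: if_splits)
  also have "\<dots> = ennreal (0 - ?k / (s + n) * r powr (s + n))"
  proof (rule nn_integral_FTC_atLeast)
    fix t assume t: "r \<le> t"
    show "((\<lambda>t. ?k / (s + n) * t powr (s + n)) has_real_derivative ?k * t powr (s + n - 1)) (at t)"
      using t assms by (auto intro!: derivative_eq_intros simp: n_def powr_diff)
    show "0 \<le> ?k * t powr (s + n - 1)" using k by simp
  next
    have "((\<lambda>t. t powr (s + n)) \<longlongrightarrow> 0) at_top"
      using assms by (intro tendsto_neg_powr filterlim_ident) (auto simp: n_def)
    from tendsto_mult_left[OF this, of "?k / (s + n)"]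
    show "((\<lambda>t. ?k / (s + n) * t powr (s + n)) \<longlongrightarrow> 0) at_top" by simp
  qed auto
  finally show ?thesis by (simp add: n_def minus_divide_right[symmetric] del: minus_add_distrib)
qed

lemma nn_integral_norm_powr_inside:
  assumes "r \<ge> 0" "s > - real DIM('a)"
  shows "(\<integral>\<^sup>+(x::'a::euclidean_space). ennreal (norm x powr s) * indicator {..r} (norm x) \<partial>lborel)
    = ennreal (sphere_area TYPE('a) / (s + real DIM('a)) * r powr (s + real DIM('a)))"
proof -
  define n where "n = real DIM('a)"
  let ?k = "sphere_area TYPE('a)"
  have k: "?k > 0" by (rule sphere_area_pos)
  have "((\<lambda>t. t powr (s + n - 1)) has_integral (r powr (s + n - 1 + 1) / (s + n - 1 + 1))) {0..r}"
    using assms by (intro has_integral_powr_from_0) (auto simp: n_def)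
  from has_integral_mult_right[OF this, of ?k]
  have hi: "((\<lambda>t. ?k * t powr (s + n - 1)) has_integral (?k / (s + n) * r powr (s + n))) {0..r}"
    by simp
  have "(\<integral>\<^sup>+(x::'a). ennreal (norm x powr s) * indicator {..r} (norm x) \<partial>lborel)
     = (\<integral>\<^sup>+t. ennreal (?k * t powr (s + n - 1)) * indicator {0..r} t \<partial>lborel)"
    apply (subst nn_integral_norm)
     apply measurable
    apply (rule nn_integral_cong_AE)
    using AE_lborel_singleton[of 0]
    apply eventually_elim
    using k
    by (auto simp: indicator_def ennreal_mult[symmetric] powr_add powr_diff n_def of_nat_diff
             simp flip: powr_realpow  split: if_splits)
  also have "\<dots> = ennreal (?k / (s + n) * r powr (s + n))"
    by (rule nn_integral_has_integral_lebesgue'[OF _ hi]) (use k in auto)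
  finally show ?thesis by (simp add: n_def)
qed

section \<open>The fundamental lemma of the calculus of variations\<close>

text \<open>The squared positive part is C^1, which is all the smoothness that
  \<open>test_fun\<close> asks for; the bumps and cutoffs below are built from it.\<close>

lemma DERIV_pos_part_sq: "((\<lambda>s::real. (max 0 s)\<^sup>2) has_real_derivative 2 * max 0 s) (at s)"
proof (cases s "0::real" rule: linorder_cases)
  case less
  have "((\<lambda>s::real. 0) has_real_derivative 2 * max 0 s) (at s)"
    using less by (auto intro!: derivative_eq_intros)
  then show ?thesis
    by (rule has_field_derivative_transform_within_open[of _ _ _ "{..<0}"]) (use less in auto)
next
  case equal
  have "((\<lambda>h::real. (max 0 h)\<^sup>2 / h) \<longlongrightarrow> 0) (at 0)"
  proof (rule Lim_null_comparison)
    show "\<forall>\<^sub>F h in at 0. norm ((max 0 h)\<^sup>2 / h) \<le> \<bar>h::real\<bar>"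
      by (rule always_eventually) (auto simp: max_def power2_eq_square)
    show "((\<lambda>h::real. \<bar>h\<bar>) \<longlongrightarrow> 0) (at 0)"
      using tendsto_rabs_zero[OF tendsto_ident_at[of "0::real" UNIV]] by simp
  qed
  then show ?thesis using equal by (simp add: DERIV_def)
next
  case greater
  have "((\<lambda>s::real. s\<^sup>2) has_real_derivative 2 * max 0 s) (at s)"
    using greater by (auto intro!: derivative_eq_intros)
  then show ?thesis
    by (rule has_field_derivative_transform_within_open[of _ _ _ "{0<..}"]) (use greater in auto)
qed

lemma has_derivative_pos_part_sq[derivative_intros]:
  assumes "(f has_derivative f') (at x)"
  shows "((\<lambda>x. (max 0 (f x :: real))\<^sup>2) has_derivative (\<lambda>h. 2 * max 0 (f x) * f' h)) (at x)"
  using DERIV_compose_FDERIV[OF DERIV_pos_part_sq assms] by (simp add: ac_simps)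

text \<open>Stated over an arbitrary Euclidean space because the fundamental lemma is applied both
  on \<open>real^'n\<close> and on the line of radii, whereas \<open>test_fun\<close> lives on
  \<open>real^'n\<close>.\<close>

definition C1_fun :: "('a::euclidean_space \<Rightarrow> real) \<Rightarrow> bool" where
  "C1_fun f \<longleftrightarrow> (\<exists>D. continuous_on UNIV D \<and> (\<forall>x. (f has_derivative (\<lambda>h. h \<bullet> D x)) (at x)))"

lemma C1_funI:
  assumes "continuous_on UNIV D" "\<And>x. (f has_derivative (\<lambda>h. h \<bullet> D x)) (at x)"
  shows "C1_fun f"
  using assms unfolding C1_fun_def by blast

lemma C1_fun_bump: "C1_fun (\<lambda>x::'a::euclidean_space. (max 0 (r\<^sup>2 - (norm (x - a))\<^sup>2))\<^sup>2)"
proof (rule C1_funI)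
  let ?D = "\<lambda>x. (- 4 * max 0 (r\<^sup>2 - (norm (x - a))\<^sup>2)) *\<^sub>R (x - a)"
  show "continuous_on UNIV ?D" by (intro continuous_intros)
  show "((\<lambda>x::'a. (max 0 (r\<^sup>2 - (norm (x - a))\<^sup>2))\<^sup>2) has_derivative (\<lambda>h. h \<bullet> ?D x)) (at x)" for x
    unfolding power2_norm_eq_inner
    by (rule derivative_eq_intros | simp)+
       (auto simp: fun_eq_iff inner_commute algebra_simps)
qed

lemma C1_fun_add:
  assumes "C1_fun f" "C1_fun g" shows "C1_fun (\<lambda>x. f x + g x)"
proof -
  obtain D E where "continuous_on UNIV D" "\<And>x. (f has_derivative (\<lambda>h. h \<bullet> D x)) (at x)"
    "continuous_on UNIV E" "\<And>x. (g has_derivative (\<lambda>h. h \<bullet> E x)) (at x)"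
    using assms unfolding C1_fun_def by blast
  then show ?thesis
    by (intro C1_funI[of "\<lambda>x. D x + E x"])
       (auto intro!: continuous_intros derivative_eq_intros simp: inner_add_right)
qed

lemma C1_fun_sum:
  assumes "finite I" "\<And>i. i \<in> I \<Longrightarrow> C1_fun (f i)" shows "C1_fun (\<lambda>x. \<Sum>i\<in>I. f i x)"
  using assms
proof (induction I rule: finite_induct)
  case empty
  show ?case by (rule C1_funI[of "\<lambda>_. 0"]) auto
qed (auto intro!: C1_fun_add)

lemma C1_fun_continuous: "C1_fun f \<Longrightarrow> continuous_on UNIV f"
  unfolding C1_fun_def
  by (meson continuous_at_imp_continuous_on has_derivative_continuous)

text \<open>For growing \<open>k\<close> the quotient tends to 1 where \<open>f\<close> is positive
  and stays 0 where \<open>f\<close> is 0, so a sum of bumps becomes an approximate indicator with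
  values below 1.\<close>

lemma C1_fun_saturate:
  assumes "C1_fun f" "\<And>x. f x \<ge> 0" "k \<ge> 0"
  shows "C1_fun (\<lambda>x. k * f x / (1 + k * f x))"
proof -
  obtain D where D: "continuous_on UNIV D" "\<And>x. (f has_derivative (\<lambda>h. h \<bullet> D x)) (at x)"
    using assms unfolding C1_fun_def by blast
  have pos: "1 + k * f x > 0" for x using assms(2)[of x] assms(3) by (simp add: add_pos_nonneg)
  note cf = C1_fun_continuous[OF assms(1)]
  have ne: "1 + k * f x \<noteq> 0" for x using pos[of x] by simp
  have "((\<lambda>s. k * s / (1 + k * s)) has_real_derivative k / (1 + k * f x)\<^sup>2) (at (f x))" for x
    using ne[of x] by (auto intro!: derivative_eq_intros simp: field_simps power2_eq_square)
  from DERIV_compose_FDERIV[OF this D(2)]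
  show ?thesis
    by (intro C1_funI[of "\<lambda>x. (k / (1 + k * f x)\<^sup>2) *\<^sub>R D x"])
       (auto intro!: continuous_intros cf D(1) simp: ne ac_simps)
qed

text \<open>An open set is a countable union of balls whose closures lie inside it. The sum of bumps
  on the first \<open>k\<close> balls is positive exactly on their union; saturating it with growing
  weight drives it to the indicator while the support stays in a compact subset.\<close>

lemma open_indicator_C1_approx:
  fixes U :: "'a::euclidean_space set"
  assumes "open U"
  obtains \<phi> :: "nat \<Rightarrow> 'a \<Rightarrow> real" and K where
    "\<And>k. C1_fun (\<phi> k)" "\<And>k x. 0 \<le> \<phi> k x" "\<And>k x. \<phi> k x \<le> 1"
    "\<And>k. compact (K k)" "\<And>k. K k \<subseteq> U" "\<And>k x. x \<notin> K k \<Longrightarrow> \<phi> k x = 0"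
    "\<And>x. (\<lambda>k. \<phi> k x) \<longlonglongrightarrow> indicator U x"
proof (cases "U = {}")
  case True
  show thesis
    by (rule that[of "\<lambda>_ _. 0" "\<lambda>_. {}"]) (auto simp: True intro: C1_funI[of "\<lambda>_. 0"])
next
  case ne: False
  define \<F> where "\<F> = {ball a r | a r. r > 0 \<and> cball a r \<subseteq> U}"
  have "\<Union>\<F> = U"
  proof (intro set_eqI iffI)
    fix x assume "x \<in> U"
    then obtain e where "e > 0" "cball x e \<subseteq> U" using assms open_contains_cball by blast
    then show "x \<in> \<Union>\<F>" unfolding \<F>_def by (auto intro!: exI[of _ "ball x e"])
  next
    fix x assume "x \<in> \<Union>\<F>"
    then show "x \<in> U" unfolding \<F>_def using ball_subset_cball by blast
  qed
  moreover have "\<And>S. S \<in> \<F> \<Longrightarrow> open S" unfolding \<F>_def by auto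
  ultimately obtain \<F>' where F': "\<F>' \<subseteq> \<F>" "countable \<F>'" "\<Union>\<F>' = U"
    using Lindelof[of \<F>] by metis
  define S where "S = from_nat_into \<F>'"
  have S: "range S = \<F>'"
    unfolding S_def using F' ne by (intro range_from_nat_into) auto
  have "\<exists>a r. S i = ball a r \<and> r > 0 \<and> cball a r \<subseteq> U" for i
  proof -
    have "S i \<in> \<F>" using S F'(1) by blast
    then show ?thesis unfolding \<F>_def by blast
  qed
  then obtain a r where ar: "\<And>i. S i = ball (a i) (r i)" "\<And>i. r i > 0" "\<And>i. cball (a i) (r i) \<subseteq> U"
    by metis
  have UU: "(\<Union>i. S i) = U" using S F'(3) by simp
  define \<eta> where "\<eta> k x = (\<Sum>i\<le>k. (max 0 ((r i)\<^sup>2 - (norm (x - a i))\<^sup>2))\<^sup>2)" for k :: nat and x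
  have eta: "C1_fun (\<eta> k)" "\<eta> k x \<ge> 0" for k x
    unfolding \<eta>_def by (auto intro!: C1_fun_sum C1_fun_bump sum_nonneg)
  define K where "K k = (\<Union>i\<le>k. cball (a i) (r i))" for k :: nat
  have cK: "compact (K k)" for k unfolding K_def by (intro compact_UN) auto
  have bump0: "max 0 ((r i)\<^sup>2 - (norm (x - a i))\<^sup>2) = 0" if "x \<notin> S i" for x i
    using that ar(2)[of i] unfolding ar(1)
    by (auto simp: max_def dist_norm norm_minus_commute intro!: power_mono)
  have eta0: "\<eta> k x = 0" if "x \<notin> K k" for k x
    unfolding \<eta>_def
  proof (rule sum.neutral, rule ballI)
    fix i assume "i \<in> {..k}"
    have "x \<notin> S i" using that ar(1)[of i] \<open>i \<in> {..k}\<close> unfolding K_def by fastforce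
    then show "(max 0 ((r i)\<^sup>2 - (norm (x - a i))\<^sup>2))\<^sup>2 = 0" using bump0 by simp
  qed
  define \<phi> where "\<phi> k x = real k * \<eta> k x / (1 + real k * \<eta> k x)" for k x
  show thesis
  proof (rule that[of \<phi> K])
    show "C1_fun (\<phi> k)" for k unfolding \<phi>_def by (rule C1_fun_saturate) (auto intro: eta)
    show "0 \<le> \<phi> k x" "\<phi> k x \<le> 1" for k x
      using eta(2)[of k x] by (auto simp: \<phi>_def divide_le_eq add_pos_nonneg)
    show "compact (K k)" for k by (rule cK)
    show "K k \<subseteq> U" for k unfolding K_def using ar(3) by auto
    show "\<phi> k x = 0" if "x \<notin> K k" for k x using eta0[OF that] by (simp add: \<phi>_def)
    show "(\<lambda>k. \<phi> k x) \<longlonglongrightarrow> indicator U x" for x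
    proof (cases "x \<in> U")
      case False
      then have "x \<notin> K k" for k unfolding K_def using ar(3) by blast
      then show ?thesis using False eta0 by (simp add: \<phi>_def)
    next
      case True
      then obtain i where i: "x \<in> S i" using UU by auto
      define d where "d = (max 0 ((r i)\<^sup>2 - (norm (x - a i))\<^sup>2))\<^sup>2"
      have "norm (x - a i) < r i" using i unfolding ar(1) by (simp add: dist_norm norm_minus_commute)
      then have "(norm (x - a i))\<^sup>2 < (r i)\<^sup>2" by (intro power_strict_mono) auto
      then have d: "d > 0" unfolding d_def by simp
      \<comment> \<open>From index \<open>i\<close> on, the sum contains the fixed positive bump
        \<open>d\<close>, so monotonicity of s / (1 + s) gives a lower bound that tends to
        1.\<close>
      have ge: "\<eta> k x \<ge> d" if "k \<ge> i" for k
        unfolding \<eta>_def d_def using that by (intro member_le_sum) auto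
      have lim: "(\<lambda>k. real k * d / (1 + real k * d)) \<longlonglongrightarrow> 1"
      proof -
        have "filterlim (\<lambda>k. 1 + real k * d) at_top sequentially"
          using d by (intro filterlim_tendsto_add_at_top[OF tendsto_const]
             filterlim_at_top_mult_tendsto_pos[OF tendsto_const] filterlim_real_sequentially) auto
        then have "(\<lambda>k. 1 - 1 / (1 + real k * d)) \<longlonglongrightarrow> 1 - 0"
          by (intro tendsto_intros tendsto_divide_0[OF tendsto_const])
             (auto intro: filterlim_at_top_imp_at_infinity)
        moreover have "1 - 1 / (1 + real k * d) = real k * d / (1 + real k * d)" for k
          using d by (simp add: field_simps add_pos_nonneg less_imp_neq[symmetric])
        ultimately show ?thesis by simp
      qed
      have "(\<lambda>k. \<phi> k x) \<longlonglongrightarrow> 1"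
      proof (rule tendsto_sandwich[OF _ _ lim tendsto_const])
        show "\<forall>\<^sub>F k in sequentially. real k * d / (1 + real k * d) \<le> \<phi> k x"
          using eventually_ge_at_top[of i]
        proof eventually_elim
          case (elim k)
          have frac_mono: "s / (1 + s) \<le> t / (1 + t)" if "0 \<le> s" "s \<le> t" for s t :: real
            using that by (simp add: divide_simps) (simp add: algebra_simps)
          show ?case unfolding \<phi>_def
            by (rule frac_mono) (use d ge[OF elim] in \<open>auto intro!: mult_left_mono\<close>)
        qed
        show "\<forall>\<^sub>F k in sequentially. \<phi> k x \<le> 1"
          using eta(2) by (auto simp: \<phi>_def divide_le_eq add_pos_nonneg intro!: always_eventually)
      qed
      then show ?thesis using True by simp
    qed
  qed
qed

text \<open>\<open>ennreal\<close> truncates negative reals to 0, so \<open>v\<close> and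
  \<open>- v\<close> read as densities are the positive and negative parts. The two finite measures
  agree on open sets, a generator closed under intersection, hence everywhere, and so their
  densities agree almost everywhere; the two parts can coincide only where \<open>v\<close> is
  0.\<close>

lemma AE_zero_if_open_integrals_zero:
  fixes v :: "'a::euclidean_space \<Rightarrow> real"
  assumes v: "integrable lborel v"
    and zero: "\<And>A. open A \<Longrightarrow> (\<integral>x. indicator A x * v x \<partial>lborel) = 0"
  shows "AE x in lborel. v x = 0"
proof -
  have [measurable]: "v \<in> borel_measurable borel" using v by simp
  have em: "emeasure (density lborel (\<lambda>x. ennreal (w x))) A = ennreal (\<integral>x. indicator A x * max 0 (w x) \<partial>lborel)"
    if w: "integrable lborel w" and [measurable]: "A \<in> sets borel" for w :: "'a \<Rightarrow> real" and A
  proof -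
    have [measurable]: "w \<in> borel_measurable borel" using w by simp
    have "emeasure (density lborel (\<lambda>x. ennreal (w x))) A = (\<integral>\<^sup>+x. ennreal (indicator A x * max 0 (w x)) \<partial>lborel)"
      by (subst emeasure_density) (auto intro!: nn_integral_cong simp: indicator_def max_def ennreal_neg)
    also have "\<dots> = ennreal (\<integral>x. indicator A x * max 0 (w x) \<partial>lborel)"
    proof (rule nn_integral_eq_integral)
      show "integrable lborel (\<lambda>x. indicator A x * max 0 (w x))"
        by (rule Bochner_Integration.integrable_bound[OF w]) (auto simp: indicator_def)
    qed auto
    finally show ?thesis .
  qed
  have nv: "integrable lborel (\<lambda>x. - v x)" using v by simp
  have "density lborel (\<lambda>x. ennreal (v x)) = density lborel (\<lambda>x. ennreal (- v x))"
  proof (rule measure_eqI_generator_eq[where E = "{A. open A}" and \<Omega> = UNIV and A = "\<lambda>_. UNIV"])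
    show "Int_stable {A::'a set. open A}" by (auto simp: Int_stable_def)
    show "emeasure (density lborel (\<lambda>x. ennreal (v x))) X = emeasure (density lborel (\<lambda>x. ennreal (- v x))) X"
      if "X \<in> {A. open A}" for X
    proof -
      have X: "open X" using that by simp
      then have [measurable]: "X \<in> sets borel" by simp
      have i: "integrable lborel (\<lambda>x. indicator X x * max 0 (v x))" "integrable lborel (\<lambda>x. indicator X x * max 0 (- v x))"
        by (rule Bochner_Integration.integrable_bound[OF v]; auto simp: indicator_def)+
      have "(\<integral>x. indicator X x * max 0 (v x) \<partial>lborel) - (\<integral>x. indicator X x * max 0 (- v x) \<partial>lborel)
         = (\<integral>x. indicator X x * v x \<partial>lborel)"
        by (subst Bochner_Integration.integral_diff[OF i, symmetric])
           (auto intro!: Bochner_Integration.integral_cong simp: max_def indicator_def)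
      then show ?thesis using zero[OF X] by (simp add: em v nv)
    qed
    show "emeasure (density lborel (\<lambda>x. ennreal (v x))) UNIV \<noteq> \<infinity>" by (subst em[OF v]) auto
  qed (auto simp: borel_def)
  moreover have "integral\<^sup>N lborel (\<lambda>x. ennreal (v x)) \<noteq> \<infinity>"
    using em[OF v, of UNIV] by (simp add: emeasure_density)
  ultimately have "AE x in lborel. ennreal (v x) = ennreal (- v x)"
    by (subst (asm) finite_density_unique) auto
  then show ?thesis
  proof eventually_elim
    case (elim x)
    then show ?case by (cases "v x \<ge> 0") (auto simp: ennreal_neg ennreal_eq_0_iff dest: sym)
  qed
qed

text \<open>On a ball whose closure lies in \<open>U\<close> the function is integrable, so
  approximate indicators of an open subset pass to the limit by dominated convergence. The preceding
  lemma then gives 0 on the ball, and countably many such balls cover \<open>U\<close>.\<close>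

lemma fundamental_lemma_real:
  fixes w :: "'a::euclidean_space \<Rightarrow> real"
  assumes U: "open U" and [measurable]: "w \<in> borel_measurable borel"
    and loc: "\<And>K. compact K \<Longrightarrow> K \<subseteq> U \<Longrightarrow> set_integrable lborel K w"
    and zero: "\<And>\<phi> K. C1_fun \<phi> \<Longrightarrow> compact K \<Longrightarrow> K \<subseteq> U \<Longrightarrow> (\<And>x. x \<notin> K \<Longrightarrow> \<phi> x = 0)
      \<Longrightarrow> (\<integral>x. \<phi> x * w x \<partial>lborel) = 0"
  shows "AE x in lborel. x \<in> U \<longrightarrow> w x = 0"
proof -
  have main: "AE x in lborel. indicator (ball a r) x * w x = 0" if ar: "cball a r \<subseteq> U" for a r
  proof (rule AE_zero_if_open_integrals_zero)
    have int: "integrable lborel (\<lambda>x. indicator (cball a r) x * w x)"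
      using loc[OF compact_cball ar] by (simp add: set_integrable_def)
    show "integrable lborel (\<lambda>x. indicator (ball a r) x * w x)"
      by (rule Bochner_Integration.integrable_bound[OF int]) (auto simp: indicator_def)
    fix A :: "'a set" assume A: "open A"
    define V where "V = A \<inter> ball a r"
    have "open V" unfolding V_def using A by auto
    then obtain \<phi> K where phi:
      "\<And>k. C1_fun (\<phi> k)" "\<And>k x. 0 \<le> \<phi> k x" "\<And>k x. \<phi> k x \<le> 1"
      "\<And>k. compact (K k)" "\<And>k. K k \<subseteq> V" "\<And>k x. x \<notin> K k \<Longrightarrow> \<phi> k x = 0"
      "\<And>x. (\<lambda>k. \<phi> k x) \<longlonglongrightarrow> indicator V x"
      using open_indicator_C1_approx[of V] by blast
    have [measurable]: "\<phi> k \<in> borel_measurable borel" for k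
      using C1_fun_continuous[OF phi(1)] by (rule borel_measurable_continuous_onI)
    have [measurable]: "V \<in> sets borel" using \<open>open V\<close> by simp
    have "(\<lambda>k. \<integral>x. \<phi> k x * w x \<partial>lborel) \<longlonglongrightarrow> (\<integral>x. indicator V x * w x \<partial>lborel)"
    proof (rule integral_dominated_convergence[where w = "\<lambda>x. norm (indicator (cball a r) x * w x)"])
      show "integrable lborel (\<lambda>x. norm (indicator (cball a r) x * w x))" using int by (rule integrable_norm)
      show "AE x in lborel. (\<lambda>k. \<phi> k x * w x) \<longlonglongrightarrow> indicator V x * w x"
        by (intro AE_I2 tendsto_intros phi)
      show "AE x in lborel. norm (\<phi> k x * w x) \<le> norm (indicator (cball a r) x * w x)" for k
      proof (intro AE_I2)
        fix x
        show "norm (\<phi> k x * w x) \<le> norm (indicator (cball a r) x * w x)"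
        proof (cases "x \<in> K k")
          case True
          then have "x \<in> cball a r" using phi(5)[of k] unfolding V_def by auto
          then show ?thesis using phi(2,3)[of k x] by (simp add: abs_mult mult_left_le_one_le)
        qed (simp add: phi(6))
      qed
    qed auto
    moreover have "(\<integral>x. \<phi> k x * w x \<partial>lborel) = 0" for k
    proof (rule zero[OF phi(1) phi(4) _ phi(6)])
      show "K k \<subseteq> U" using phi(5)[of k] ar ball_subset_cball[of a r] unfolding V_def by blast
    qed
    ultimately have "(\<integral>x. indicator V x * w x \<partial>lborel) = 0" by (simp add: LIMSEQ_const_iff)
    then show "(\<integral>x. indicator A x * (indicator (ball a r) x * w x) \<partial>lborel) = 0"
      by (simp add: V_def indicator_inter_arith mult.assoc)
  qed
  define \<F> where "\<F> = {ball a r | a r. cball a r \<subseteq> U}"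
  have "\<And>S. S \<in> \<F> \<Longrightarrow> open S" unfolding \<F>_def by auto
  then obtain \<F>' where F': "\<F>' \<subseteq> \<F>" "countable \<F>'" "\<Union>\<F>' = \<Union>\<F>"
    using Lindelof[of \<F>] by metis
  have "U \<subseteq> \<Union>\<F>"
  proof
    fix x assume "x \<in> U"
    then obtain e where "e > 0" "cball x e \<subseteq> U" using U open_contains_cball by blast
    then show "x \<in> \<Union>\<F>" unfolding \<F>_def by (auto intro!: exI[of _ "ball x e"])
  qed
  have "AE x in lborel. \<forall>S\<in>\<F>'. indicator S x * w x = 0"
    using F'(1) main by (subst AE_ball_countable[OF F'(2)]) (auto simp: \<F>_def)
  then show ?thesis
  proof eventually_elim
    case (elim x)
    show ?case
    proof
      assume "x \<in> U"
      then obtain S where "S \<in> \<F>'" "x \<in> S" using F'(3) \<open>U \<subseteq> \<Union>\<F>\<close> by blast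
      then show "w x = 0" using elim by force
    qed
  qed
qed

lemma fundamental_lemma_complex:
  fixes w :: "'a::euclidean_space \<Rightarrow> complex"
  assumes U: "open U" and [measurable]: "w \<in> borel_measurable borel"
    and loc: "\<And>K. compact K \<Longrightarrow> K \<subseteq> U \<Longrightarrow> set_integrable lborel K w"
    and zero: "\<And>\<phi> K. C1_fun \<phi> \<Longrightarrow> compact K \<Longrightarrow> K \<subseteq> U \<Longrightarrow> (\<And>x. x \<notin> K \<Longrightarrow> \<phi> x = 0)
      \<Longrightarrow> (\<integral>x. \<phi> x *\<^sub>R w x \<partial>lborel) = 0"
  shows "AE x in lborel. x \<in> U \<longrightarrow> w x = 0"
proof -
  have int: "integrable lborel (\<lambda>x. \<phi> x *\<^sub>R w x)"
    if "C1_fun \<phi>" "compact K" "K \<subseteq> U" "\<And>x. x \<notin> K \<Longrightarrow> \<phi> x = 0" for \<phi> K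
  proof -
    have c: "continuous_on UNIV \<phi>" using that(1) by (rule C1_fun_continuous)
    then have [measurable]: "\<phi> \<in> borel_measurable borel" by (rule borel_measurable_continuous_onI)
    have "compact (\<phi> ` K)" using c that(2) by (meson compact_continuous_image continuous_on_subset subset_UNIV)
    then obtain B where B: "\<And>x. x \<in> K \<Longrightarrow> \<bar>\<phi> x\<bar> \<le> B"
      using compact_imp_bounded[THEN bounded_pos[THEN iffD1]] by fastforce
    have "integrable lborel (\<lambda>x. B *\<^sub>R (indicator K x *\<^sub>R w x))"
      using loc[OF that(2,3)] unfolding set_integrable_def by (rule integrable_scaleR_right)
    then show ?thesis
      by (rule Bochner_Integration.integrable_bound)
         (auto simp: indicator_def that(4) abs_mult intro!: AE_I2 mult_right_mono order.trans[OF B])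
  qed
  have Re: "AE x in lborel. x \<in> U \<longrightarrow> Re (w x) = 0"
  proof (rule fundamental_lemma_real[OF U])
    show "set_integrable lborel K (\<lambda>x. Re (w x))" if "compact K" "K \<subseteq> U" for K
      using integrable_Re[OF loc[OF that, unfolded set_integrable_def]] by (simp add: set_integrable_def)
    show "(\<integral>x. \<phi> x * Re (w x) \<partial>lborel) = 0"
      if "C1_fun \<phi>" "compact K" "K \<subseteq> U" "\<And>x. x \<notin> K \<Longrightarrow> \<phi> x = 0" for \<phi> K
      using integral_Re[OF int[OF that]] zero[OF that] by simp
  qed auto
  have Im: "AE x in lborel. x \<in> U \<longrightarrow> Im (w x) = 0"
  proof (rule fundamental_lemma_real[OF U])
    show "set_integrable lborel K (\<lambda>x. Im (w x))" if "compact K" "K \<subseteq> U" for K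
      using integrable_Im[OF loc[OF that, unfolded set_integrable_def]] by (simp add: set_integrable_def)
    show "(\<integral>x. \<phi> x * Im (w x) \<partial>lborel) = 0"
      if "C1_fun \<phi>" "compact K" "K \<subseteq> U" "\<And>x. x \<notin> K \<Longrightarrow> \<phi> x = 0" for \<phi> K
      using integral_Im[OF int[OF that]] zero[OF that] by simp
  qed auto
  from Re Im show ?thesis by eventually_elim (auto simp: complex_eq_iff)
qed

section \<open>Uniqueness of the weak gradient\<close>

lemma test_fun_C1:
  assumes "C1_fun (\<phi> :: real^'n \<Rightarrow> real)" "bounded {x. \<phi> x \<noteq> 0}"
  obtains d where "test_fun \<phi> d"
proof -
  obtain D where D: "continuous_on UNIV D" "\<And>x. (\<phi> has_derivative (\<lambda>h. h \<bullet> D x)) (at x)"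
    using assms(1) unfolding C1_fun_def by blast
  obtain R where "\<And>x. \<phi> x \<noteq> 0 \<Longrightarrow> norm x \<le> R" using assms(2) by (auto simp: bounded_iff)
  then have "test_fun \<phi> (\<lambda>j x. D x $ j)"
    unfolding test_fun_def using D
    by (auto simp: inner_vec_def intro!: continuous_intros exI[of _ R]) (meson not_le)
  then show thesis by (rule that)
qed

lemma borel_measurable_vec_nth_compose[measurable]:
  fixes f :: "'a \<Rightarrow> ('b::{second_countable_topology, real_normed_vector})^'n"
  assumes "f \<in> borel_measurable M"
  shows "(\<lambda>x. f x $ j) \<in> borel_measurable M"
  by (rule measurable_compose[OF assms borel_measurable_continuous_onI]) (intro continuous_intros)

text \<open>This is what makes \<open>grad_norm\<close>, defined through a choice of weak gradient,
  a function of \<open>u\<close> alone: the difference of two weak gradients integrates to 0 against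
  every test function.\<close>

lemma weak_grad_unique:
  fixes u :: "real^'n \<Rightarrow> complex"
  assumes g: "weak_grad u g" "g \<in> borel_measurable borel"
    and h: "weak_grad u h" "h \<in> borel_measurable borel"
  shows "AE x in lborel. g x = h x"
proof -
  note [measurable] = g(2) h(2)
  have "AE x in lborel. x \<in> UNIV \<longrightarrow> g x $ j - h x $ j = 0" for j
  proof (rule fundamental_lemma_complex)
    show m: "(\<lambda>x. g x $ j - h x $ j) \<in> borel_measurable borel" by measurable
    show "set_integrable lborel K (\<lambda>x. g x $ j - h x $ j)" if "compact K" for K
      using g(1) h(1) that unfolding weak_grad_def by (auto intro!: set_integral_diff)
    fix \<phi> :: "real^'n \<Rightarrow> real" and K assume \<phi>: "C1_fun \<phi>" "compact K" "\<And>x. x \<notin> K \<Longrightarrow> \<phi> x = 0"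
    then have "{x. \<phi> x \<noteq> 0} \<subseteq> K" by auto
    then obtain d where d: "test_fun \<phi> d"
      using test_fun_C1[OF \<phi>(1)] \<phi>(2) compact_imp_bounded bounded_subset by metis
    have c: "continuous_on UNIV \<phi>" using \<phi>(1) by (rule C1_fun_continuous)
    then have [measurable]: "\<phi> \<in> borel_measurable borel" by (rule borel_measurable_continuous_onI)
    have "compact (\<phi> ` K)" using c \<phi>(2) by (meson compact_continuous_image continuous_on_subset subset_UNIV)
    then obtain B where B: "\<And>x. x \<in> K \<Longrightarrow> \<bar>\<phi> x\<bar> \<le> B"
      using compact_imp_bounded[THEN bounded_pos[THEN iffD1]] by fastforce
    have i: "integrable lborel (\<lambda>x. \<phi> x *\<^sub>R w x $ j)" if w: "weak_grad u w" and [measurable]: "w \<in> borel_measurable borel" for w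
    proof -
      have "integrable lborel (\<lambda>x. B *\<^sub>R (indicator K x *\<^sub>R w x $ j))"
        using w \<phi>(2) unfolding weak_grad_def set_integrable_def by (intro integrable_scaleR_right) auto
      then show ?thesis
        by (rule Bochner_Integration.integrable_bound)
           (auto simp: indicator_def \<phi>(3) abs_mult intro!: AE_I2 mult_right_mono order.trans[OF B])
    qed
    show "(\<integral>x. \<phi> x *\<^sub>R (g x $ j - h x $ j) \<partial>lborel) = 0"
    proof -
      have "(\<integral>x. \<phi> x *\<^sub>R g x $ j \<partial>lborel) = - (\<integral>x. d j x *\<^sub>R u x \<partial>lborel)"
        "(\<integral>x. \<phi> x *\<^sub>R h x $ j \<partial>lborel) = - (\<integral>x. d j x *\<^sub>R u x \<partial>lborel)"
        using g(1) h(1) d unfolding weak_grad_def by auto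
      then show ?thesis
        using Bochner_Integration.integral_diff[OF i[OF g] i[OF h]] by (simp add: scaleR_diff_right)
    qed
  qed auto
  then have "AE x in lborel. \<forall>j. g x $ j - h x $ j = 0"
    by (subst AE_all_countable) auto
  then show ?thesis by eventually_elim (simp add: vec_eq_iff)
qed

section \<open>Weighted norms and test functions\<close>

lemma wnorm_nonneg: "wnorm a q f \<ge> 0"
  by (simp add: wnorm_def)

lemma wnorm_sq: "(wnorm a 2 f)\<^sup>2 = (\<integral>x. norm x powr a * (norm (f x))\<^sup>2 \<partial>lborel)"
proof -
  have "(\<integral>x. norm x powr a * norm (f x) powr 2 \<partial>lborel) \<ge> 0"
    by (intro Bochner_Integration.integral_nonneg) auto
  then show ?thesis
    by (simp add: wnorm_def powr_half_sqrt)
qed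

lemma wint_sq: "wint a 2 f \<longleftrightarrow> f \<in> borel_measurable borel \<and> integrable lborel (\<lambda>x. norm x powr a * (norm (f x))\<^sup>2)"
  by (simp add: wint_def)

text \<open>In HOL \<open>0 powr 0\<close> is 0, so the weight with exponent 0 equals 1 only off the
  origin.\<close>

lemma norm_powr_0_AE: "AE x in (lborel :: 'a::euclidean_space measure). norm x powr 0 = 1"
  using AE_lborel_singleton[of 0] by eventually_elim simp

lemma wnorm0_sq: "(wnorm 0 2 f)\<^sup>2 = (\<integral>x. (norm (f x))\<^sup>2 \<partial>lborel)"
proof -
  have "(\<integral>x. norm x powr 0 * (norm (f x))\<^sup>2 \<partial>lborel) = (\<integral>x. (norm (f x))\<^sup>2 \<partial>lborel)"
    by (rule integral_discrete_difference[of "{0}"]) auto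
  then show ?thesis by (simp add: wnorm_sq)
qed

lemma wint0_sq: "wint 0 2 f \<longleftrightarrow> f \<in> borel_measurable borel \<and> integrable lborel (\<lambda>x. (norm (f x))\<^sup>2)"
proof -
  have "integrable lborel (\<lambda>x. norm x powr 0 * (norm (f x))\<^sup>2) \<longleftrightarrow> integrable lborel (\<lambda>x. (norm (f x))\<^sup>2)"
    if [measurable]: "f \<in> borel_measurable borel"
  proof (rule integrable_cong_AE)
    show "AE x in lborel. norm x powr 0 * (norm (f x))\<^sup>2 = (norm (f x))\<^sup>2"
      using norm_powr_0_AE by eventually_elim simp
  qed auto
  then show ?thesis by (auto simp: wint_sq)
qed

section \<open>Weighted integrals over shells, and radial test functions\<close>

lemma ennreal_le_of_sq_le:
  fixes x :: ennreal
  assumes "x\<^sup>2 \<le> (ennreal y)\<^sup>2" "y \<ge> 0"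
  shows "x \<le> ennreal y"
proof (cases x rule: ennreal_cases)
  case (real z)
  have "ennreal (z\<^sup>2) \<le> ennreal (y\<^sup>2)"
    using assms real by (simp add: ennreal_power)
  then have "z\<^sup>2 \<le> y\<^sup>2" by (simp add: ennreal_le_iff)
  then have "z \<le> y" using assms(2) by (rule power2_le_imp_le)
  then show ?thesis using real by (simp add: ennreal_leI)
next
  case top
  have "(ennreal y)\<^sup>2 < top" using assms(2) by (simp add: ennreal_power)
  moreover have "x\<^sup>2 = top" unfolding top power2_eq_square by (simp add: ennreal_top_mult)
  ultimately show ?thesis using assms(1) by simp
qed

text \<open>The weight is split as |x|^(m - b/2) times |x|^(b/2), and the second factor joins
  \<open>g\<close> to form its weighted norm. With nonnegative integrals, finiteness of the left
  side is part of the conclusion.\<close>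

lemma Cauchy_Schwarz_shell:
  fixes g :: "real^'n \<Rightarrow> 'v::{real_normed_vector, second_countable_topology}" and b m :: real
  assumes g: "wint b 2 g" and [measurable]: "S \<in> sets borel"
    and J: "(\<integral>\<^sup>+(x::real^'n). ennreal (norm x powr (2 * m - b)) * indicator S (norm x) \<partial>lborel) \<le> ennreal J" "J \<ge> 0"
  shows "(\<integral>\<^sup>+(x::real^'n). ennreal (norm x powr m * norm (g x)) * indicator S (norm x) \<partial>lborel) \<le> ennreal (sqrt J * wnorm b 2 g)"
proof -
  have [measurable]: "g \<in> borel_measurable borel" using g by (simp add: wint_def)
  let ?I = "\<integral>\<^sup>+(x::real^'n). ennreal (norm x powr m * norm (g x)) * indicator S (norm x) \<partial>lborel"
  have "?I = (\<integral>\<^sup>+(x::real^'n). (ennreal (norm x powr (m - b/2)) * indicator S (norm x)) * ennreal (norm x powr (b/2) * norm (g x)) \<partial>lborel)"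
  proof (rule nn_integral_cong)
    fix x :: "real^'n"
    have "norm x powr m = norm x powr (m - b/2) * norm x powr (b/2)" by (simp flip: powr_add)
    then show "ennreal (norm x powr m * norm (g x)) * indicator S (norm x) =
      (ennreal (norm x powr (m - b/2)) * indicator S (norm x)) * ennreal (norm x powr (b/2) * norm (g x))"
      by (auto simp: indicator_def ennreal_mult[symmetric] mult.assoc)
  qed
  then have "?I\<^sup>2 \<le> (\<integral>\<^sup>+(x::real^'n). (ennreal (norm x powr (m - b/2)) * indicator S (norm x))\<^sup>2 \<partial>lborel)
     * (\<integral>\<^sup>+(x::real^'n). (ennreal (norm x powr (b/2) * norm (g x)))\<^sup>2 \<partial>lborel)"
    by (simp only:) (rule Cauchy_Schwarz_nn_integral; measurable)
  also have "(\<integral>\<^sup>+(x::real^'n). (ennreal (norm x powr (m - b/2)) * indicator S (norm x))\<^sup>2 \<partial>lborel)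
     = (\<integral>\<^sup>+(x::real^'n). ennreal (norm x powr (2 * m - b)) * indicator S (norm x) \<partial>lborel)"
    by (intro nn_integral_cong) (auto simp: indicator_def power2_eq_square ennreal_mult[symmetric] simp flip: powr_add)
  also have "(\<integral>\<^sup>+(x::real^'n). (ennreal (norm x powr (b/2) * norm (g x)))\<^sup>2 \<partial>lborel)
     = (\<integral>\<^sup>+(x::real^'n). ennreal (norm x powr b * (norm (g x))\<^sup>2) \<partial>lborel)"
  proof (rule nn_integral_cong)
    fix x :: "real^'n"
    have "norm x powr b = norm x powr (b/2) * norm x powr (b/2)" by (simp flip: powr_add)
    then show "(ennreal (norm x powr (b/2) * norm (g x)))\<^sup>2 = ennreal (norm x powr b * (norm (g x))\<^sup>2)"
      by (simp add: power2_eq_square ennreal_mult[symmetric] ac_simps)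
  qed
  also have "\<dots> = ennreal ((wnorm b 2 g)\<^sup>2)"
    using g by (subst nn_integral_eq_integral) (auto simp: wint_sq wnorm_sq)
  also have "(\<integral>\<^sup>+(x::real^'n). ennreal (norm x powr (2 * m - b)) * indicator S (norm x) \<partial>lborel) * ennreal ((wnorm b 2 g)\<^sup>2)
     \<le> ennreal J * ennreal ((wnorm b 2 g)\<^sup>2)"
    by (intro mult_right_mono J) auto
  also have "\<dots> = (ennreal (sqrt J * wnorm b 2 g))\<^sup>2"
    using J(2) by (simp add: ennreal_power wnorm_nonneg power_mult_distrib ennreal_mult)
  finally show ?thesis
    using J(2) by (intro ennreal_le_of_sq_le) (auto simp: wnorm_nonneg)
qed

text \<open>A power of the radius is increasing or decreasing according to the sign of its exponent;
  the larger endpoint value bounds it in either case.\<close>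

lemma shell_volume_bounds:
  assumes r: "0 < r" and rs: "r \<le> s"
  shows "(\<integral>\<^sup>+(x::'a::euclidean_space). ennreal (norm x powr m) * indicator {r<..s} (norm x) \<partial>lborel)
      \<le> ennreal (sphere_area TYPE('a) * max (r powr (m + real DIM('a) - 1)) (s powr (m + real DIM('a) - 1)) * (s - r))"
proof -
  let ?k = "sphere_area TYPE('a)" and ?e = "m + real DIM('a) - 1"
  have k: "?k > 0" by (rule sphere_area_pos)
  have "(\<integral>\<^sup>+(x::'a). ennreal (norm x powr m) * indicator {r<..s} (norm x) \<partial>lborel)
    = (\<integral>\<^sup>+t. ennreal (?k * t powr ?e) * indicator {r<..s} t \<partial>lborel)"
    apply (subst nn_integral_norm)
     apply measurable
    apply (rule nn_integral_cong)
    using r k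
    by (auto simp: indicator_def ennreal_mult[symmetric] powr_add powr_diff
             simp flip: powr_realpow split: if_splits)
  also have "\<dots> \<le> (\<integral>\<^sup>+t. ennreal (?k * max (r powr ?e) (s powr ?e)) * indicator {r<..s} t \<partial>lborel)"
  proof (rule nn_integral_mono)
    fix t
    have "t powr ?e \<le> max (r powr ?e) (s powr ?e)" if "r < t" "t \<le> s"
    proof (cases "?e \<ge> 0")
      case True
      then have "t powr ?e \<le> s powr ?e" using that r by (intro powr_mono2) auto
      then show ?thesis by simp
    next
      case False
      then have "t powr ?e \<le> r powr ?e" using that r by (intro powr_mono2') auto
      then show ?thesis by simp
    qed
    then show "ennreal (?k * t powr ?e) * indicator {r<..s} t \<le> ennreal (?k * max (r powr ?e) (s powr ?e)) * indicator {r<..s} t"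
      using k by (auto simp: indicator_def intro!: ennreal_leI mult_left_mono)
  qed
  also have "\<dots> = ennreal (?k * max (r powr ?e) (s powr ?e)) * ennreal (s - r)"
    using rs by (subst nn_integral_cmult_indicator) auto
  also have "\<dots> = ennreal (?k * max (r powr ?e) (s powr ?e) * (s - r))"
    using k rs by (intro ennreal_mult[symmetric]) (auto simp: le_max_iff_disj)
  finally show ?thesis .
qed

lemma shell_volume_lower:
  assumes "0 < r" "r \<le> s"
  shows "emeasure lborel {x::'a::euclidean_space. r < norm x \<and> norm x \<le> s} \<ge> ennreal (sphere_area TYPE('a) * r ^ (DIM('a) - 1) * (s - r))"
proof -
  let ?k = "sphere_area TYPE('a)"
  have k: "?k > 0" by (rule sphere_area_pos)
  have "emeasure lborel {x::'a. r < norm x \<and> norm x \<le> s} = (\<integral>\<^sup>+(x::'a). indicator {r<..s} (norm x) \<partial>lborel)"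
  proof -
    have "(\<lambda>x::'a. indicator {r<..s} (norm x) :: ennreal) = indicator {x. r < norm x \<and> norm x \<le> s}"
      by (auto simp: indicator_def)
    then show ?thesis by simp
  qed
  also have "\<dots> = (\<integral>\<^sup>+t. indicator {r<..s} t * ennreal (?k * t ^ (DIM('a) - 1)) * indicator {0..} t \<partial>lborel)"
    by (rule nn_integral_norm) auto
  also have "\<dots> \<ge> (\<integral>\<^sup>+t. ennreal (?k * r ^ (DIM('a) - 1)) * indicator {r<..s} t \<partial>lborel)"
    using assms k by (intro nn_integral_mono) (auto simp: indicator_def intro!: ennreal_leI mult_left_mono power_mono)
  also have "(\<integral>\<^sup>+t. ennreal (?k * r ^ (DIM('a) - 1)) * indicator {r<..s} t \<partial>lborel) = ennreal (?k * r ^ (DIM('a) - 1) * (s - r))"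
    using assms k by (subst nn_integral_cmult_indicator) (auto simp: ennreal_mult)
  finally show ?thesis .
qed

text \<open>Composition with the squared norm keeps the product differentiable at the origin. Taking
  \<open>i = j\<close> and summing over \<open>j\<close> gives the divergence n \<Theta> + 2 |x|^2
  \<Theta>' of the radial field x \<Theta>(|x|^2).\<close>

lemma test_fun_coordinate_radial:
  fixes \<Theta> \<Theta>' :: "real \<Rightarrow> real"
  assumes d: "\<And>s. (\<Theta> has_real_derivative \<Theta>' s) (at s)" and c: "continuous_on UNIV \<Theta>'"
    and z: "\<And>s. s > R \<Longrightarrow> \<Theta> s = 0"
  shows "test_fun (\<lambda>x::real^'n. x $ j * \<Theta> ((norm x)\<^sup>2))
     (\<lambda>i x. (if i = j then \<Theta> ((norm x)\<^sup>2) else 0) + 2 * x $ j * x $ i * \<Theta>' ((norm x)\<^sup>2))"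
  unfolding test_fun_def
proof (intro conjI allI)
  have cT: "continuous_on UNIV \<Theta>" using d by (meson DERIV_isCont continuous_at_imp_continuous_on)
  fix x :: "real^'n"
  have dn: "((\<lambda>x::real^'n. (norm x)\<^sup>2) has_derivative (\<lambda>h. 2 * (x \<bullet> h))) (at x)"
    unfolding power2_norm_eq_inner by (auto intro!: derivative_eq_intros simp: inner_commute)
  have "((\<lambda>x. x $ j * \<Theta> ((norm x)\<^sup>2)) has_derivative (\<lambda>h. x $ j * (\<Theta>' ((norm x)\<^sup>2) * (2 * (x \<bullet> h))) + h $ j * \<Theta> ((norm x)\<^sup>2))) (at x)"
  proof (rule has_derivative_mult)
    show "((\<lambda>x. x $ j) has_derivative (\<lambda>h. h $ j)) (at x)"
      by (rule bounded_linear_imp_has_derivative) (rule bounded_linear_vec_nth)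
    show "((\<lambda>x. \<Theta> ((norm x)\<^sup>2)) has_derivative (\<lambda>h. \<Theta>' ((norm x)\<^sup>2) * (2 * (x \<bullet> h)))) (at x)"
      using DERIV_compose_FDERIV[OF d dn] by (simp add: ac_simps)
  qed
  moreover have "(\<lambda>h. x $ j * (\<Theta>' ((norm x)\<^sup>2) * (2 * (x \<bullet> h))) + h $ j * \<Theta> ((norm x)\<^sup>2)) =
     (\<lambda>h. \<Sum>i\<in>UNIV. h $ i * ((if i = j then \<Theta> ((norm x)\<^sup>2) else 0) + 2 * x $ j * x $ i * \<Theta>' ((norm x)\<^sup>2)))"
  proof
    fix h :: "real^'n"
    have "(\<Sum>i\<in>UNIV. h $ i * ((if i = j then \<Theta> ((norm x)\<^sup>2) else 0) + 2 * x $ j * x $ i * \<Theta>' ((norm x)\<^sup>2)))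
       = (\<Sum>i\<in>UNIV. if i = j then h $ i * \<Theta> ((norm x)\<^sup>2) else 0) + (\<Sum>i\<in>UNIV. 2 * x $ j * \<Theta>' ((norm x)\<^sup>2) * (x $ i * h $ i))"
      by (subst sum.distrib[symmetric]) (auto intro!: sum.cong simp: algebra_simps)
    also have "\<dots> = h $ j * \<Theta> ((norm x)\<^sup>2) + 2 * x $ j * \<Theta>' ((norm x)\<^sup>2) * (x \<bullet> h)"
      by (simp add: sum_distrib_left inner_vec_def)
    finally show "x $ j * (\<Theta>' ((norm x)\<^sup>2) * (2 * (x \<bullet> h))) + h $ j * \<Theta> ((norm x)\<^sup>2) =
      (\<Sum>i\<in>UNIV. h $ i * ((if i = j then \<Theta> ((norm x)\<^sup>2) else 0) + 2 * x $ j * x $ i * \<Theta>' ((norm x)\<^sup>2)))" by simp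
  qed
  ultimately show "((\<lambda>x. x $ j * \<Theta> ((norm x)\<^sup>2)) has_derivative
     (\<lambda>h. \<Sum>i\<in>UNIV. h $ i * ((if i = j then \<Theta> ((norm x)\<^sup>2) else 0) + 2 * x $ j * x $ i * \<Theta>' ((norm x)\<^sup>2)))) (at x)"
    by simp
next
  fix i
  have cT: "continuous_on UNIV \<Theta>" using d by (meson DERIV_isCont continuous_at_imp_continuous_on)
  have c1: "continuous_on UNIV (\<lambda>x::real^'n. \<Theta> ((norm x)\<^sup>2))" "continuous_on UNIV (\<lambda>x::real^'n. \<Theta>' ((norm x)\<^sup>2))"
    by (rule continuous_on_compose2[OF cT] continuous_on_compose2[OF c]; auto intro!: continuous_intros)+
  show "continuous_on UNIV (\<lambda>x::real^'n. (if i = j then \<Theta> ((norm x)\<^sup>2) else 0) + 2 * x $ j * x $ i * \<Theta>' ((norm x)\<^sup>2))"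
    by (cases "i = j") (auto intro!: continuous_intros c1)
next
  show "\<exists>R. \<forall>x::real^'n. R < norm x \<longrightarrow> x $ j * \<Theta> ((norm x)\<^sup>2) = 0"
  \<comment> \<open>Beyond radius 1 the norm is at most its square, so the vanishing of \<Theta>
    past \<open>R\<close> carries over.\<close>
  proof (intro exI[of _ "max 1 R"] allI impI)
    fix x :: "real^'n" assume x: "max 1 R < norm x"
    have "norm x \<le> (norm x)\<^sup>2" using x by (simp add: self_le_power)
    then show "x $ j * \<Theta> ((norm x)\<^sup>2) = 0" using x z by simp
  qed
qed

text \<open>\<open>test_fun\<close> asks only that the function itself vanish outside a ball; as the
  exterior of the closed ball is open, the partials vanish there too, and continuity bounds
  everything on the ball.\<close>

lemma test_fun_bounded:
  fixes \<phi> :: "real^'n \<Rightarrow> real"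
  assumes "test_fun \<phi> d"
  obtains B R where "B \<ge> 0" "R \<ge> 0" "\<And>x. \<bar>\<phi> x\<bar> \<le> B * indicator (cball 0 R) x" "\<And>j x. \<bar>d j x\<bar> \<le> B * indicator (cball 0 R) x"
    "continuous_on UNIV \<phi>" "\<And>j. continuous_on UNIV (d j)"
proof -
  have t: "\<And>x. (\<phi> has_derivative (\<lambda>h. \<Sum>j\<in>UNIV. h $ j * d j x)) (at x)" "\<And>j. continuous_on UNIV (d j)"
    using assms unfolding test_fun_def by auto
  obtain R0 where R0: "\<And>x. norm x > R0 \<Longrightarrow> \<phi> x = 0" using assms unfolding test_fun_def by auto
  define R where "R = max 0 R0"
  have R: "R \<ge> 0" "\<And>x. norm x > R \<Longrightarrow> \<phi> x = 0" using R0 unfolding R_def by auto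
  have c: "continuous_on UNIV \<phi>" using t(1) by (meson continuous_at_imp_continuous_on has_derivative_continuous)
  have d0: "d j x = 0" if "norm x > R" for j x
  proof -
    have "(\<phi> has_derivative (\<lambda>h. 0)) (at x)"
      by (rule has_derivative_transform_within_open[OF has_derivative_const[of 0], of "- cball 0 R"])
         (use that R in auto)
    from has_derivative_unique[OF this t(1)]
    have "0 = (\<Sum>i\<in>UNIV. axis j (1::real) $ i * d i x)" by metis
    also have "\<dots> = (\<Sum>i\<in>UNIV. if i = j then d i x else 0)" by (intro sum.cong) (auto simp: axis_def)
    finally show ?thesis by simp
  qed
  have "compact (\<phi> ` cball 0 R)" by (intro compact_continuous_image continuous_on_subset[OF c]) auto
  then obtain B0 where B0: "\<And>x. x \<in> cball 0 R \<Longrightarrow> \<bar>\<phi> x\<bar> \<le> B0"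
    using compact_imp_bounded[THEN bounded_iff[THEN iffD1]] by fastforce
  have "\<exists>B. \<forall>x\<in>cball 0 R. \<bar>d j x\<bar> \<le> B" for j
  proof -
    have "compact (d j ` cball 0 R)" by (intro compact_continuous_image continuous_on_subset[OF t(2)]) auto
    then show ?thesis using compact_imp_bounded[THEN bounded_iff[THEN iffD1]] by fastforce
  qed
  then obtain B1 where B1: "\<And>j x. x \<in> cball 0 R \<Longrightarrow> \<bar>d j x\<bar> \<le> B1 j" by metis
  define B where "B = \<bar>B0\<bar> + (\<Sum>j\<in>UNIV. \<bar>B1 j\<bar>)"
  have Bj: "B1 j \<le> B" for j
  proof -
    have "\<bar>B1 j\<bar> \<le> (\<Sum>j\<in>UNIV. \<bar>B1 j\<bar>)" by (rule member_le_sum) auto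
    then show ?thesis unfolding B_def by linarith
  qed
  have B0B: "B0 \<le> B" unfolding B_def by (rule order.trans[OF abs_ge_self]) (simp add: sum_nonneg)
  show thesis
  proof (rule that[of B R])
    show "B \<ge> 0" unfolding B_def by (auto intro!: add_nonneg_nonneg sum_nonneg)
    show "\<bar>\<phi> x\<bar> \<le> B * indicator (cball 0 R) x" for x
      using B0[of x] B0B R(2)[of x] by (auto simp: indicator_def)
    show "\<bar>d j x\<bar> \<le> B * indicator (cball 0 R) x" for j x
      using B1[of x j] Bj[of j] d0[of x j] by (auto simp: indicator_def)
  qed (rule R(1) c t(2))+
qed

lemma integrable_mult_test:
  fixes w :: "real^'n \<Rightarrow> 'v::{banach, second_countable_topology}" and \<phi> :: "real^'n \<Rightarrow> real"
  assumes loc: "\<And>K. compact K \<Longrightarrow> set_integrable lborel K w"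
    and [measurable]: "w \<in> borel_measurable borel"
    and c: "continuous_on UNIV \<phi>" and B: "\<And>x. \<bar>\<phi> x\<bar> \<le> B * indicator (cball 0 R) x"
  shows "integrable lborel (\<lambda>x. \<phi> x *\<^sub>R w x)"
proof -
  have [measurable]: "\<phi> \<in> borel_measurable borel" using c by (rule borel_measurable_continuous_onI)
  have "integrable lborel (\<lambda>x. B *\<^sub>R (indicator (cball 0 R) x *\<^sub>R w x))"
    using loc[OF compact_cball] unfolding set_integrable_def by (rule integrable_scaleR_right)
  then show ?thesis
  proof (rule Bochner_Integration.integrable_bound)
    show "AE x in lborel. norm (\<phi> x *\<^sub>R w x) \<le> norm (B *\<^sub>R (indicator (cball 0 R) x *\<^sub>R w x))"
    proof (rule AE_I2)
      fix x
      have "\<bar>\<phi> x\<bar> * norm (w x) \<le> (B * indicator (cball 0 R) x) * norm (w x)" by (intro mult_right_mono B) auto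
      also have "\<dots> \<le> \<bar>B\<bar> * (indicator (cball 0 R) x * norm (w x))" by (auto simp: indicator_def intro!: mult_right_mono)
      finally show "norm (\<phi> x *\<^sub>R w x) \<le> norm (B *\<^sub>R (indicator (cball 0 R) x *\<^sub>R w x))" by (simp add: abs_mult mult.assoc)
    qed
  qed auto
qed

section \<open>The continuous profile of a radial function\<close>

lemma test_fun_integrable:
  fixes w :: "real^'n \<Rightarrow> 'v::{banach, second_countable_topology}"
  assumes "test_fun \<phi> d" "\<And>K. compact K \<Longrightarrow> set_integrable lborel K w" "w \<in> borel_measurable borel"
  shows "integrable lborel (\<lambda>x. \<phi> x *\<^sub>R w x)" "integrable lborel (\<lambda>x. d j x *\<^sub>R w x)"
  by (rule test_fun_bounded[OF assms(1)], rule integrable_mult_test[OF assms(2,3)]; assumption)+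

section \<open>The radial flux and the profile it defines\<close>

locale radial_weak_grad =
  fixes u :: "real^'n \<Rightarrow> complex" and g :: "real^'n \<Rightarrow> complex^'n" and b :: real
  assumes u: "wint 0 2 u" and rad: "radial u" and grad: "weak_grad u g" and g: "wint b 2 g"
    and dim: "2 - real CARD('n) < b"
begin

text \<open>This is |x|^(1-n) times the radial derivative of \<open>u\<close>. The power cancels the
  r^(n-1) of polar coordinates, so the integral of the flux over a shell is the area of the unit
  sphere times the increment of \<open>u\<close> between the two radii.\<close>

definition flux :: "real^'n \<Rightarrow> complex" where
  "flux x = norm x powr (- real CARD('n)) *\<^sub>R (\<Sum>j\<in>UNIV. x $ j *\<^sub>R g x $ j)"

text \<open>The fundamental theorem of calculus from \<open>r\<close> to infinity with boundary
  value 0 at infinity; that this is the right boundary value is settled only in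
  \<open>u_eq_profile\<close>.\<close>

definition profile :: "real \<Rightarrow> complex" where
  "profile r = (- 1 / sphere_area TYPE(real^'n)) *\<^sub>R (\<integral>x. indicator {r<..} (norm x) *\<^sub>R flux x \<partial>lborel)"

lemma measurable_u[measurable]: "u \<in> borel_measurable borel"
  using u by (simp add: wint_def)

lemma measurable_g[measurable]: "g \<in> borel_measurable borel"
  using g by (simp add: wint_def)

lemma measurable_flux[measurable]: "flux \<in> borel_measurable borel"
  unfolding flux_def by measurable

lemma omega_pos: "sphere_area TYPE(real^'n) > 0"
  by (rule sphere_area_pos)

lemma norm_flux_le: "norm (flux x) \<le> norm x powr (1 - real CARD('n)) * norm (g x)"
proof -
  have "norm (\<Sum>j\<in>UNIV. x $ j *\<^sub>R g x $ j) \<le> (\<Sum>j\<in>UNIV. \<bar>x $ j\<bar> * \<bar>norm (g x $ j)\<bar>)"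
    by (rule order.trans[OF norm_sum]) simp
  also have "\<dots> \<le> L2_set (\<lambda>j. x $ j) UNIV * L2_set (\<lambda>j. norm (g x $ j)) UNIV"
    by (rule L2_set_mult_ineq)
  also have "\<dots> = norm x * norm (g x)"
    by (simp add: norm_vec_def L2_set_def)
  finally have "norm x powr (- real CARD('n)) * norm (\<Sum>j\<in>UNIV. x $ j *\<^sub>R g x $ j) \<le> norm x powr (- real CARD('n)) * (norm x * norm (g x))"
    by (intro mult_left_mono) auto
  also have "\<dots> = norm x powr (1 - real CARD('n)) * norm (g x)"
    by (cases "x = 0") (auto simp: powr_diff powr_minus field_simps)
  finally show ?thesis by (simp add: flux_def)
qed

text \<open>Cauchy-Schwarz with m = 1 - n. \<open>S\<close> is a set of radii: a half-line to bound
  the profile, an interval to bound its increments.\<close>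

lemma flux_integral:
  assumes [measurable]: "S \<in> sets borel"
    and J: "(\<integral>\<^sup>+(x::real^'n). ennreal (norm x powr (2 - 2 * real CARD('n) - b)) * indicator S (norm x) \<partial>lborel) \<le> ennreal J" "J \<ge> 0"
  shows "integrable lborel (\<lambda>x. indicator S (norm x) *\<^sub>R flux x)"
    and "norm (\<integral>x. indicator S (norm x) *\<^sub>R flux x \<partial>lborel) \<le> sqrt J * wnorm b 2 g"
proof -
  have e: "2 - 2 * real CARD('n) - b = 2 * (1 - real CARD('n)) - b" by simp
  have "(\<integral>\<^sup>+x. ennreal (norm (indicator S (norm x) *\<^sub>R flux x)) \<partial>lborel)
     \<le> (\<integral>\<^sup>+x. ennreal (norm x powr (1 - real CARD('n)) * norm (g x)) * indicator S (norm x) \<partial>lborel)"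
    by (intro nn_integral_mono) (auto simp: indicator_def intro!: ennreal_leI norm_flux_le)
  also have "\<dots> \<le> ennreal (sqrt J * wnorm b 2 g)"
    by (rule Cauchy_Schwarz_shell[OF g _ J[unfolded e]]) simp
  finally have *: "(\<integral>\<^sup>+x. ennreal (norm (indicator S (norm x) *\<^sub>R flux x)) \<partial>lborel) \<le> ennreal (sqrt J * wnorm b 2 g)" .
  show i: "integrable lborel (\<lambda>x. indicator S (norm x) *\<^sub>R flux x)"
    by (rule integrableI_bounded) (use * in \<open>auto intro: le_less_trans\<close>)
  have "ennreal (norm (\<integral>x. indicator S (norm x) *\<^sub>R flux x \<partial>lborel)) \<le> ennreal (sqrt J * wnorm b 2 g)"
    by (rule order.trans[OF integral_norm_bound_ennreal[OF i] *])
  then show "norm (\<integral>x. indicator S (norm x) *\<^sub>R flux x \<partial>lborel) \<le> sqrt J * wnorm b 2 g"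
    using J(2) by (subst (asm) ennreal_le_iff) (auto simp: wnorm_nonneg)
qed

text \<open>The exponent 2 - 2n - b lies below -n precisely because 2 - n < b; this is how that
  hypothesis makes the flux integrable at infinity.\<close>

lemma tail_weight:
  assumes "r > 0"
  shows "(\<integral>\<^sup>+(x::real^'n). ennreal (norm x powr (2 - 2 * real CARD('n) - b)) * indicator {r<..} (norm x) \<partial>lborel)
    \<le> ennreal (sphere_area TYPE(real^'n) / (real CARD('n) - 2 + b) * r powr (2 - real CARD('n) - b))"
proof -
  have "(\<integral>\<^sup>+(x::real^'n). ennreal (norm x powr (2 - 2 * real CARD('n) - b)) * indicator {r<..} (norm x) \<partial>lborel)
     \<le> (\<integral>\<^sup>+(x::real^'n). ennreal (norm x powr (2 - 2 * real CARD('n) - b)) * indicator {r..} (norm x) \<partial>lborel)"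
    by (intro nn_integral_mono) (auto simp: indicator_def)
  also have "\<dots> = ennreal (sphere_area TYPE(real^'n) / (- (2 - 2 * real CARD('n) - b + real DIM(real^'n))) * r powr (2 - 2 * real CARD('n) - b + real DIM(real^'n)))"
    using assms dim by (intro nn_integral_norm_powr_outside) auto
  also have "\<dots> = ennreal (sphere_area TYPE(real^'n) / (real CARD('n) - 2 + b) * r powr (2 - real CARD('n) - b))"
  proof -
    have "- (2 - 2 * real CARD('n) - b + real DIM(real^'n)) = real CARD('n) - 2 + b" "2 - 2 * real CARD('n) - b + real DIM(real^'n) = 2 - real CARD('n) - b" by auto
    then show ?thesis by (simp only:)
  qed
  finally show ?thesis .
qed

lemma flux_integrable:
  assumes "r > 0"
  shows "integrable lborel (\<lambda>x. indicator {r<..} (norm x) *\<^sub>R flux x)"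
  using dim omega_pos by (intro flux_integral(1)[OF _ tail_weight[OF assms]]) auto

text \<open>Cauchy-Schwarz on the whole exterior of a ball. The bound involves the gradient alone;
  it is the one used near the origin, and it shows that the profile tends to 0 at infinity.\<close>

lemma profile_bound:
  assumes "r > 0"
  shows "norm (profile r) \<le> sqrt (1 / (sphere_area TYPE(real^'n) * (real CARD('n) - 2 + b))) * r powr (- (real CARD('n) - 2 + b) / 2) * wnorm b 2 g"
proof -
  have d: "real CARD('n) - 2 + b > 0" using dim by simp
  have "norm (profile r) \<le> (1 / sphere_area TYPE(real^'n)) * (sqrt (sphere_area TYPE(real^'n) / (real CARD('n) - 2 + b) * r powr (2 - real CARD('n) - b)) * wnorm b 2 g)"
  proof -
    have "norm (\<integral>x. indicator {r<..} (norm x) *\<^sub>R flux x \<partial>lborel)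
      \<le> sqrt (sphere_area TYPE(real^'n) / (real CARD('n) - 2 + b) * r powr (2 - real CARD('n) - b)) * wnorm b 2 g"
      using omega_pos d by (intro flux_integral(2)[OF _ tail_weight[OF assms]]) auto
    moreover have "norm (profile r) = (1 / sphere_area TYPE(real^'n)) * norm (\<integral>x. indicator {r<..} (norm x) *\<^sub>R flux x \<partial>lborel)"
      using omega_pos by (simp add: profile_def)
    ultimately show ?thesis using omega_pos by (simp only:) (intro mult_left_mono; simp)
  qed
  also have "sqrt (sphere_area TYPE(real^'n) / (real CARD('n) - 2 + b) * r powr (2 - real CARD('n) - b)) = sqrt (sphere_area TYPE(real^'n) / (real CARD('n) - 2 + b)) * r powr (- (real CARD('n) - 2 + b) / 2)"
  proof -
    have "sqrt (r powr (2 - real CARD('n) - b)) = r powr (- (real CARD('n) - 2 + b) / 2)"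
      using assms by (simp add: powr_half_sqrt[symmetric] powr_powr)
    then show ?thesis unfolding real_sqrt_mult by simp
  qed
  also have "(1 / sphere_area TYPE(real^'n)) * (sqrt (sphere_area TYPE(real^'n) / (real CARD('n) - 2 + b)) * r powr (- (real CARD('n) - 2 + b) / 2) * wnorm b 2 g)
    = ((1 / sphere_area TYPE(real^'n)) * sqrt (sphere_area TYPE(real^'n) / (real CARD('n) - 2 + b))) * r powr (- (real CARD('n) - 2 + b) / 2) * wnorm b 2 g" by simp
  also have "(1 / sphere_area TYPE(real^'n)) * sqrt (sphere_area TYPE(real^'n) / (real CARD('n) - 2 + b)) = sqrt (1 / (sphere_area TYPE(real^'n) * (real CARD('n) - 2 + b)))"
    using d omega_pos by (simp add: real_sqrt_divide real_sqrt_mult) (simp add: field_simps)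
  finally show ?thesis .
qed

text \<open>On a shell the thickness s - r comes out as a factor, which gives continuity of the
  profile and, later, the Strauss bound. The exponent 1 - n - b is negative, so the inner radius
  maximises the weight.\<close>

lemma profile_diff:
  assumes "0 < r" "r \<le> s"
  shows "(norm (profile r - profile s))\<^sup>2 \<le> 1 / sphere_area TYPE(real^'n) * r powr (1 - real CARD('n) - b) * (s - r) * (wnorm b 2 g)\<^sup>2"
proof -
  have J: "(\<integral>\<^sup>+(x::real^'n). ennreal (norm x powr (2 - 2 * real CARD('n) - b)) * indicator {r<..s} (norm x) \<partial>lborel)
     \<le> ennreal (sphere_area TYPE(real^'n) * r powr (1 - real CARD('n) - b) * (s - r))"
  proof -
    have "2 - 2 * real CARD('n) - b + real DIM(real^'n) - 1 = 1 - real CARD('n) - b" by simp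
    moreover have "max (r powr (1 - real CARD('n) - b)) (s powr (1 - real CARD('n) - b)) = r powr (1 - real CARD('n) - b)"
      using assms dim by (intro max_absorb1 powr_mono2') auto
    ultimately show ?thesis using shell_volume_bounds[OF assms, of "2 - 2 * real CARD('n) - b", where 'a="real^'n"] by (simp only:)
  qed
  have J0: "sphere_area TYPE(real^'n) * r powr (1 - real CARD('n) - b) * (s - r) \<ge> 0" using omega_pos assms by auto
  have "profile r - profile s = (- 1 / sphere_area TYPE(real^'n)) *\<^sub>R (\<integral>x. indicator {r<..s} (norm x) *\<^sub>R flux x \<partial>lborel)"
  proof -
    have "(\<integral>x. indicator {r<..} (norm x) *\<^sub>R flux x \<partial>lborel) - (\<integral>x. indicator {s<..} (norm x) *\<^sub>R flux x \<partial>lborel)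
      = (\<integral>x. indicator {r<..s} (norm x) *\<^sub>R flux x \<partial>lborel)"
      using assms
      by (subst Bochner_Integration.integral_diff[OF flux_integrable flux_integrable, symmetric])
         (auto intro!: Bochner_Integration.integral_cong simp: indicator_def)
    then show ?thesis unfolding profile_def scaleR_diff_right[symmetric] by (simp only:)
  qed
  then have "norm (profile r - profile s) \<le> (1 / sphere_area TYPE(real^'n)) * (sqrt (sphere_area TYPE(real^'n) * r powr (1 - real CARD('n) - b) * (s - r)) * wnorm b 2 g)"
    using omega_pos by (auto intro!: divide_right_mono flux_integral(2)[OF _ J J0])
  then have "(norm (profile r - profile s))\<^sup>2 \<le> ((1 / sphere_area TYPE(real^'n)) * (sqrt (sphere_area TYPE(real^'n) * r powr (1 - real CARD('n) - b) * (s - r)) * wnorm b 2 g))\<^sup>2"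
    by (intro power_mono) auto
  also have "\<dots> = 1 / sphere_area TYPE(real^'n) * r powr (1 - real CARD('n) - b) * (s - r) * (wnorm b 2 g)\<^sup>2"
    using omega_pos J0 unfolding power_mult_distrib real_sqrt_pow2[OF J0] by (simp add: field_simps power2_eq_square)
  finally show ?thesis .
qed

lemma continuous_profile: "continuous_on {0<..} profile"
proof (rule continuous_at_imp_continuous_on, rule ballI)
  fix r :: real assume "r \<in> {0<..}"
  then have r: "r > 0" by simp
  define C where "C = 1 / sphere_area TYPE(real^'n) * (r / 2) powr (1 - real CARD('n) - b) * (wnorm b 2 g)\<^sup>2"
  have bnd: "(norm (profile x - profile y))\<^sup>2 \<le> C * \<bar>x - y\<bar>" if "r / 2 < x" "r / 2 < y" for x y
    using that
  proof (induction x y rule: linorder_wlog)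
    case (le x y)
    have "(norm (profile x - profile y))\<^sup>2 \<le> 1 / sphere_area TYPE(real^'n) * x powr (1 - real CARD('n) - b) * (y - x) * (wnorm b 2 g)\<^sup>2"
      using le r by (intro profile_diff) auto
    also have "\<dots> \<le> 1 / sphere_area TYPE(real^'n) * (r / 2) powr (1 - real CARD('n) - b) * (y - x) * (wnorm b 2 g)\<^sup>2"
      using le r dim omega_pos by (intro mult_right_mono mult_left_mono powr_mono2') auto
    finally show ?case using le by (simp add: C_def ac_simps)
  next
    case (sym x y)
    then show ?case by (simp add: norm_minus_commute abs_minus_commute)
  qed
  have "((\<lambda>y. norm (profile y - profile r)) \<longlongrightarrow> 0) (at r)"
  proof (rule Lim_null_comparison)
    show "\<forall>\<^sub>F y in at r. norm (norm (profile y - profile r)) \<le> sqrt (C * \<bar>y - r\<bar>)"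
    proof -
      have "\<forall>\<^sub>F y in at r. y \<in> {r/2<..} - {r}" using r by (intro eventually_at_in_open) auto
      then show ?thesis by eventually_elim (use r bnd in \<open>auto intro!: real_le_rsqrt\<close>)
    qed
    have "((\<lambda>y. sqrt (C * \<bar>y - r\<bar>)) \<longlongrightarrow> sqrt (C * \<bar>r - r\<bar>)) (at r)"
      by (intro tendsto_intros)
    then show "((\<lambda>y. sqrt (C * \<bar>y - r\<bar>)) \<longlongrightarrow> 0) (at r)" by simp
  qed
  then show "isCont profile r"
    unfolding isCont_def by (rule LIM_zero_cancel[OF tendsto_norm_zero_cancel])
qed

text \<open>The weak gradient is tested with the field x |x|^(-n) \<zeta>(|x|), whose divergence is
  \<zeta>'(|x|) |x|^(1-n). The singular power is harmless because \<zeta> vanishes near the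
  origin.\<close>

lemma radial_test:
  fixes \<alpha> \<zeta> :: "real \<Rightarrow> real"
  assumes a: "0 < a" and \<alpha>: "continuous_on UNIV \<alpha>" "\<And>r. r < a \<Longrightarrow> \<alpha> r = 0"
    and \<zeta>: "\<And>r. (\<zeta> has_real_derivative \<alpha> r) (at r)" "\<And>r. r < a \<Longrightarrow> \<zeta> r = 0" "\<And>r. r > d \<Longrightarrow> \<zeta> r = 0"
  shows "(\<integral>x. (\<alpha> (norm x) * norm x powr (1 - real CARD('n))) *\<^sub>R u x \<partial>lborel) = - (\<integral>x. \<zeta> (norm x) *\<^sub>R flux x \<partial>lborel)"
proof -
  \<comment> \<open>The factor |x|^(-n) \<zeta>(|x|) in the variable s = |x|^2, the form that
    \<open>test_fun_coordinate_radial\<close> takes.\<close>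
  define \<Theta> where "\<Theta> s = s powr (- real CARD('n) / 2) * \<zeta> (sqrt s)" for s
  define \<Theta>' where "\<Theta>' s = (- real CARD('n) / 2) * s powr (- real CARD('n) / 2 - 1) * \<zeta> (sqrt s) + s powr (- real CARD('n) / 2) * \<alpha> (sqrt s) * (inverse (sqrt s) / 2)" for s
  have z0: "\<Theta> s = 0" "\<Theta>' s = 0" if "s < a\<^sup>2" for s
  proof -
    have "sqrt s < a" using that a by (metis real_sqrt_less_mono real_sqrt_abs abs_of_pos)
    then show "\<Theta> s = 0" "\<Theta>' s = 0" by (simp_all add: \<Theta>_def \<Theta>'_def \<zeta>(2) \<alpha>(2))
  qed
  have dT: "(\<Theta> has_real_derivative \<Theta>' s) (at s)" for s
  proof (cases "s < a\<^sup>2")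
    case True
    have "((\<lambda>_. 0) has_real_derivative \<Theta>' s) (at s)" using z0(2)[OF True] by simp
    then show ?thesis
      by (rule has_field_derivative_transform_within_open[of _ _ _ "{..<a\<^sup>2}"]) (use True z0 in auto)
  next
    case False
    then have s: "s > 0" using a by (metis not_le_imp_less order_less_le_trans zero_less_power)
    show ?thesis unfolding \<Theta>_def \<Theta>'_def
      using s by (auto intro!: derivative_eq_intros DERIV_chain2[OF \<zeta>(1)] simp: powr_diff)
  qed
  have cz: "continuous_on UNIV \<zeta>" using \<zeta>(1) by (meson DERIV_isCont continuous_at_imp_continuous_on)
  have cT: "continuous_on UNIV \<Theta>'"
  proof -
    \<comment> \<open>Two open sets cover the line: for positive \<open>s\<close> the formula is
      continuous, and below a^2 the function is 0.\<close>
    have "continuous_on ({0<..} \<union> {..<a\<^sup>2}) \<Theta>'"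
    proof (rule continuous_on_open_Un)
      show "continuous_on {0<..} \<Theta>'" unfolding \<Theta>'_def
        by (intro continuous_intros continuous_on_compose2[OF cz] continuous_on_compose2[OF \<alpha>(1)]) auto
      show "continuous_on {..<a\<^sup>2} \<Theta>'"
        by (rule continuous_on_eq[of _ "\<lambda>_. 0"]) (auto simp: z0)
    qed auto
    moreover have "{0<..} \<union> {..<a\<^sup>2} = UNIV"
    proof -
      have "x \<in> {0<..} \<union> {..<a\<^sup>2}" for x :: real
        using zero_less_power[OF a, of 2] unfolding Un_iff greaterThan_iff lessThan_iff by linarith
      then show ?thesis by blast
    qed
    ultimately show ?thesis by simp
  qed
  have zR: "\<Theta> s = 0" if "s > d\<^sup>2" for s
  proof -
    have "d \<le> \<bar>d\<bar>" by simp
    also have "\<bar>d\<bar> < sqrt s" using that by (metis real_sqrt_abs real_sqrt_less_mono)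
    finally show ?thesis by (simp add: \<Theta>_def \<zeta>(3))
  qed
  note tf = test_fun_coordinate_radial[OF dT cT zR, where 'n='n]
  have uloc: "\<And>K. compact K \<Longrightarrow> set_integrable lborel K u" "\<And>K j. compact K \<Longrightarrow> set_integrable lborel K (\<lambda>x. g x $ j)"
    using grad unfolding weak_grad_def by auto
  let ?\<phi> = "\<lambda>j (x::real^'n). x $ j * \<Theta> ((norm x)\<^sup>2)"
  let ?d = "\<lambda>j (x::real^'n). \<Theta> ((norm x)\<^sup>2) + 2 * x $ j * x $ j * \<Theta>' ((norm x)\<^sup>2)"
  have i1: "integrable lborel (\<lambda>x. ?d j x *\<^sub>R u x)" for j
    using test_fun_integrable(2)[OF tf[where j=j] uloc(1) measurable_u, where j=j] by simp
  have i2: "integrable lborel (\<lambda>x. ?\<phi> j x *\<^sub>R g x $ j)" for j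
    by (rule test_fun_integrable(1)[OF tf[where j=j] uloc(2)]) auto
  have w: "\<And>phi dphi j. test_fun phi dphi \<Longrightarrow> (\<integral>x. dphi j x *\<^sub>R u x \<partial>lborel) = - (\<integral>x. phi x *\<^sub>R g x $ j \<partial>lborel)"
    using grad unfolding weak_grad_def by blast
  have "(\<integral>x. ?d j x *\<^sub>R u x \<partial>lborel) = - (\<integral>x. ?\<phi> j x *\<^sub>R g x $ j \<partial>lborel)" for j
    using w[where j=j, OF tf[where j=j]] by simp
  then have "(\<Sum>j\<in>UNIV. (\<integral>x. ?d j x *\<^sub>R u x \<partial>lborel)) = (\<Sum>j\<in>UNIV. - (\<integral>x. ?\<phi> j x *\<^sub>R g x $ j \<partial>lborel))"
    by simp
  then have *: "(\<integral>x. (\<Sum>j\<in>UNIV. ?d j x *\<^sub>R u x) \<partial>lborel) = - (\<integral>x. (\<Sum>j\<in>UNIV. ?\<phi> j x *\<^sub>R g x $ j) \<partial>lborel)"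
    by (simp add: Bochner_Integration.integral_sum i1 i2 sum_negf)
  \<comment> \<open>The divergence n \<Theta> + 2 r^2 \<Theta>' at r^2, in which the two terms
    containing \<zeta> cancel.\<close>
  have e1: "(\<Sum>j\<in>UNIV. ?d j x *\<^sub>R u x) = (\<alpha> (norm x) * norm x powr (1 - real CARD('n))) *\<^sub>R u x" if "x \<noteq> 0" for x
  proof -
    define r where "r = norm x"
    have r: "r > 0" "r\<^sup>2 > 0" "sqrt (r\<^sup>2) = r" using that by (auto simp: r_def)
    have p: "(r\<^sup>2) powr e = r powr (2 * e)" for e
      using r by (simp add: powr_powr flip: powr_numeral)
    have sq: "(\<Sum>j\<in>UNIV. x $ j * x $ j) = r\<^sup>2"
      by (simp add: r_def power2_norm_eq_inner inner_vec_def)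
    have "(\<Sum>j\<in>UNIV. ?d j x) = real CARD('n) * \<Theta> (r\<^sup>2) + 2 * r\<^sup>2 * \<Theta>' (r\<^sup>2)"
      by (simp add: sum.distrib r_def[symmetric] sq[symmetric] sum_distrib_left sum_distrib_right ac_simps)
    also have "\<dots> = \<alpha> r * r powr (1 - real CARD('n))"
    proof -
      have "2 * (- real CARD('n) / 2 - 1) = - real CARD('n) - 2" "2 * (- real CARD('n) / 2) = - real CARD('n)" by simp_all
      moreover have "r powr (- real CARD('n) - 2) = r powr (- real CARD('n)) / r\<^sup>2"
        using r(1) by (simp add: powr_diff)
      moreover have "r powr (1 - real CARD('n)) = r * r powr (- real CARD('n))"
        using r(1) by (simp add: powr_diff powr_minus divide_inverse)
      ultimately have e: "r powr (2 * (- real CARD('n) / 2 - 1)) = r powr (- real CARD('n)) / r\<^sup>2"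
        "r powr (2 * (- real CARD('n) / 2)) = r powr (- real CARD('n))"
        "r powr (1 - real CARD('n)) = r * r powr (- real CARD('n))"
        by simp_all
      show ?thesis
        unfolding \<Theta>_def \<Theta>'_def p r(3) e using r(1)
        by (simp add: divide_simps power2_eq_square)
    qed
    finally show ?thesis by (simp add: r_def scaleR_sum_left[symmetric])
  qed
  have e2: "(\<Sum>j\<in>UNIV. ?\<phi> j x *\<^sub>R g x $ j) = \<zeta> (norm x) *\<^sub>R flux x" if "x \<noteq> 0" for x
  proof -
    have "((norm x)\<^sup>2) powr (- real CARD('n) / 2) = norm x powr (- real CARD('n))"
      using that by (simp add: powr_powr flip: powr_numeral)
    then show ?thesis by (simp add: \<Theta>_def flux_def scaleR_sum_right ac_simps)
  qed
  have "(\<integral>x. (\<Sum>j\<in>UNIV. ?d j x *\<^sub>R u x) \<partial>lborel) = (\<integral>x. (\<alpha> (norm x) * norm x powr (1 - real CARD('n))) *\<^sub>R u x \<partial>lborel)"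
    by (rule integral_discrete_difference[of "{0}"]) (use e1 in auto)
  moreover have "(\<integral>x. (\<Sum>j\<in>UNIV. ?\<phi> j x *\<^sub>R g x $ j) \<partial>lborel) = (\<integral>x. \<zeta> (norm x) *\<^sub>R flux x \<partial>lborel)"
    by (rule integral_discrete_difference[of "{0}"]) (use e2 in auto)
  ultimately show ?thesis using * by simp
qed

end

section \<open>Comparison of the function and the profile on the half-line of radii\<close>

lemma integrable_continuous_mult:
  fixes w :: "real \<Rightarrow> 'v::{banach, second_countable_topology}" and \<alpha> :: "real \<Rightarrow> real"
  assumes w: "set_integrable lborel {a..d} w" and c: "continuous_on UNIV \<alpha>"
    and z: "\<And>r. r \<notin> {a..d} \<Longrightarrow> \<alpha> r = 0"
  shows "integrable lborel (\<lambda>r. \<alpha> r *\<^sub>R w r)"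
proof -
  have [measurable]: "\<alpha> \<in> borel_measurable borel" using c by (rule borel_measurable_continuous_onI)
  have "compact (\<alpha> ` {a..d})" by (intro compact_continuous_image continuous_on_subset[OF c]) auto
  then obtain B where B: "\<And>r. r \<in> {a..d} \<Longrightarrow> \<bar>\<alpha> r\<bar> \<le> B"
    using compact_imp_bounded[THEN bounded_iff[THEN iffD1]] by fastforce
  have "integrable lborel (\<lambda>r. \<alpha> r *\<^sub>R (indicator {a..d} r *\<^sub>R w r))"
  proof (rule Bochner_Integration.integrable_bound)
    show i: "integrable lborel (\<lambda>r. B *\<^sub>R (indicator {a..d} r *\<^sub>R w r))"
      using w unfolding set_integrable_def by (rule integrable_scaleR_right)
    have [measurable]: "(\<lambda>r. indicator {a..d} r *\<^sub>R w r) \<in> borel_measurable borel"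
      using w unfolding set_integrable_def by (simp add: integrable_iff_bounded)
    show "(\<lambda>r. \<alpha> r *\<^sub>R (indicator {a..d} r *\<^sub>R w r)) \<in> borel_measurable lborel" by measurable
    show "AE r in lborel. norm (\<alpha> r *\<^sub>R (indicator {a..d} r *\<^sub>R w r)) \<le> norm (B *\<^sub>R (indicator {a..d} r *\<^sub>R w r))"
    proof (rule AE_I2)
      fix r
      have "\<bar>\<alpha> r\<bar> * norm (indicator {a..d} r *\<^sub>R w r) \<le> \<bar>B\<bar> * norm (indicator {a..d} r *\<^sub>R w r)"
        using B[of r] z[of r] by (intro mult_right_mono) (cases "r \<in> {a..d}"; auto)+
      then show "norm (\<alpha> r *\<^sub>R (indicator {a..d} r *\<^sub>R w r)) \<le> norm (B *\<^sub>R (indicator {a..d} r *\<^sub>R w r))"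
        unfolding norm_scaleR[of "\<alpha> r"] norm_scaleR[of B] .
    qed
  qed
  moreover have "(\<lambda>r. \<alpha> r *\<^sub>R (indicator {a..d} r *\<^sub>R w r)) = (\<lambda>r. \<alpha> r *\<^sub>R w r)"
    using z by (intro ext) (auto simp: indicator_def split: split_of_bool)
  ultimately show ?thesis by simp
qed

lemma compact_pos_subset_Icc:
  fixes K :: "real set"
  assumes "compact K" "K \<subseteq> {0<..}"
  obtains a d where "0 < a" "K \<subseteq> {a..d}"
proof (cases "K = {}")
  case True
  then show thesis using that[of 1 1] by auto
next
  case False
  obtain a where a: "a \<in> K" "\<And>x. x \<in> K \<Longrightarrow> a \<le> x" using compact_attains_inf[OF assms(1) False] by blast
  obtain d where d: "d \<in> K" "\<And>x. x \<in> K \<Longrightarrow> x \<le> d" using compact_attains_sup[OF assms(1) False] by blast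
  have "0 < a" using a(1) assms(2) by auto
  moreover have "K \<subseteq> {a..d}" using a(2) d(2) by auto
  ultimately show thesis by (rule that)
qed

context radial_weak_grad
begin

text \<open>\<open>axis undefined 1\<close> is a unit vector in an unspecified direction. As
  \<open>radial\<close> holds at every point, \<open>u\<close> is recovered from the ray exactly and
  not only almost everywhere.\<close>

definition ray :: "real \<Rightarrow> complex" where
  "ray r = u (r *\<^sub>R axis undefined 1)"

lemma measurable_ray[measurable]: "ray \<in> borel_measurable borel"
  unfolding ray_def by measurable

lemma u_eq_ray: "u x = ray (norm x)"
  unfolding ray_def by (rule rad[unfolded radial_def, rule_format]) simp

lemma ray_L2: "integrable lborel (\<lambda>r. (sphere_area TYPE(real^'n) * r ^ (CARD('n) - 1) * indicator {0..} r) *\<^sub>R (norm (ray r))\<^sup>2)"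
proof -
  have "integrable lborel (\<lambda>x::real^'n. (norm (ray (norm x)))\<^sup>2)"
    using u unfolding wint0_sq u_eq_ray[symmetric] by simp
  then show ?thesis by (subst (asm) integrable_norm_iff) auto
qed

text \<open>Square integrability gives local integrability away from the origin: |z| is at most 1 +
  |z|^2, and on the interval the polar weight is at least its value at \<open>a\<close>.\<close>

lemma ray_set_integrable:
  assumes a: "0 < a"
  shows "set_integrable lborel {a..d} ray"
  unfolding set_integrable_def
proof (rule Bochner_Integration.integrable_bound)
  define W where "W r = sphere_area TYPE(real^'n) * r ^ (CARD('n) - 1)" for r
  have c: "W a > 0" using a omega_pos by (simp add: W_def)
  let ?h = "\<lambda>r. indicator {a..d} r + (1 / W a) * ((W r * indicator {0..} r) *\<^sub>R (norm (ray r))\<^sup>2)"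
  show "integrable lborel ?h" unfolding W_def
    by (intro Bochner_Integration.integrable_add integrable_mult_right ray_L2) (auto simp: integrable_indicator_iff emeasure_lborel_Icc_eq)
  show "AE r in lborel. norm (indicator {a..d} r *\<^sub>R ray r) \<le> norm (?h r)"
  proof (rule AE_I2)
    fix r
    show "norm (indicator {a..d} r *\<^sub>R ray r) \<le> norm (?h r)"
    proof (cases "r \<in> {a..d}")
      case True
      have "0 \<le> (norm (ray r) - 1)\<^sup>2" by simp
      then have "2 * norm (ray r) \<le> 1 + (norm (ray r))\<^sup>2" by (simp add: power2_eq_square algebra_simps)
      then have "norm (ray r) \<le> 1 + (norm (ray r))\<^sup>2" using norm_ge_zero[of "ray r"] by linarith
      also have "(norm (ray r))\<^sup>2 \<le> (W r / W a) * (norm (ray r))\<^sup>2"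
      proof -
        have "W a \<le> W r" unfolding W_def
          using True a omega_pos by (intro mult_left_mono power_mono) auto
        then have "1 \<le> W r / W a" using c by simp
        then show ?thesis using mult_right_mono[of 1 "W r / W a" "(norm (ray r))\<^sup>2"] by simp
      qed
      finally have "norm (ray r) \<le> ?h r" using True a by simp
      then show ?thesis using True by (simp add: abs_le_iff)
    next
      case False then show ?thesis by simp
    qed
  qed
qed auto

lemma profile_set_integrable:
  assumes a: "0 < a"
  shows "set_integrable lborel {a..d} profile"
  by (rule borel_integrable_atLeastAtMost') (rule continuous_on_subset[OF continuous_profile], use a in auto)

text \<open>Fubini: for fixed \<open>x\<close> the radii r < |x| contribute the integral of \<alpha>
  up to |x|, which is \<zeta>(|x|).\<close>

lemma profile_test:
  fixes \<alpha> \<zeta> :: "real \<Rightarrow> real"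
  assumes a: "0 < a" and \<alpha>: "continuous_on UNIV \<alpha>" "\<And>r. r \<notin> {a..d} \<Longrightarrow> \<alpha> r = 0"
    and \<zeta>: "\<And>r. (\<zeta> has_real_derivative \<alpha> r) (at r)" "\<And>r. r < a \<Longrightarrow> \<zeta> r = 0"
  shows "(\<integral>r. \<alpha> r *\<^sub>R profile r \<partial>lborel) = (- 1 / sphere_area TYPE(real^'n)) *\<^sub>R (\<integral>x. \<zeta> (norm x) *\<^sub>R flux x \<partial>lborel)"
proof -
  let ?w = "sphere_area TYPE(real^'n)"
  have [measurable]: "\<alpha> \<in> borel_measurable borel" using \<alpha>(1) by (rule borel_measurable_continuous_onI)
  define f where "f = (\<lambda>(r::real, x::real^'n). (\<alpha> r * indicator {r<..} (norm x)) *\<^sub>R flux x)"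
  have [measurable]: "f \<in> borel_measurable (lborel \<Otimes>\<^sub>M lborel)"
  proof -
    have "f = (\<lambda>p. (\<alpha> (fst p) * (if fst p < norm (snd p) then 1 else 0)) *\<^sub>R flux (snd p))"
      by (auto simp: f_def indicator_def)
    then show ?thesis by simp
  qed
  have ia: "integrable lborel \<alpha>"
  proof -
    have "set_integrable lborel {a..d} (\<lambda>_. 1::real)"
      by (rule borel_integrable_atLeastAtMost') auto
    from integrable_continuous_mult[OF this \<alpha>] show ?thesis by simp
  qed
  have int: "integrable (lborel \<Otimes>\<^sub>M lborel) f"
  proof (rule integrableI_bounded)
    let ?C = "\<integral>\<^sup>+x. ennreal (norm (indicator {a/2<..} (norm x) *\<^sub>R flux x)) \<partial>lborel"
    have C: "?C < \<infinity>" using flux_integrable[of "a/2"] a by (simp add: integrable_iff_bounded)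
    have "(\<integral>\<^sup>+p. ennreal (norm (f p)) \<partial>(lborel \<Otimes>\<^sub>M lborel)) = (\<integral>\<^sup>+r. \<integral>\<^sup>+x. ennreal (norm (f (r, x))) \<partial>lborel \<partial>lborel)"
      by (rule lborel.nn_integral_fst[symmetric]) measurable
    also have "\<dots> \<le> (\<integral>\<^sup>+r. \<integral>\<^sup>+x. ennreal \<bar>\<alpha> r\<bar> * ennreal (norm (indicator {a/2<..} (norm x) *\<^sub>R flux x)) \<partial>lborel \<partial>lborel)"
    proof (intro nn_integral_mono)
      fix r :: real and x :: "real^'n"
      show "ennreal (norm (f (r, x))) \<le> ennreal \<bar>\<alpha> r\<bar> * ennreal (norm (indicator {a/2<..} (norm x) *\<^sub>R flux x))"
      proof (cases "\<alpha> r = 0 \<or> norm x \<le> r")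
        case True
        then show ?thesis by (auto simp: f_def)
      next
        case False
        then have "r \<ge> a" using \<alpha>(2)[of r] by auto
        then have "norm x > a / 2" using False a by auto
        then show ?thesis using False by (simp add: f_def abs_mult ennreal_mult)
      qed
    qed
    also have "\<dots> = (\<integral>\<^sup>+r. ennreal \<bar>\<alpha> r\<bar> \<partial>lborel) * ?C"
      by (simp add: nn_integral_cmult nn_integral_multc)
    also have "\<dots> < \<infinity>"
      using C ia by (simp add: integrable_iff_bounded ennreal_mult_less_top)
    finally show "(\<integral>\<^sup>+p. ennreal (norm (f p)) \<partial>(lborel \<Otimes>\<^sub>M lborel)) < \<infinity>" .
  qed measurable
  have inner: "(\<integral>r. \<alpha> r * indicator {r<..} R \<partial>lborel) = \<zeta> R" if "R \<ge> 0" for R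
  proof -
    have "(\<integral>r. \<alpha> r * indicator {r<..} R \<partial>lborel) = (\<integral>r. \<alpha> r * indicator {0..R} r \<partial>lborel)"
      using \<alpha>(2) a by (intro integral_discrete_difference[of "{R}"]) (auto simp: indicator_def)
    also have "\<dots> = \<zeta> R - \<zeta> 0"
      using \<zeta>(1) \<alpha>(1) that by (intro integral_FTC_Icc_real) (auto simp: continuous_on_eq_continuous_at)
    finally show ?thesis using \<zeta>(2)[of 0] a by simp
  qed
  have "(\<integral>r. \<alpha> r *\<^sub>R profile r \<partial>lborel) = (\<integral>r. (- 1 / ?w) *\<^sub>R (\<integral>x. f (r, x) \<partial>lborel) \<partial>lborel)"
    by (intro Bochner_Integration.integral_cong refl)
       (simp add: f_def profile_def scaleR_scaleR[symmetric] scaleR_left_commute del: scaleR_scaleR)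
  also have "\<dots> = (- 1 / ?w) *\<^sub>R (\<integral>r. (\<integral>x. f (r, x) \<partial>lborel) \<partial>lborel)"
    by (rule integral_scaleR_right)
  also have "(\<integral>r. (\<integral>x. f (r, x) \<partial>lborel) \<partial>lborel) = (\<integral>x. (\<integral>r. f (r, x) \<partial>lborel) \<partial>lborel)"
    using lborel_pair.Fubini_integral[of "\<lambda>r x. f (r, x)"] int by simp
  also have "(\<integral>x. (\<integral>r. f (r, x) \<partial>lborel) \<partial>lborel) = (\<integral>x. \<zeta> (norm x) *\<^sub>R flux x \<partial>lborel)"
  proof (intro Bochner_Integration.integral_cong refl)
    fix x :: "real^'n"
    have "integrable lborel (\<lambda>r. \<alpha> r * indicator {r<..} (norm x))"
    proof (rule Bochner_Integration.integrable_bound[OF ia])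
      have "(\<lambda>r. \<alpha> r * indicator {r<..} (norm x)) = (\<lambda>r. \<alpha> r * (if r < norm x then 1 else 0))"
        by (auto simp: indicator_def)
      then show "(\<lambda>r. \<alpha> r * indicator {r<..} (norm x)) \<in> borel_measurable lborel" by simp
    qed (auto simp: indicator_def)
    then show "(\<integral>r. f (r, x) \<partial>lborel) = \<zeta> (norm x) *\<^sub>R flux x"
      by (simp add: f_def inner)
  qed
  finally show ?thesis .
qed

end

lemma continuous_compact_support_integrable:
  fixes \<alpha> :: "real \<Rightarrow> real"
  assumes "continuous_on UNIV \<alpha>" "\<And>r. r \<notin> {a..d} \<Longrightarrow> \<alpha> r = 0"
  shows "integrable lborel \<alpha>"
proof -
  have "set_integrable lborel {a..d} (\<lambda>_. 1::real)"
    by (rule borel_integrable_atLeastAtMost') auto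
  from integrable_continuous_mult[OF this assms] show ?thesis by simp
qed

context radial_weak_grad
begin

text \<open>A mean-zero \<alpha> has a compactly supported primitive \<zeta>, and testing the ray
  and testing the profile then both lead to the same integral of the flux against \<zeta>. In other
  words, the difference has weak derivative 0.\<close>

lemma ray_profile_orthogonal:
  fixes \<alpha> :: "real \<Rightarrow> real"
  assumes a: "0 < a" and \<alpha>: "continuous_on UNIV \<alpha>" "\<And>r. r \<notin> {a..d} \<Longrightarrow> \<alpha> r = 0"
    and mean: "(\<integral>r. \<alpha> r \<partial>lborel) = 0"
  shows "(\<integral>r. \<alpha> r *\<^sub>R (ray r - profile r) \<partial>lborel) = 0"
proof -
  let ?w = "sphere_area TYPE(real^'n)"
  have [measurable]: "\<alpha> \<in> borel_measurable borel" using \<alpha>(1) by (rule borel_measurable_continuous_onI)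
  \<comment> \<open>For negative \<open>r\<close> the interval is empty and the value is 0, in
    agreement with the vanishing below \<open>a\<close>.\<close>
  define \<zeta> where "\<zeta> r = integral {0..r} \<alpha>" for r
  have z0: "\<zeta> r = 0" if "r < a" for r
  proof -
    have "integral {0..r} \<alpha> = integral {0..r} (\<lambda>_. 0)"
      using that \<alpha>(2) by (intro Henstock_Kurzweil_Integration.integral_cong) auto
    then show ?thesis by (simp add: \<zeta>_def)
  qed
  have dz: "(\<zeta> has_real_derivative \<alpha> r) (at r)" for r
  proof (cases "r < a")
    case True
    have "((\<lambda>_. 0) has_real_derivative \<alpha> r) (at r)" using \<alpha>(2)[of r] True by simp
    then show ?thesis
      by (rule has_field_derivative_transform_within_open[of _ _ _ "{..<a}"]) (use True z0 in auto)
  next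
    case False
    then have r: "0 < r" using a by simp
    have "(\<zeta> has_real_derivative \<alpha> r) (at r within {0..r + 1})"
      unfolding \<zeta>_def using r by (intro integral_has_real_derivative continuous_on_subset[OF \<alpha>(1)]) auto
    moreover have "at r within {0..r + 1} = at r"
      using r by (intro at_within_interior) (auto simp: interior_atLeastAtMost_real)
    ultimately show ?thesis by simp
  qed
  have z1: "\<zeta> r = 0" if "r > d" for r
  proof (cases "r < a")
    case False
    then have r: "r \<ge> 0" using a by simp
    have "(\<integral>t. \<alpha> t * indicator {0..r} t \<partial>lborel) = \<zeta> r - \<zeta> 0"
      using dz \<alpha>(1) r by (intro integral_FTC_Icc_real) (auto simp: continuous_on_eq_continuous_at)
    moreover have "(\<lambda>t. \<alpha> t * indicator {0..r} t) = \<alpha>"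
    proof
      fix t
      show "\<alpha> t * indicator {0..r} t = \<alpha> t"
        using \<alpha>(2)[of t] a that by (cases "t \<in> {a..d}") auto
    qed
    ultimately show ?thesis using mean z0[of 0] a by simp
  qed (rule z0)
  have \<alpha>': "\<alpha> r = 0" if "r < a" for r using \<alpha>(2) that by auto
  have ir: "integrable lborel (\<lambda>r. \<alpha> r *\<^sub>R ray r)"
    by (rule integrable_continuous_mult[OF ray_set_integrable[OF a] \<alpha>])
  have ip: "integrable lborel (\<lambda>r. \<alpha> r *\<^sub>R profile r)"
    by (rule integrable_continuous_mult[OF profile_set_integrable[OF a] \<alpha>])
  have "- (\<integral>x. \<zeta> (norm x) *\<^sub>R flux x \<partial>lborel) = (\<integral>x. (\<alpha> (norm x) * norm x powr (1 - real CARD('n))) *\<^sub>R u x \<partial>lborel)"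
    using radial_test[OF a \<alpha>(1) \<alpha>' dz z0 z1] by simp
  also have "\<dots> = (\<integral>(x::real^'n). (\<alpha> (norm x) * norm x powr (1 - real CARD('n))) *\<^sub>R ray (norm x) \<partial>lborel)"
    by (simp add: u_eq_ray[symmetric])
  also have "\<dots> = (\<integral>r. (?w * r ^ (CARD('n) - 1) * indicator {0..} r) *\<^sub>R ((\<alpha> r * r powr (1 - real CARD('n))) *\<^sub>R ray r) \<partial>lborel)"
    by (subst integral_norm) auto
  also have "\<dots> = (\<integral>r. ?w *\<^sub>R (\<alpha> r *\<^sub>R ray r) \<partial>lborel)"
  proof (intro Bochner_Integration.integral_cong refl)
    fix r
    show "(?w * r ^ (CARD('n) - 1) * indicator {0..} r) *\<^sub>R ((\<alpha> r * r powr (1 - real CARD('n))) *\<^sub>R ray r) = ?w *\<^sub>R (\<alpha> r *\<^sub>R ray r)"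
    proof (cases "r < a")
      case True then show ?thesis by (simp add: \<alpha>')
    next
      case False
      then have r: "r > 0" using a by simp
      have "r ^ (CARD('n) - 1) * r powr (1 - real CARD('n)) = 1"
        using r by (simp add: powr_realpow[symmetric] powr_add[symmetric] of_nat_diff)
      then show ?thesis using r by (simp add: ac_simps)
    qed
  qed
  also have "\<dots> = ?w *\<^sub>R (\<integral>r. \<alpha> r *\<^sub>R ray r \<partial>lborel)" by (rule integral_scaleR_right)
  finally have 1: "?w *\<^sub>R (\<integral>r. \<alpha> r *\<^sub>R ray r \<partial>lborel) = - (\<integral>x. \<zeta> (norm x) *\<^sub>R flux x \<partial>lborel)" by simp
  have 2: "(\<integral>r. \<alpha> r *\<^sub>R profile r \<partial>lborel) = (- 1 / ?w) *\<^sub>R (\<integral>x. \<zeta> (norm x) *\<^sub>R flux x \<partial>lborel)"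
    by (rule profile_test[OF a \<alpha> dz z0])
  have "(\<integral>r. \<alpha> r *\<^sub>R ray r \<partial>lborel) = (1 / ?w) *\<^sub>R (?w *\<^sub>R (\<integral>r. \<alpha> r *\<^sub>R ray r \<partial>lborel))"
    using omega_pos by simp
  also have "\<dots> = (\<integral>r. \<alpha> r *\<^sub>R profile r \<partial>lborel)" unfolding 1 2 by simp
  finally show ?thesis using Bochner_Integration.integral_diff[OF ir ip] by (simp add: scaleR_diff_right)
qed

text \<open>The du Bois-Reymond argument: a test function becomes mean-zero after subtracting a
  multiple of a fixed \<beta> of integral 1, so the difference minus its \<beta>-average is
  orthogonal to every test function.\<close>

lemma ray_eq_profile_plus_const:
  obtains \<kappa> where "AE r in lborel. r > 0 \<longrightarrow> ray r = profile r + \<kappa>"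
proof -
  \<comment> \<open>The factor 6 normalises the integral of (r - 1)(2 - r) over [1,2], which is 1/6.
    Continuity suffices, since \<open>ray_profile_orthogonal\<close> asks no more of
    \<alpha>.\<close>
  define \<beta> :: "real \<Rightarrow> real" where "\<beta> r = 6 * max 0 ((r - 1) * (2 - r))" for r
  have b1: "continuous_on UNIV \<beta>" unfolding \<beta>_def by (intro continuous_intros)
  have b2: "\<beta> r = 0" if "r \<notin> {1..2}" for r
    using that by (auto simp: \<beta>_def max_def mult_le_0_iff zero_le_mult_iff)
  have b3: "(\<integral>r. \<beta> r \<partial>lborel) = 1"
  proof -
    let ?F = "\<lambda>r::real. - 2 * r ^ 3 + 9 * r ^ 2 - 12 * r"
    have "(\<integral>r. \<beta> r \<partial>lborel) = (\<integral>r. (6 * ((r - 1) * (2 - r))) * indicator {1..2} r \<partial>lborel)"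
    proof (intro Bochner_Integration.integral_cong refl)
      fix r :: real
      show "\<beta> r = (6 * ((r - 1) * (2 - r))) * indicator {1..2} r"
        using b2[of r] by (cases "r \<in> {1..2}") (auto simp: \<beta>_def max_def)
    qed
    also have "\<dots> = ?F 2 - ?F 1"
      by (rule integral_FTC_Icc_real) (auto intro!: derivative_eq_intros continuous_intros simp: algebra_simps power2_eq_square)
    finally show ?thesis by simp
  qed
  define \<kappa> where "\<kappa> = (\<integral>r. \<beta> r *\<^sub>R (ray r - profile r) \<partial>lborel)"
  have loc: "set_integrable lborel {a..d} (\<lambda>r. ray r - profile r)" if "0 < a" for a d
    using ray_set_integrable[OF that] profile_set_integrable[OF that] by (rule set_integral_diff(1))
  \<comment> \<open>Continuity of the profile, and with it measurability, is available on positive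
    radii, so \<open>w\<close> is cut off to them.\<close>
  define w where "w r = indicator {0<..} r *\<^sub>R (ray r - profile r - \<kappa>)" for r
  have [measurable]: "w \<in> borel_measurable borel"
  proof -
    have "(\<lambda>r. indicator {0<..} r *\<^sub>R profile r) \<in> borel_measurable borel"
      by (rule borel_measurable_continuous_on_indicator[OF _ continuous_profile]) auto
    then have "(\<lambda>r. indicator {0<..} r *\<^sub>R ray r - indicator {0<..} r *\<^sub>R profile r - indicator {0<..} r *\<^sub>R \<kappa>) \<in> borel_measurable borel"
      by measurable
    then show ?thesis unfolding w_def scaleR_diff_right .
  qed
  have "AE r in lborel. r \<in> {0<..} \<longrightarrow> w r = 0"
  proof (rule fundamental_lemma_complex)
    show "set_integrable lborel K w" if K: "compact K" "K \<subseteq> {0<..}" for K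
    proof -
      obtain a d where ad: "0 < a" "K \<subseteq> {a..d}" using compact_pos_subset_Icc[OF K] by blast
      have "set_integrable lborel {a..d} (\<lambda>r. ray r - profile r - \<kappa>)"
        by (rule set_integral_diff(1)[OF loc[OF ad(1)]]) (rule borel_integrable_atLeastAtMost', auto)
      then have "set_integrable lborel K (\<lambda>r. ray r - profile r - \<kappa>)"
        using ad(2) borel_compact[OF K(1)] by (rule_tac set_integrable_subset[of _ "{a..d}"]) auto
      moreover have "(\<lambda>r. indicator K r *\<^sub>R w r) = (\<lambda>r. indicator K r *\<^sub>R (ray r - profile r - \<kappa>))"
      proof
        fix r
        show "indicator K r *\<^sub>R w r = indicator K r *\<^sub>R (ray r - profile r - \<kappa>)"
          using K(2) by (cases "r \<in> K") (auto simp: w_def)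
      qed
      ultimately show ?thesis by (simp add: set_integrable_def)
    qed
    fix \<phi> :: "real \<Rightarrow> real" and K
    assume \<phi>: "C1_fun \<phi>" "compact K" "K \<subseteq> {0<..}" "\<And>x. x \<notin> K \<Longrightarrow> \<phi> x = 0"
    obtain a0 d0 where ad: "0 < a0" "K \<subseteq> {a0..d0}" using compact_pos_subset_Icc[OF \<phi>(2,3)] by blast
    \<comment> \<open>The interval is enlarged so that it also contains [1,2], the support of
      \<beta>.\<close>
    define a where "a = min a0 1"
    define d where "d = max d0 2"
    have a: "0 < a" using ad by (simp add: a_def)
    have p1: "continuous_on UNIV \<phi>" using \<phi>(1) by (rule C1_fun_continuous)
    have p2: "\<phi> r = 0" if "r \<notin> {a..d}" for r
    proof (rule \<phi>(4))
      show "r \<notin> K" using that ad(2) unfolding a_def d_def by (auto simp: subset_eq)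
    qed
    have b2': "\<beta> r = 0" if "r \<notin> {a..d}" for r
      using that by (intro b2) (auto simp: a_def d_def)
    have ip: "integrable lborel \<phi>" by (rule continuous_compact_support_integrable[OF p1 p2])
    have ib: "integrable lborel \<beta>" by (rule continuous_compact_support_integrable[OF b1 b2])
    define m where "m = (\<integral>r. \<phi> r \<partial>lborel)"
    have "(\<integral>r. (\<phi> r - m * \<beta> r) *\<^sub>R (ray r - profile r) \<partial>lborel) = 0"
    proof (rule ray_profile_orthogonal[OF a])
      show "continuous_on UNIV (\<lambda>r. \<phi> r - m * \<beta> r)" by (intro continuous_intros p1 b1)
      show "\<phi> r - m * \<beta> r = 0" if "r \<notin> {a..d}" for r using p2[OF that] b2'[OF that] by simp
      show "(\<integral>r. \<phi> r - m * \<beta> r \<partial>lborel) = 0" using ip ib by (simp add: b3 m_def)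
    qed
    moreover have iP: "integrable lborel (\<lambda>r. \<phi> r *\<^sub>R (ray r - profile r))"
      by (rule integrable_continuous_mult[OF loc[OF a] p1 p2])
    moreover have iB: "integrable lborel (\<lambda>r. \<beta> r *\<^sub>R (ray r - profile r))"
      by (rule integrable_continuous_mult[OF loc[OF a] b1 b2'])
    ultimately have eq: "(\<integral>r. \<phi> r *\<^sub>R (ray r - profile r) \<partial>lborel) = m *\<^sub>R \<kappa>"
      using Bochner_Integration.integral_diff[OF iP integrable_scaleR_right[OF iB, of m]]
      unfolding \<kappa>_def integral_scaleR_right by (simp add: scaleR_diff_left)
    have "(\<integral>r. \<phi> r *\<^sub>R w r \<partial>lborel) = (\<integral>r. \<phi> r *\<^sub>R (ray r - profile r) - \<phi> r *\<^sub>R \<kappa> \<partial>lborel)"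
    proof (intro Bochner_Integration.integral_cong refl)
      fix r
      show "\<phi> r *\<^sub>R w r = \<phi> r *\<^sub>R (ray r - profile r) - \<phi> r *\<^sub>R \<kappa>"
      proof (cases "r \<in> K")
        case True
        then show ?thesis using \<phi>(3) by (auto simp: w_def scaleR_diff_right)
      qed (simp add: \<phi>(4))
    qed
    also have "\<dots> = (\<integral>r. \<phi> r *\<^sub>R (ray r - profile r) \<partial>lborel) - (\<integral>r. \<phi> r *\<^sub>R \<kappa> \<partial>lborel)"
      by (rule Bochner_Integration.integral_diff[OF iP]) (rule integrable_scaleR_left, rule ip)
    also have "\<dots> = 0" using ip by (simp add: eq m_def)
    finally show "(\<integral>r. \<phi> r *\<^sub>R w r \<partial>lborel) = 0" .
  qed auto
  then have "AE r in lborel. r > 0 \<longrightarrow> ray r = profile r + \<kappa>"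
    by eventually_elim (auto simp: w_def algebra_simps)
  then show thesis by (rule that)
qed

text \<open>The profile tends to 0, so a nonzero constant \<kappa> would keep |u| above |\<kappa>| /
  2 outside some ball, a region of infinite volume; this contradicts square integrability.\<close>

lemma u_eq_profile: "AE x in lborel. u x = profile (norm x)"
proof -
  let ?w = "sphere_area TYPE(real^'n)"
  obtain \<kappa> where \<kappa>: "AE r in lborel. r > 0 \<longrightarrow> ray r = profile r + \<kappa>" by (rule ray_eq_profile_plus_const)
  define P where "P r \<longleftrightarrow> r > 0 \<longrightarrow> ray r = profile r + \<kappa>" for r
  have [measurable]: "(\<lambda>r. indicator {0<..} r *\<^sub>R profile r) \<in> borel_measurable borel"
    by (rule borel_measurable_continuous_on_indicator[OF _ continuous_profile]) auto
  have "Measurable.pred borel P"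
  proof -
    have "P = (\<lambda>r. indicator {0<..} r *\<^sub>R ray r = indicator {0<..} r *\<^sub>R profile r + indicator {0<..} r *\<^sub>R \<kappa>)"
      by (auto simp: P_def fun_eq_iff indicator_def)
    then show ?thesis by simp
  qed
  then have "AE x in (lborel :: (real^'n) measure). P (norm x)"
  proof (rule AE_norm[rotated])
    show "AE r in lborel. 0 < r \<longrightarrow> P r" using \<kappa> by eventually_elim (simp add: P_def)
  qed
  then have ae: "AE x in lborel. u x = profile (norm x) + \<kappa>"
    using AE_lborel_singleton[of 0] by eventually_elim (auto simp: P_def u_eq_ray)
  have "\<kappa> = 0"
  proof (rule ccontr)
    assume k0: "\<kappa> \<noteq> 0"
    define C where "C = sqrt (1 / (?w * (real CARD('n) - 2 + b))) * wnorm b 2 g"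
    have "((\<lambda>r. C * r powr (- (real CARD('n) - 2 + b) / 2)) \<longlongrightarrow> C * 0) at_top"
      using dim by (intro tendsto_intros tendsto_neg_powr filterlim_ident) auto
    then have "\<forall>\<^sub>F r in at_top. C * r powr (- (real CARD('n) - 2 + b) / 2) < norm \<kappa> / 2"
      using k0 by (intro order_tendstoD(2)[of _ "C * 0"]) auto
    then obtain R0 where R0: "\<And>r. r \<ge> R0 \<Longrightarrow> C * r powr (- (real CARD('n) - 2 + b) / 2) < norm \<kappa> / 2"
      unfolding eventually_at_top_linorder by blast
    define R where "R = max 1 R0"
    have lower: "norm \<kappa> / 2 \<le> norm (profile r + \<kappa>)" if "r > R" for r
    proof -
      have "norm (profile r) \<le> C * r powr (- (real CARD('n) - 2 + b) / 2)"
        using profile_bound[of r] that by (simp add: C_def R_def ac_simps)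
      also have "\<dots> < norm \<kappa> / 2" using that by (intro R0) (simp add: R_def)
      finally show ?thesis using norm_triangle_ineq4[of "profile r + \<kappa>" "profile r"] by simp
    qed
    let ?I = "\<integral>x. (norm (u x))\<^sup>2 \<partial>lborel"
    have iu: "integrable lborel (\<lambda>x. (norm (u x))\<^sup>2)" using u by (simp add: wint0_sq)
    have bound: "?w * R ^ (CARD('n) - 1) * L * (norm \<kappa> / 2)\<^sup>2 \<le> ?I" if "L \<ge> 0" for L
    proof -
      let ?S = "{x::real^'n. R < norm x \<and> norm x \<le> R + L}"
      have "ennreal (?w * R ^ (CARD('n) - 1) * L * (norm \<kappa> / 2)\<^sup>2)
        = ennreal (?w * R ^ (CARD('n) - 1) * (R + L - R)) * ennreal ((norm \<kappa> / 2)\<^sup>2)"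
        using that omega_pos by (subst ennreal_mult[symmetric]) (auto simp: R_def)
      also have "\<dots> \<le> emeasure lborel ?S * ennreal ((norm \<kappa> / 2)\<^sup>2)"
        using shell_volume_lower[of R "R + L", where 'a="real^'n"] that
        by (intro mult_right_mono) (auto simp: R_def)
      also have "\<dots> = (\<integral>\<^sup>+x. ennreal ((norm \<kappa> / 2)\<^sup>2) * indicator ?S x \<partial>lborel)"
        by (subst nn_integral_cmult_indicator) (auto simp: mult.commute)
      also have "\<dots> \<le> (\<integral>\<^sup>+x. ennreal ((norm (u x))\<^sup>2) \<partial>lborel)"
      proof (rule nn_integral_mono_AE)
        show "AE x in lborel. ennreal ((norm \<kappa> / 2)\<^sup>2) * indicator ?S x \<le> ennreal ((norm (u x))\<^sup>2)"
          using ae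
        proof eventually_elim
          case (elim x)
          show ?case
          proof (cases "x \<in> ?S")
            case True
            then have "(norm \<kappa> / 2)\<^sup>2 \<le> (norm (u x))\<^sup>2" using lower[of "norm x"] elim by (intro power_mono) auto
            then show ?thesis using True by (auto intro: ennreal_leI)
          qed auto
        qed
      qed
      also have "\<dots> = ennreal ?I" by (rule nn_integral_eq_integral[OF iu]) auto
      finally show ?thesis by (subst (asm) ennreal_le_iff) (auto intro!: Bochner_Integration.integral_nonneg)
    qed
    \<comment> \<open>The mass would be at least \<open>c * L\<close> for every thickness
      \<open>L\<close> of the shell.\<close>
    define c where "c = ?w * R ^ (CARD('n) - 1) * (norm \<kappa> / 2)\<^sup>2"
    have c: "c > 0" using k0 omega_pos unfolding c_def by (auto simp: R_def)
    have "?I \<ge> 0" by (rule Bochner_Integration.integral_nonneg) auto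
    have "c * L \<le> ?I" if "L \<ge> 0" for L using bound[OF that] by (simp add: c_def ac_simps)
    from this[of "(?I + 1) / c"] have "c * ((?I + 1) / c) \<le> ?I" using c \<open>?I \<ge> 0\<close> by simp
    then show False using c by simp
  qed
  then show ?thesis using ae by simp
qed

text \<open>Averaging over a shell of thickness \<delta>: |F(r)|^2 is at most twice |F(r) - F(s)|^2
  plus twice |F(s)|^2. The first term is small by \<open>profile_diff\<close>; the second integrates
  over the shell to at most the mass.\<close>

lemma profile_strauss_aux:
  assumes r: "r > 0" and \<delta>: "\<delta> > 0"
  shows "(norm (profile r))\<^sup>2 \<le> 2 / (sphere_area TYPE(real^'n) * r ^ (CARD('n) - 1) * \<delta>) * (wnorm 0 2 u)\<^sup>2
    + 2 / sphere_area TYPE(real^'n) * r powr (1 - real CARD('n) - b) * \<delta> * (wnorm b 2 g)\<^sup>2"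
proof -
  let ?w = "sphere_area TYPE(real^'n)"
  define E where "E = 1 / ?w * r powr (1 - real CARD('n) - b) * \<delta> * (wnorm b 2 g)\<^sup>2"
  define A where "A = (norm (profile r))\<^sup>2 / 2 - E"
  define V where "V = ?w * r ^ (CARD('n) - 1) * \<delta>"
  have V: "V > 0" unfolding V_def using r \<delta> omega_pos by simp
  have iu: "integrable lborel (\<lambda>x. (norm (u x))\<^sup>2)" using u by (simp add: wint0_sq)
  let ?S = "{x::real^'n. r < norm x \<and> norm x \<le> r + \<delta>}"
  have low: "A \<le> (norm (profile s))\<^sup>2" if "r < s" "s \<le> r + \<delta>" for s
  proof -
    have "(norm (profile r - profile s))\<^sup>2 \<le> 1 / ?w * r powr (1 - real CARD('n) - b) * (s - r) * (wnorm b 2 g)\<^sup>2"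
      using that r by (intro profile_diff) auto
    also have "\<dots> \<le> E" unfolding E_def using that omega_pos by (intro mult_right_mono mult_left_mono) auto
    finally have 1: "(norm (profile r - profile s))\<^sup>2 \<le> E" .
    have "norm (profile r) \<le> norm (profile r - profile s) + norm (profile s)"
      using norm_triangle_ineq[of "profile r - profile s" "profile s"] by simp
    then have "(norm (profile r))\<^sup>2 \<le> (norm (profile r - profile s) + norm (profile s))\<^sup>2"
      by (intro power_mono) auto
    also have "\<dots> \<le> 2 * (norm (profile r - profile s))\<^sup>2 + 2 * (norm (profile s))\<^sup>2"
      using zero_le_power2[of "norm (profile r - profile s) - norm (profile s)"] by (simp add: power2_eq_square algebra_simps)
    finally show ?thesis using 1 unfolding A_def by simp
  qed
  have "A * V \<le> (wnorm 0 2 u)\<^sup>2"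
  proof (cases "A \<le> 0")
    case True
    then have "A * V \<le> 0" using V by (simp add: mult_le_0_iff)
    then show ?thesis using zero_le_power2 order_trans by blast
  next
    case False
    have "ennreal (A * V) = ennreal A * ennreal V" using False V by (intro ennreal_mult) auto
    also have "\<dots> \<le> ennreal A * emeasure lborel ?S"
      using shell_volume_lower[of r "r + \<delta>", where 'a="real^'n"] r \<delta> by (intro mult_left_mono) (auto simp: V_def)
    also have "\<dots> = (\<integral>\<^sup>+x. ennreal A * indicator ?S x \<partial>lborel)"
      by (subst nn_integral_cmult_indicator) auto
    also have "\<dots> \<le> (\<integral>\<^sup>+x. ennreal ((norm (u x))\<^sup>2) \<partial>lborel)"
    proof (rule nn_integral_mono_AE)
      show "AE x in lborel. ennreal A * indicator ?S x \<le> ennreal ((norm (u x))\<^sup>2)"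
        using u_eq_profile
      proof eventually_elim
        case (elim x)
        show ?case
          using low[of "norm x"] elim by (cases "x \<in> ?S") (auto intro: ennreal_leI)
      qed
    qed
    also have "\<dots> = ennreal ((wnorm 0 2 u)\<^sup>2)" unfolding wnorm0_sq by (rule nn_integral_eq_integral[OF iu]) auto
    finally show ?thesis by (subst (asm) ennreal_le_iff) auto
  qed
  then have "A \<le> (wnorm 0 2 u)\<^sup>2 / V" using V by (simp add: pos_le_divide_eq)
  then have "(norm (profile r))\<^sup>2 \<le> 2 * ((wnorm 0 2 u)\<^sup>2 / V) + 2 * E" unfolding A_def by simp
  then show ?thesis unfolding V_def E_def by (simp add: ac_simps)
qed

text \<open>The two terms of the auxiliary bound balance at \<delta> = (M / G) r^(b/2). So that
  \<delta> is positive and defined also when M or G is 0, both are raised by \<open>e\<close>, which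
  then tends to 0.\<close>

lemma profile_strauss:
  assumes r: "r > 0"
  shows "(norm (profile r))\<^sup>2 \<le> 4 / sphere_area TYPE(real^'n) * r powr (1 - real CARD('n) - b / 2) * wnorm 0 2 u * wnorm b 2 g"
proof -
  let ?w = "sphere_area TYPE(real^'n)"
  let ?M = "wnorm 0 2 u" and ?G = "wnorm b 2 g"
  have gen1: "2 / (w * A * (X / Y * B)) * X\<^sup>2 = 2 / w * (1 / (A * B)) * X * Y"
    if "0 < w" "0 < A" "0 < B" "0 < X" "0 < Y" for w A B X Y :: real
    using that by (simp add: field_simps power2_eq_square)
  have gen2: "2 / w * P * (X / Y * B) * Y\<^sup>2 = 2 / w * (P * B) * X * Y" if "0 < Y" for w P X B Y :: real
    using that by (simp add: power2_eq_square)
  have ineq: "(norm (profile r))\<^sup>2 \<le> 4 / ?w * r powr (1 - real CARD('n) - b / 2) * (?M + e) * (?G + e)" if e: "e > 0" for e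
  proof -
    define \<delta> where "\<delta> = (?M + e) / (?G + e) * r powr (b / 2)"
    have pos: "?M + e > 0" "?G + e > 0" using e wnorm_nonneg by (auto intro: add_nonneg_pos)
    have \<delta>: "\<delta> > 0" unfolding \<delta>_def using pos r by simp
    have p: "r ^ (CARD('n) - 1) = r powr (real CARD('n) - 1)"
      using r by (simp add: powr_realpow[symmetric] of_nat_diff)
    have "(norm (profile r))\<^sup>2 \<le> 2 / (?w * r ^ (CARD('n) - 1) * \<delta>) * ?M\<^sup>2 + 2 / ?w * r powr (1 - real CARD('n) - b) * \<delta> * ?G\<^sup>2"
      by (rule profile_strauss_aux[OF r \<delta>])
    also have "\<dots> \<le> 2 / (?w * r ^ (CARD('n) - 1) * \<delta>) * (?M + e)\<^sup>2 + 2 / ?w * r powr (1 - real CARD('n) - b) * \<delta> * (?G + e)\<^sup>2"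
      using omega_pos \<delta> r e by (intro add_mono mult_left_mono power_mono) (auto simp: wnorm_nonneg)
    also have "2 / (?w * r ^ (CARD('n) - 1) * \<delta>) * (?M + e)\<^sup>2 = 2 / ?w * r powr (1 - real CARD('n) - b / 2) * (?M + e) * (?G + e)"
    proof -
      have "r powr (1 - real CARD('n) - b / 2) = 1 / (r powr (real CARD('n) - 1) * r powr (b / 2))"
        using r by (simp add: powr_add[symmetric] powr_minus_divide[symmetric])
      then show ?thesis
        unfolding \<delta>_def p using gen1[OF omega_pos _ _ pos, of "r powr (real CARD('n) - 1)" "r powr (b / 2)"] r by simp
    qed
    also have "2 / ?w * r powr (1 - real CARD('n) - b) * \<delta> * (?G + e)\<^sup>2 = 2 / ?w * r powr (1 - real CARD('n) - b / 2) * (?M + e) * (?G + e)"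
    proof -
      have "r powr (1 - real CARD('n) - b) * r powr (b / 2) = r powr (1 - real CARD('n) - b / 2)"
        by (simp add: powr_add[symmetric])
      then show ?thesis
        unfolding \<delta>_def using gen2[OF pos(2), of ?w "r powr (1 - real CARD('n) - b)" "?M + e" "r powr (b / 2)"] by simp
    qed
    finally show ?thesis by (simp add: ac_simps)
  qed
  show ?thesis
  proof (rule tendsto_lowerbound[where F = "at_right (0::real)"])
    show "((\<lambda>e. 4 / ?w * r powr (1 - real CARD('n) - b / 2) * (?M + e) * (?G + e))
       \<longlongrightarrow> 4 / ?w * r powr (1 - real CARD('n) - b / 2) * ?M * ?G) (at_right 0)"
      using omega_pos by (auto intro!: tendsto_eq_intros)
    show "\<forall>\<^sub>F e in at_right 0. (norm (profile r))\<^sup>2 \<le> 4 / ?w * r powr (1 - real CARD('n) - b / 2) * (?M + e) * (?G + e)"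
      using eventually_at_right_less[of "0::real"] by eventually_elim (rule ineq)
  qed simp
qed

end

section \<open>The radial Gagliardo--Nirenberg inequality\<close>

lemma wgrad_props:
  assumes "in_Wb b u"
  shows "weak_grad u (wgrad b u)" "wint b 2 (wgrad b u)"
proof -
  have "\<exists>g. weak_grad u g \<and> wint b 2 g" using assms by (simp add: in_Wb_def)
  from someI_ex[OF this] show "weak_grad u (wgrad b u)" "wint b 2 (wgrad b u)"
    by (simp_all add: wgrad_def)
qed

lemma grad_norm_nonneg: "grad_norm b u \<ge> 0"
  by (simp add: grad_norm_def wnorm_nonneg)

text \<open>By almost-everywhere uniqueness the chosen gradient may be replaced by an explicit one,
  as is done for cutoffs and for variations.\<close>

lemma grad_norm_eqI:
  assumes "wint 0 2 u" "weak_grad u g" "wint b 2 g"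
  shows "in_Wb b u" "(grad_norm b u)\<^sup>2 = (\<integral>x. norm x powr b * (norm (g x))\<^sup>2 \<partial>lborel)"
proof -
  show W: "in_Wb b u" using assms by (auto simp: in_Wb_def)
  have m: "g \<in> borel_measurable borel" "wgrad b u \<in> borel_measurable borel"
    using assms(3) wgrad_props(2)[OF W] by (auto simp: wint_def)
  note [measurable] = m
  have "AE x in lborel. wgrad b u x = g x"
    by (rule weak_grad_unique[OF wgrad_props(1)[OF W] m(2) assms(2) m(1)])
  then show "(grad_norm b u)\<^sup>2 = (\<integral>x. norm x powr b * (norm (g x))\<^sup>2 \<partial>lborel)"
    unfolding grad_norm_def wnorm_sq by (intro integral_cong_AE) auto
qed

text \<open>What the later arguments use of the profile of the chosen gradient: the Strauss bound
  serves large radii, the bound by the gradient norm alone serves small ones.\<close>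

definition is_profile :: "real \<Rightarrow> (real^'n \<Rightarrow> complex) \<Rightarrow> (real \<Rightarrow> complex) \<Rightarrow> bool" where
  "is_profile b u F \<longleftrightarrow> continuous_on {0<..} F \<and> (AE x in lborel. u x = F (norm x)) \<and>
    (\<forall>r>0. (norm (F r))\<^sup>2 \<le> 4 / sphere_area TYPE(real^'n) * r powr (1 - real CARD('n) - b / 2) * wnorm 0 2 u * grad_norm b u) \<and>
    (\<forall>r>0. norm (F r) \<le> sqrt (1 / (sphere_area TYPE(real^'n) * (real CARD('n) - 2 + b))) * r powr (- (real CARD('n) - 2 + b) / 2) * grad_norm b u)"

lemma radial_Wb_profile:
  fixes u :: "real^'n \<Rightarrow> complex"
  assumes u: "in_Wb b u" "radial u" and dim: "2 - real CARD('n) < b"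
  shows "\<exists>F. is_profile b u F"
proof -
  interpret radial_weak_grad u "wgrad b u" b
    using u wgrad_props[OF u(1)] dim by unfold_locales (auto simp: in_Wb_def)
  show ?thesis
    unfolding is_profile_def grad_norm_def
    by (intro exI[of _ profile] conjI allI impI continuous_profile u_eq_profile profile_strauss profile_bound)
qed

definition pot :: "real \<Rightarrow> real \<Rightarrow> (real^'n \<Rightarrow> complex) \<Rightarrow> real" where
  "pot c p u = (\<integral>x. norm x powr c * cmod (u x) powr (p + 2) \<partial>lborel)"

lemma mass_zero_AE:
  assumes "wint 0 2 u" "wnorm 0 2 u = 0"
  shows "AE x in lborel. u x = 0"
proof -
  have "(\<integral>x. (norm (u x))\<^sup>2 \<partial>lborel) = 0" using assms(2) wnorm0_sq[of u] by simp
  then have "AE x in lborel. (norm (u x))\<^sup>2 = 0"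
    using assms(1) by (subst (asm) integral_nonneg_eq_0_iff_AE) (auto simp: wint0_sq)
  then show ?thesis by simp
qed

lemma wnorm0_eq_0I:
  assumes "AE x in lborel. u x = 0"
  shows "wnorm 0 2 u = 0"
proof -
  have "(\<integral>x. (norm (u x))\<^sup>2 \<partial>lborel) = 0"
    using assms by (intro integral_eq_zero_AE) (auto elim: eventually_mono)
  then show ?thesis using wnorm0_sq[of u] by simp
qed

text \<open>With vanishing gradient norm the Strauss bound forces the profile to be 0. Positivity is
  what permits division by G later on.\<close>

lemma grad_norm_pos:
  fixes u :: "real^'n \<Rightarrow> complex"
  assumes "in_Wb b u" "radial u" "2 - real CARD('n) < b" "wnorm 0 2 u > 0"
  shows "grad_norm b u > 0"
proof (rule ccontr)
  assume "\<not> grad_norm b u > 0"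
  then have G: "grad_norm b u = 0" using grad_norm_nonneg[of b u] by simp
  obtain F where "is_profile b u F" using radial_Wb_profile[OF assms(1-3)] by blast
  then have F: "AE x in lborel. u x = F (norm x)"
    "\<And>r. r > 0 \<Longrightarrow> (norm (F r))\<^sup>2 \<le> 4 / sphere_area TYPE(real^'n) * r powr (1 - real CARD('n) - b / 2) * wnorm 0 2 u * grad_norm b u"
    by (simp_all only: is_profile_def)
  have "AE x in lborel. u x = 0"
    using F(1) AE_lborel_singleton[of 0]
  proof eventually_elim
    case (elim x)
    then show ?case using F(2)[of "norm x"] G by simp
  qed
  then show False using wnorm0_eq_0I[of u] assms(4) by simp
qed

text \<open>|x|^c |u|^p is the weight multiplying |u|^2 in the potential energy. The dimension
  cancels in c + (1 - n - b/2) p/2 and leaves -(2 - b)(1 - p/4), which is negative when p < 4, that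
  is, when c < b - 2 + 2n.\<close>

lemma is_profile_decay:
  fixes u :: "real^'n \<Rightarrow> complex"
  assumes prof: "is_profile b u F" and p: "0 < p" and c: "c = real CARD('n) * p / 2 - 2 + b" and r0: "r > 0"
  shows "r powr c * norm (F r) powr p
    \<le> (4 / sphere_area TYPE(real^'n)) powr (p / 2) * r powr (- ((2 - b) * (1 - p / 4))) * (wnorm 0 2 u * grad_norm b u) powr (p / 2)"
proof -
  let ?w = "sphere_area TYPE(real^'n)" and ?M = "wnorm 0 2 u" and ?G = "grad_norm b u"
  have w: "?w > 0" by (rule sphere_area_pos)
  have F: "(norm (F r))\<^sup>2 \<le> 4 / ?w * r powr (1 - real CARD('n) - b / 2) * ?M * ?G"
    using prof r0 by (simp only: is_profile_def)
  have "norm (F r) powr p = ((norm (F r))\<^sup>2) powr (p / 2)"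
    by (cases "F r = 0") (auto simp: powr_powr simp flip: powr_numeral)
  also have "\<dots> \<le> (4 / ?w * r powr (1 - real CARD('n) - b / 2) * ?M * ?G) powr (p / 2)"
    using p by (intro powr_mono2 F) auto
  also have "\<dots> = ((4 / ?w) * (r powr (1 - real CARD('n) - b / 2) * (?M * ?G))) powr (p / 2)"
    by (simp add: mult.assoc)
  also have "\<dots> = (4 / ?w) powr (p / 2) * (r powr ((1 - real CARD('n) - b / 2) * (p / 2)) * (?M * ?G) powr (p / 2))"
    using w by (simp only: powr_mult powr_powr)
  finally have "r powr c * norm (F r) powr p \<le> r powr c * ((4 / ?w) powr (p / 2) * (r powr ((1 - real CARD('n) - b / 2) * (p / 2)) * (?M * ?G) powr (p / 2)))"
    by (intro mult_left_mono) auto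
  also have "\<dots> = (4 / ?w) powr (p / 2) * (r powr c * r powr ((1 - real CARD('n) - b / 2) * (p / 2))) * (?M * ?G) powr (p / 2)"
    by (simp add: ac_simps)
  also have "r powr c * r powr ((1 - real CARD('n) - b / 2) * (p / 2)) = r powr (- ((2 - b) * (1 - p / 4)))"
    unfolding powr_add[symmetric] c by (rule arg_cong[where f = "\<lambda>e. r powr e"]) (simp add: field_simps)
  finally show ?thesis .
qed

text \<open>A factor |u|^2 is kept for the mass; the remaining weight decays and is bounded by its
  bound at radius \<open>R\<close>.\<close>

lemma radial_Wb_outer:
  fixes u :: "real^'n \<Rightarrow> complex"
  assumes u: "in_Wb b u" "radial u" and dim: "2 - real CARD('n) < b" and b: "b \<le> 0"
    and p: "0 < p" "p < 4" and c: "c = real CARD('n) * p / 2 - 2 + b" and R: "R > 0"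
  shows "(\<integral>\<^sup>+x. ennreal (norm x powr c * cmod (u x) powr (p + 2)) * indicator {R..} (norm x) \<partial>lborel)
     \<le> ennreal ((4 / sphere_area TYPE(real^'n)) powr (p / 2) * R powr (- ((2 - b) * (1 - p / 4))) * (wnorm 0 2 u * grad_norm b u) powr (p / 2) * (wnorm 0 2 u)\<^sup>2)"
proof -
  let ?w = "sphere_area TYPE(real^'n)" and ?M = "wnorm 0 2 u" and ?G = "grad_norm b u"
  let ?K = "(4 / ?w) powr (p / 2) * R powr (- ((2 - b) * (1 - p / 4))) * (?M * ?G) powr (p / 2)"
  have w: "?w > 0" by (rule sphere_area_pos)
  have [measurable]: "u \<in> borel_measurable borel" using u(1) by (simp add: in_Wb_def wint_def)
  have iu: "integrable lborel (\<lambda>x. (norm (u x))\<^sup>2)" using u(1) by (simp add: in_Wb_def wint0_sq)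
  obtain F where prof: "is_profile b u F" using radial_Wb_profile[OF u dim] by blast
  then have F: "AE x in lborel. u x = F (norm x)" by (simp only: is_profile_def)
  have pt: "r powr c * norm (F r) powr p \<le> ?K" if r: "r \<ge> R" for r
  proof -
    have "r powr c * norm (F r) powr p \<le> (4 / ?w) powr (p / 2) * r powr (- ((2 - b) * (1 - p / 4))) * (?M * ?G) powr (p / 2)"
      using r R p by (intro is_profile_decay[OF prof _ c]) auto
    also have "\<dots> \<le> ?K"
      using r R b p by (intro mult_right_mono mult_left_mono powr_mono2') (auto simp: mult_le_0_iff)
    finally show ?thesis .
  qed
  have "(\<integral>\<^sup>+x. ennreal (norm x powr c * cmod (u x) powr (p + 2)) * indicator {R..} (norm x) \<partial>lborel)
    \<le> (\<integral>\<^sup>+x. ennreal ?K * ennreal ((norm (u x))\<^sup>2) \<partial>lborel)"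
  proof (rule nn_integral_mono_AE)
    show "AE x in lborel. ennreal (norm x powr c * cmod (u x) powr (p + 2)) * indicator {R..} (norm x) \<le> ennreal ?K * ennreal ((norm (u x))\<^sup>2)"
      using F
    proof eventually_elim
      case (elim x)
      show ?case
      proof (cases "norm x \<ge> R")
        case True
        have "norm x powr c * cmod (u x) powr (p + 2) = (norm x powr c * norm (F (norm x)) powr p) * (norm (u x))\<^sup>2"
          by (cases "u x = 0") (auto simp: powr_add elim)
        also have "\<dots> \<le> ?K * (norm (u x))\<^sup>2"
          by (intro mult_right_mono pt True) auto
        finally show ?thesis using True by (simp add: ennreal_mult[symmetric] ennreal_leI)
      qed simp
    qed
  qed
  also have "\<dots> = ennreal ?K * ennreal (?M\<^sup>2)"
    by (subst nn_integral_cmult) (auto simp: nn_integral_eq_integral[OF iu] wnorm0_sq)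
  also have "\<dots> = ennreal (?K * ?M\<^sup>2)" by (simp add: ennreal_mult)
  finally show ?thesis .
qed

text \<open>All p + 2 powers of |u| are estimated by the gradient norm alone. The resulting power of
  |x| exceeds -n by p (2 - b) / 2, so it is integrable at the origin.\<close>

lemma radial_Wb_inner:
  fixes u :: "real^'n \<Rightarrow> complex"
  assumes u: "in_Wb b u" "radial u" and dim: "2 - real CARD('n) < b" and b: "b \<le> 0"
    and p: "0 < p" and c: "c = real CARD('n) * p / 2 - 2 + b" and R: "R > 0"
  shows "(\<integral>\<^sup>+x. ennreal (norm x powr c * cmod (u x) powr (p + 2)) * indicator {..R} (norm x) \<partial>lborel)
     \<le> ennreal ((sqrt (1 / (sphere_area TYPE(real^'n) * (real CARD('n) - 2 + b)))) powr (p + 2) * (sphere_area TYPE(real^'n) / (p * (2 - b) / 2))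
          * (R powr (p * (2 - b) / 2) * grad_norm b u powr (p + 2)))"
proof -
  let ?w = "sphere_area TYPE(real^'n)" and ?G = "grad_norm b u"
  let ?k = "sqrt (1 / (?w * (real CARD('n) - 2 + b)))"
  let ?s = "c - (real CARD('n) - 2 + b) / 2 * (p + 2)"
  have w: "?w > 0" by (rule sphere_area_pos)
  have k: "?k \<ge> 0" using w dim by simp
  have s: "?s + real DIM(real^'n) = p * (2 - b) / 2" unfolding c by (simp add: field_simps)
  have sp: "p * (2 - b) / 2 > 0" using p b by simp
  obtain F where "is_profile b u F" using radial_Wb_profile[OF u dim] by blast
  then have F: "AE x in lborel. u x = F (norm x)"
    "\<And>r. r > 0 \<Longrightarrow> norm (F r) \<le> ?k * r powr (- (real CARD('n) - 2 + b) / 2) * ?G"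
    by (simp_all only: is_profile_def)
  have pt: "r powr c * norm (F r) powr (p + 2) \<le> ?k powr (p + 2) * ?G powr (p + 2) * r powr ?s" if r0: "r > 0" for r
  proof -
    have "norm (F r) powr (p + 2) \<le> (?k * r powr (- (real CARD('n) - 2 + b) / 2) * ?G) powr (p + 2)"
      using p by (intro powr_mono2 F(2) r0) auto
    also have "\<dots> = ?k powr (p + 2) * r powr (- (real CARD('n) - 2 + b) / 2 * (p + 2)) * ?G powr (p + 2)"
      using k by (simp add: powr_mult powr_powr grad_norm_nonneg del: real_sqrt_ge_0_iff)
    finally have "r powr c * norm (F r) powr (p + 2) \<le> r powr c * (?k powr (p + 2) * r powr (- (real CARD('n) - 2 + b) / 2 * (p + 2)) * ?G powr (p + 2))"
      by (intro mult_left_mono) auto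
    also have "\<dots> = ?k powr (p + 2) * ?G powr (p + 2) * (r powr c * r powr (- (real CARD('n) - 2 + b) / 2 * (p + 2)))"
      by (simp only: ac_simps)
    also have "r powr c * r powr (- (real CARD('n) - 2 + b) / 2 * (p + 2)) = r powr ?s"
      unfolding powr_add[symmetric] by (rule arg_cong[where f = "\<lambda>e. r powr e"]) (simp add: field_simps)
    finally show ?thesis .
  qed
  have "(\<integral>\<^sup>+x. ennreal (norm x powr c * cmod (u x) powr (p + 2)) * indicator {..R} (norm x) \<partial>lborel)
    \<le> (\<integral>\<^sup>+x. ennreal (?k powr (p + 2) * ?G powr (p + 2)) * (ennreal (norm (x::real^'n) powr ?s) * indicator {..R} (norm x)) \<partial>lborel)"
  proof (rule nn_integral_mono_AE)
    show "AE x in lborel. ennreal (norm x powr c * cmod (u x) powr (p + 2)) * indicator {..R} (norm x)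
      \<le> ennreal (?k powr (p + 2) * ?G powr (p + 2)) * (ennreal (norm x powr ?s) * indicator {..R} (norm x))"
      using F(1) AE_lborel_singleton[of 0]
    proof eventually_elim
      case (elim x)
      show ?case
      proof (cases "norm x \<le> R")
        case True
        then show ?thesis using pt[of "norm x"] elim by (simp add: ennreal_mult[symmetric] ennreal_leI)
      qed simp
    qed
  qed
  also have "\<dots> = ennreal (?k powr (p + 2) * ?G powr (p + 2)) * (\<integral>\<^sup>+x. (ennreal (norm (x::real^'n) powr ?s) * indicator {..R} (norm x)) \<partial>lborel)"
    by (rule nn_integral_cmult) measurable
  also have "(\<integral>\<^sup>+x. (ennreal (norm (x::real^'n) powr ?s) * indicator {..R} (norm x)) \<partial>lborel)
     = ennreal (?w / (?s + real DIM(real^'n)) * R powr (?s + real DIM(real^'n)))"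
    using R s sp by (intro nn_integral_norm_powr_inside) auto
  also have "\<dots> = ennreal (?w / (p * (2 - b) / 2) * R powr (p * (2 - b) / 2))" unfolding s ..
  also have "ennreal (?k powr (p + 2) * ?G powr (p + 2)) * \<dots> = ennreal ((?k powr (p + 2) * ?G powr (p + 2)) * (?w / (p * (2 - b) / 2) * R powr (p * (2 - b) / 2)))"
    using w sp by (intro ennreal_mult[symmetric]) auto
  also have "(?k powr (p + 2) * ?G powr (p + 2)) * (?w / (p * (2 - b) / 2) * R powr (p * (2 - b) / 2))
     = ?k powr (p + 2) * (?w / (p * (2 - b) / 2)) * (R powr (p * (2 - b) / 2) * ?G powr (p + 2))"
    by (simp only: ac_simps)
  finally show ?thesis .
qed

text \<open>The integral is split at a radius, with the gradient bound inside and the Strauss bound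
  outside. The constant is not sharp; its role is to make the supremum in \<open>C_GN\<close> finite
  and to serve where no ground state is at hand.\<close>

lemma radial_GN:
  assumes dim: "2 - real CARD('n) < b" and b: "b \<le> 0"
    and p: "0 < p" "p < 4" and c: "c = real CARD('n) * p / 2 - 2 + b"
  shows "\<exists>K>0. \<forall>u :: real^'n \<Rightarrow> complex. in_Wb b u \<longrightarrow> radial u \<longrightarrow>
    integrable lborel (\<lambda>x. norm x powr c * cmod (u x) powr (p + 2)) \<and>
    pot c p u \<le> K * (grad_norm b u)\<^sup>2 * wnorm 0 2 u powr p"
proof -
  let ?w = "sphere_area TYPE(real^'n)"
  define K1 where "K1 = (sqrt (1 / (?w * (real CARD('n) - 2 + b)))) powr (p + 2) * (?w / (p * (2 - b) / 2))"
  define K2 where "K2 = (4 / ?w) powr (p / 2)"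
  have w: "?w > 0" by (rule sphere_area_pos)
  have K1: "K1 \<ge> 0" unfolding K1_def using w p b by simp
  have K2: "K2 > 0" unfolding K2_def using w by simp
  have *: "integrable lborel (\<lambda>x. norm x powr c * cmod (u x) powr (p + 2)) \<and> pot c p u \<le> (K1 + K2) * (grad_norm b u)\<^sup>2 * wnorm 0 2 u powr p"
    if u: "in_Wb b u" "radial u" for u :: "real^'n \<Rightarrow> complex"
  proof (cases "wnorm 0 2 u = 0")
    case True
    have ae: "AE x in lborel. norm x powr c * cmod (u x) powr (p + 2) = 0"
      using mass_zero_AE[OF _ True] u(1) by (auto simp: in_Wb_def elim: eventually_mono)
    have [measurable]: "u \<in> borel_measurable borel" using u(1) by (simp add: in_Wb_def wint_def)
    have "integrable lborel (\<lambda>x. norm x powr c * cmod (u x) powr (p + 2))"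
      by (subst integrable_cong_AE[where g = "\<lambda>_. 0"]) (use ae in auto)
    moreover have "pot c p u = 0" unfolding pot_def by (rule integral_eq_zero_AE[OF ae])
    ultimately show ?thesis using True K1 K2 by simp
  next
    case False
    let ?M = "wnorm 0 2 u" and ?G = "grad_norm b u"
    have M: "?M > 0" using False wnorm_nonneg[of 0 2 u] by simp
    have G: "?G > 0" by (rule grad_norm_pos[OF u dim M])
    have [measurable]: "u \<in> borel_measurable borel" using u(1) by (simp add: in_Wb_def wint_def)
    \<comment> \<open>The length scale that M and G determine; at this radius both contributions
      become multiples of G^2 M^p.\<close>
    define R where "R = (?M / ?G) powr (2 / (2 - b))"
    have R: "R > 0" unfolding R_def using M G by simp
    have e1: "R powr (p * (2 - b) / 2) * ?G powr (p + 2) = ?G\<^sup>2 * ?M powr p"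
    proof -
      have "R powr (p * (2 - b) / 2) = (?M / ?G) powr p" unfolding R_def powr_powr using b by simp
      then show ?thesis using M G by (simp add: powr_divide powr_add)
    qed
    have e2: "R powr (- ((2 - b) * (1 - p / 4))) * (?M * ?G) powr (p / 2) * ?M\<^sup>2 = ?G\<^sup>2 * ?M powr p"
    proof -
      have "R powr (- ((2 - b) * (1 - p / 4))) = (?M / ?G) powr (p / 2 - 2)"
      proof -
        have "2 / d * (- (d * q)) = - 2 * q" if "d \<noteq> 0" for d q :: real using that by simp
        from this[of "2 - b" "1 - p / 4"] have "2 / (2 - b) * (- ((2 - b) * (1 - p / 4))) = p / 2 - 2" using b by simp
        then show ?thesis unfolding R_def powr_powr by (simp only:)
      qed
      also have "\<dots> = ?M powr (p / 2) / ?M\<^sup>2 * (?G\<^sup>2 / ?G powr (p / 2))"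
        using M G by (simp add: powr_divide powr_diff)
      finally have "R powr (- ((2 - b) * (1 - p / 4))) * (?M * ?G) powr (p / 2) * ?M\<^sup>2 = ?G\<^sup>2 * (?M powr (p / 2) * ?M powr (p / 2))"
        using M G by (simp add: powr_mult)
      then show ?thesis by (simp add: powr_add[symmetric])
    qed
    let ?f = "\<lambda>x. norm x powr c * cmod (u x) powr (p + 2)"
    have "(\<integral>\<^sup>+x. ennreal (?f x) \<partial>lborel) \<le> (\<integral>\<^sup>+x. ennreal (?f x) * indicator {..R} (norm x) + ennreal (?f x) * indicator {R..} (norm x) \<partial>lborel)"
      by (intro nn_integral_mono) (auto simp: indicator_def)
    also have "\<dots> = (\<integral>\<^sup>+x. ennreal (?f x) * indicator {..R} (norm x) \<partial>lborel) + (\<integral>\<^sup>+x. ennreal (?f x) * indicator {R..} (norm x) \<partial>lborel)"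
      by (rule nn_integral_add) measurable
    also have "\<dots> \<le> ennreal (K1 * (?G\<^sup>2 * ?M powr p)) + ennreal (K2 * (?G\<^sup>2 * ?M powr p))"
      using radial_Wb_inner[OF u dim b p(1) c R] radial_Wb_outer[OF u dim b p c R]
      by (intro add_mono) (simp_all only: e1 e2[symmetric] K1_def K2_def mult.assoc)
    also have "\<dots> = ennreal ((K1 + K2) * ?G\<^sup>2 * ?M powr p)"
      using K1 K2 by (subst ennreal_plus[symmetric]) (auto simp: algebra_simps)
    finally have bd: "(\<integral>\<^sup>+x. ennreal (?f x) \<partial>lborel) \<le> ennreal ((K1 + K2) * ?G\<^sup>2 * ?M powr p)" .
    have i: "integrable lborel ?f"
      by (rule integrableI_bounded) (use bd in \<open>auto intro: le_less_trans\<close>)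
    have "ennreal (pot c p u) = (\<integral>\<^sup>+x. ennreal (?f x) \<partial>lborel)"
      unfolding pot_def by (rule nn_integral_eq_integral[OF i, symmetric]) auto
    then have "ennreal (pot c p u) \<le> ennreal ((K1 + K2) * ?G\<^sup>2 * ?M powr p)" using bd by (simp only:)
    then have "pot c p u \<le> (K1 + K2) * ?G\<^sup>2 * ?M powr p"
      using K1 K2 by (subst (asm) ennreal_le_iff) auto
    then show ?thesis using i by simp
  qed
  show ?thesis by (rule exI[of _ "K1 + K2"]) (use K1 K2 * in auto)
qed

lemma gn_ratio_mass_critical:
  fixes u :: "real^'n \<Rightarrow> complex"
  assumes "b \<le> 0" and c: "c = real CARD('n) * p / 2 - 2 + b"
  shows "gn_ratio b c p u = pot c p u / ((grad_norm b u)\<^sup>2 * wnorm 0 2 u powr p)"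
proof -
  have pc: "real CARD('n) * p - 2 * c = 2 * (2 - b)" unfolding c by (simp add: algebra_simps)
  have "2 * (2 - b) / (2 - b) = 2" "((2 - b) * (p + 2) - 2 * (2 - b)) / (2 - b) = p"
    using assms(1) by (simp_all add: field_simps)
  then show ?thesis
    unfolding gn_ratio_def Let_def pc pot_def by (simp add: grad_norm_nonneg)
qed

text \<open>A real supremum is an upper bound only of a set that is bounded above, and this is what
  the crude inequality supplies.\<close>

lemma C_GN_bound:
  fixes u :: "real^'n \<Rightarrow> complex"
  assumes dim: "2 - real CARD('n) < b" and b: "b \<le> 0"
    and p: "0 < p" "p < 4" and c: "c = real CARD('n) * p / 2 - 2 + b"
    and u: "in_Wb b u" "radial u"
  shows "pot c p u \<le> C_GN b c p TYPE('n) * (grad_norm b u)\<^sup>2 * wnorm 0 2 u powr p"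
proof -
  obtain K where K: "K > 0" "\<And>u :: real^'n \<Rightarrow> complex. in_Wb b u \<Longrightarrow> radial u \<Longrightarrow> pot c p u \<le> K * (grad_norm b u)\<^sup>2 * wnorm 0 2 u powr p"
    using radial_GN[OF dim b p c] by blast
  show ?thesis
  proof (cases "wnorm 0 2 u > 0")
    \<comment> \<open>The supremum ranges over functions of positive mass; at mass 0 the right-hand
      sides of both inequalities are 0.\<close>
    case False
    then have "wnorm 0 2 u = 0" using wnorm_nonneg[of 0 2 u] by simp
    then show ?thesis using K(2)[OF u] by simp
  next
    case True
    let ?S = "{gn_ratio b c p (u :: real^'n \<Rightarrow> complex) | u. in_Wb b u \<and> radial u \<and> wnorm 0 2 u > 0}"
    have "bdd_above ?S"
    proof (rule bdd_aboveI[of _ K])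
      fix x assume "x \<in> ?S"
      then obtain v :: "real^'n \<Rightarrow> complex" where v: "x = gn_ratio b c p v" "in_Wb b v" "radial v" "wnorm 0 2 v > 0" by auto
      have "(grad_norm b v)\<^sup>2 * wnorm 0 2 v powr p > 0" using grad_norm_pos[OF v(2,3) dim v(4)] v(4) by simp
      then show "x \<le> K"
        using K(2)[OF v(2,3)] unfolding v(1) gn_ratio_mass_critical[OF b c] by (simp add: divide_le_eq mult.assoc)
    qed
    then have le: "gn_ratio b c p u \<le> C_GN b c p TYPE('n)"
      unfolding C_GN_def using u True by (intro cSup_upper) auto
    have "(grad_norm b u)\<^sup>2 * wnorm 0 2 u powr p > 0" using grad_norm_pos[OF u dim True] True by simp
    then show ?thesis using le unfolding gn_ratio_mass_critical[OF b c] by (simp add: divide_le_eq mult.assoc)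
  qed
qed

section \<open>Cutoffs and products of weak gradients\<close>

lemma test_fun_derivative:
  "test_fun \<phi> d \<Longrightarrow> (\<phi> has_derivative (\<lambda>h. \<Sum>j\<in>UNIV. h $ j * d j x)) (at x)"
  by (simp add: test_fun_def)

lemma test_fun_continuous:
  assumes "test_fun \<phi> d"
  shows "continuous_on UNIV \<phi>" "continuous_on UNIV (d j)"
  using assms unfolding test_fun_def
  by (auto intro: continuous_at_imp_continuous_on has_derivative_continuous)

lemma test_fun_measurable:
  assumes "test_fun \<phi> d"
  shows "\<phi> \<in> borel_measurable borel" "d j \<in> borel_measurable borel"
  using test_fun_continuous[OF assms] by (auto intro: borel_measurable_continuous_onI)

lemma test_fun_mult:
  fixes \<phi> \<eta> :: "real^'n \<Rightarrow> real"
  assumes "test_fun \<phi> d" "test_fun \<eta> e"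
  shows "test_fun (\<lambda>x. \<phi> x * \<eta> x) (\<lambda>j x. \<phi> x * e j x + d j x * \<eta> x)"
  unfolding test_fun_def
proof (intro conjI allI)
  fix x
  have "((\<lambda>x. \<phi> x * \<eta> x) has_derivative (\<lambda>h. \<phi> x * (\<Sum>j\<in>UNIV. h $ j * e j x) + (\<Sum>j\<in>UNIV. h $ j * d j x) * \<eta> x)) (at x)"
    by (rule has_derivative_mult[OF test_fun_derivative[OF assms(1)] test_fun_derivative[OF assms(2)]])
  moreover have "(\<lambda>h. \<phi> x * (\<Sum>j\<in>UNIV. h $ j * e j x) + (\<Sum>j\<in>UNIV. h $ j * d j x) * \<eta> x)
     = (\<lambda>h. \<Sum>j\<in>UNIV. h $ j * (\<phi> x * e j x + d j x * \<eta> x))"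
    by (simp add: fun_eq_iff sum_distrib_left sum_distrib_right sum.distrib algebra_simps)
  ultimately show "((\<lambda>x. \<phi> x * \<eta> x) has_derivative (\<lambda>h. \<Sum>j\<in>UNIV. h $ j * (\<phi> x * e j x + d j x * \<eta> x))) (at x)"
    by simp
next
  fix j
  show "continuous_on UNIV (\<lambda>x. \<phi> x * e j x + d j x * \<eta> x)"
    using assms[THEN test_fun_continuous(1)] assms[THEN test_fun_continuous(2)] by (intro continuous_intros)
next
  show "\<exists>R. \<forall>x. R < norm x \<longrightarrow> \<phi> x * \<eta> x = 0" using assms(1) unfolding test_fun_def by fastforce
qed

lemma continuous_set_integrable_compact:
  fixes f :: "real^'n \<Rightarrow> 'v::{banach, second_countable_topology}"
  assumes "continuous_on UNIV f" "compact K"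
  shows "set_integrable lborel K f"
  unfolding set_integrable_def
  by (rule borel_integrable_compact[OF assms(2)]) (rule continuous_on_subset[OF assms(1)], simp)

text \<open>Translation invariance: the difference quotients of \<phi> have integral 0, and they
  converge to the partial derivative.\<close>

lemma test_fun_integral_partial:
  fixes \<phi> :: "real^'n \<Rightarrow> real"
  assumes t: "test_fun \<phi> d"
  shows "(\<integral>x. d j x \<partial>lborel) = 0"
proof -
  obtain B R where B: "B \<ge> 0" "R \<ge> 0" "\<And>x. \<bar>\<phi> x\<bar> \<le> B * indicator (cball 0 R) x" "\<And>j x. \<bar>d j x\<bar> \<le> B * indicator (cball 0 R) x"
    by (rule test_fun_bounded[OF t]) blast
  note [measurable] = test_fun_measurable[OF t]
  define e where "e = (axis j 1 :: real^'n)"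
  have ne: "norm e = 1" by (simp add: e_def)
  have "integrable lborel (\<lambda>x. \<phi> x *\<^sub>R (1::real))"
    by (rule integrable_mult_test[OF _ _ test_fun_continuous(1)[OF t] B(3)]) (auto intro: continuous_set_integrable_compact)
  then have i\<phi>: "integrable lborel \<phi>" by simp
  define h where "h k = 1 / real (Suc k)" for k
  have h: "0 < h k" "h k \<le> 1" for k by (auto simp: h_def)
  have der: "((\<lambda>s. \<phi> (x + s *\<^sub>R e)) has_real_derivative d j (x + s *\<^sub>R e)) (at s)" for x s
  proof -
    have "((\<lambda>s. \<phi> (x + s *\<^sub>R e)) has_derivative (\<lambda>t. \<Sum>i\<in>UNIV. (t *\<^sub>R e) $ i * d i (x + s *\<^sub>R e))) (at s)"
      by (rule has_derivative_compose[OF _ test_fun_derivative[OF t], of "\<lambda>s. x + s *\<^sub>R e" "\<lambda>t. t *\<^sub>R e"])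
         (auto intro!: derivative_eq_intros)
    moreover have "(\<lambda>t. \<Sum>i\<in>UNIV. (t *\<^sub>R e) $ i * d i (x + s *\<^sub>R e)) = (*) (d j (x + s *\<^sub>R e))"
    proof
      fix t
      have "(\<Sum>i\<in>UNIV. (t *\<^sub>R e) $ i * d i (x + s *\<^sub>R e)) = (\<Sum>i\<in>UNIV. if i = j then t * d i (x + s *\<^sub>R e) else 0)"
        by (intro sum.cong) (auto simp: e_def axis_def)
      then show "(\<Sum>i\<in>UNIV. (t *\<^sub>R e) $ i * d i (x + s *\<^sub>R e)) = d j (x + s *\<^sub>R e) * t" by (simp add: mult.commute)
    qed
    ultimately show ?thesis by (simp add: has_field_derivative_def)
  qed
  \<comment> \<open>By the mean value theorem the quotients are bounded by \<open>B\<close>; as the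
    steps \<open>h k\<close> are at most 1, they all vanish outside the ball of radius R +
    1.\<close>
  have "(\<lambda>k. \<integral>x. (\<phi> (x + h k *\<^sub>R e) - \<phi> x) / h k \<partial>lborel) \<longlonglongrightarrow> (\<integral>x. d j x \<partial>lborel)"
  proof (rule integral_dominated_convergence[where w = "\<lambda>x. B * indicator (cball 0 (R + 1)) x"])
    show "integrable lborel (\<lambda>x::real^'n. B * indicator (cball 0 (R + 1)) x)"
      using emeasure_bounded_finite[OF bounded_cball, of "0::real^'n" "R + 1"]
      by (intro integrable_mult_right) (simp add: integrable_indicator_iff)
    show "AE x in lborel. (\<lambda>k. (\<phi> (x + h k *\<^sub>R e) - \<phi> x) / h k) \<longlonglongrightarrow> d j x"
    proof (rule AE_I2)
      fix x
      have "((\<lambda>s. (\<phi> (x + s *\<^sub>R e) - \<phi> x) / s) \<longlongrightarrow> d j x) (at 0)"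
        using der[of x 0] by (simp add: DERIV_def)
      moreover have "filterlim h (at 0) sequentially"
      proof -
        have "h \<longlonglongrightarrow> 0" using LIMSEQ_inverse_real_of_nat by (simp add: h_def[abs_def] inverse_eq_divide)
        then show ?thesis unfolding filterlim_at using h(1) by (auto intro!: always_eventually simp: less_imp_neq[symmetric])
      qed
      ultimately show "(\<lambda>k. (\<phi> (x + h k *\<^sub>R e) - \<phi> x) / h k) \<longlonglongrightarrow> d j x"
        by (rule filterlim_compose)
    qed
    show "AE x in lborel. norm ((\<phi> (x + h k *\<^sub>R e) - \<phi> x) / h k) \<le> B * indicator (cball 0 (R + 1)) x" for k
    proof (rule AE_I2)
      fix x
      obtain s where s: "0 < s" "s < h k" "\<phi> (x + h k *\<^sub>R e) - \<phi> (x + 0 *\<^sub>R e) = (h k - 0) * d j (x + s *\<^sub>R e)"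
        using MVT2[of 0 "h k" "\<lambda>s. \<phi> (x + s *\<^sub>R e)" "\<lambda>s. d j (x + s *\<^sub>R e)"] h[of k] der by blast
      then have "(\<phi> (x + h k *\<^sub>R e) - \<phi> x) / h k = d j (x + s *\<^sub>R e)" using h[of k] by simp
      moreover have "\<bar>d j (x + s *\<^sub>R e)\<bar> \<le> B * indicator (cball 0 R) (x + s *\<^sub>R e)" by (rule B)
      moreover have "indicator (cball 0 R) (x + s *\<^sub>R e) \<le> (indicator (cball 0 (R + 1)) x :: real)"
      proof -
        have "norm x \<le> norm (x + s *\<^sub>R e) + norm (s *\<^sub>R e)" using norm_triangle_ineq4[of "x + s *\<^sub>R e" "s *\<^sub>R e"] by simp
        also have "norm (s *\<^sub>R e) \<le> 1" using s h[of k] ne by simp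
        finally show ?thesis by (auto simp: indicator_def)
      qed
      ultimately show "norm ((\<phi> (x + h k *\<^sub>R e) - \<phi> x) / h k) \<le> B * indicator (cball 0 (R + 1)) x"
        using B(1) mult_left_mono[of _ _ B] by (metis order_trans real_norm_def)
    qed
  qed measurable
  moreover have "(\<integral>x. (\<phi> (x + h k *\<^sub>R e) - \<phi> x) / h k \<partial>lborel) = 0" for k
  proof -
    have eq: "integrable lborel (\<lambda>x. \<phi> (x + h k *\<^sub>R e))" "(\<integral>x. \<phi> (x + h k *\<^sub>R e) \<partial>lborel) = (\<integral>x. \<phi> x \<partial>lborel)"
    proof -
      have l: "lborel = distr lborel borel ((+) (h k *\<^sub>R e))" by (rule lborel_distr_plus[symmetric])
      have "integrable (distr lborel borel ((+) (h k *\<^sub>R e))) \<phi>" using i\<phi> l by simp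
      then show "integrable lborel (\<lambda>x. \<phi> (x + h k *\<^sub>R e))"
        by (subst (asm) integrable_distr_eq) (auto simp: add.commute)
      have "(\<integral>x. \<phi> x \<partial>lborel) = (\<integral>x. \<phi> x \<partial>distr lborel borel ((+) (h k *\<^sub>R e)))" using l by simp
      also have "\<dots> = (\<integral>x. \<phi> (x + h k *\<^sub>R e) \<partial>lborel)" by (subst integral_distr) (auto simp: add.commute)
      finally show "(\<integral>x. \<phi> (x + h k *\<^sub>R e) \<partial>lborel) = (\<integral>x. \<phi> x \<partial>lborel)" ..
    qed
    then show ?thesis using i\<phi> by simp
  qed
  ultimately have "(\<lambda>k::nat. 0) \<longlonglongrightarrow> (\<integral>x. d j x \<partial>lborel)" by (simp only:)
  then show ?thesis by (simp add: LIMSEQ_const_iff)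
qed

text \<open>Integration by parts, since the partials of a product of two test functions integrate to
  0. Test functions are real; the constant \<open>z\<close> opens all complex directions for
  variations.\<close>

lemma weak_grad_test_fun:
  fixes \<eta> :: "real^'n \<Rightarrow> real"
  assumes t: "test_fun \<eta> e"
  shows "weak_grad (\<lambda>x. \<eta> x *\<^sub>R z) (\<lambda>x. \<chi> j. e j x *\<^sub>R z)"
  unfolding weak_grad_def
proof (intro conjI allI impI)
  fix K :: "(real^'n) set" assume K: "compact K"
  show "set_integrable lborel K (\<lambda>x. \<eta> x *\<^sub>R z)"
    using test_fun_continuous[OF t] by (intro continuous_set_integrable_compact K continuous_intros)
  show "set_integrable lborel K (\<lambda>x. (\<chi> j. e j x *\<^sub>R z) $ j)" for j
    using test_fun_continuous[OF t] by (simp, intro continuous_set_integrable_compact K continuous_intros) auto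
next
  fix \<phi> :: "real^'n \<Rightarrow> real" and d j assume t2: "test_fun \<phi> d"
  have loc: "set_integrable lborel K (\<lambda>x. \<eta> x)" "set_integrable lborel K (\<lambda>x. e j x)" if "compact K" for K
    using test_fun_continuous[OF t] that by (auto intro: continuous_set_integrable_compact)
  have i1: "integrable lborel (\<lambda>x. \<phi> x * e j x)"
    using test_fun_integrable(1)[OF t2 loc(2) test_fun_measurable(2)[OF t]] by simp
  have i2: "integrable lborel (\<lambda>x. d j x * \<eta> x)"
    using test_fun_integrable(2)[OF t2 loc(1) test_fun_measurable(1)[OF t]] by simp
  have "(\<integral>x. \<phi> x * e j x \<partial>lborel) + (\<integral>x. d j x * \<eta> x \<partial>lborel) = 0"
    using test_fun_integral_partial[OF test_fun_mult[OF t2 t], of j] i1 i2 by simp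
  then have "(\<integral>x. d j x * \<eta> x \<partial>lborel) *\<^sub>R z = - ((\<integral>x. \<phi> x * e j x \<partial>lborel) *\<^sub>R z)"
    by (simp add: eq_neg_iff_add_eq_0 add.commute flip: scaleR_add_left)
  then show "(\<integral>x. d j x *\<^sub>R \<eta> x *\<^sub>R z \<partial>lborel) = - (\<integral>x. \<phi> x *\<^sub>R (\<chi> j. e j x *\<^sub>R z) $ j \<partial>lborel)"
    using i1 i2 by simp
qed

lemma weak_grad_add:
  assumes u: "weak_grad u g" "u \<in> borel_measurable borel" "g \<in> borel_measurable borel"
    and v: "weak_grad v h" "v \<in> borel_measurable borel" "h \<in> borel_measurable borel"
  shows "weak_grad (\<lambda>x. u x + v x) (\<lambda>x. g x + h x)"
proof -
  note [measurable] = u(2,3) v(2,3)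
  note u' = u(1)[unfolded weak_grad_def] and v' = v(1)[unfolded weak_grad_def]
  show ?thesis
    unfolding weak_grad_def
  proof (intro conjI allI impI)
    fix K :: "(real^'a) set" assume "compact K"
    then show "set_integrable lborel K (\<lambda>x. u x + v x)" "\<And>j. set_integrable lborel K (\<lambda>x. (g x + h x) $ j)"
      using u' v' by (auto intro!: set_integral_add(1))
  next
    fix \<phi> :: "real^'a \<Rightarrow> real" and d j assume t: "test_fun \<phi> d"
    have i: "integrable lborel (\<lambda>x. d j x *\<^sub>R u x)" "integrable lborel (\<lambda>x. d j x *\<^sub>R v x)"
      "integrable lborel (\<lambda>x. \<phi> x *\<^sub>R g x $ j)" "integrable lborel (\<lambda>x. \<phi> x *\<^sub>R h x $ j)"
      using u' v' by (auto intro!: test_fun_integrable[OF t])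
    have "(\<integral>x. d j x *\<^sub>R u x \<partial>lborel) = - (\<integral>x. \<phi> x *\<^sub>R g x $ j \<partial>lborel)"
      "(\<integral>x. d j x *\<^sub>R v x \<partial>lborel) = - (\<integral>x. \<phi> x *\<^sub>R h x $ j \<partial>lborel)"
      using u' v' t by auto
    then show "(\<integral>x. d j x *\<^sub>R (u x + v x) \<partial>lborel) = - (\<integral>x. \<phi> x *\<^sub>R (g x + h x) $ j \<partial>lborel)"
      using i by (simp add: scaleR_add_right)
  qed
qed

text \<open>The weak gradient of \<open>u\<close> is tested with the product of \<phi> and \<eta>,
  itself a test function, and the product rule separates the term with the derivative of
  \<eta>.\<close>

lemma weak_grad_mult:
  fixes \<eta> :: "real^'n \<Rightarrow> real"
  assumes t: "test_fun \<eta> e" and u: "weak_grad u g" "u \<in> borel_measurable borel" "g \<in> borel_measurable borel"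
  shows "weak_grad (\<lambda>x. \<eta> x *\<^sub>R u x) (\<lambda>x. \<eta> x *\<^sub>R g x + (\<chi> j. e j x *\<^sub>R u x))"
proof -
  note [measurable] = u(2,3) test_fun_measurable[OF t]
  note u' = u(1)[unfolded weak_grad_def]
  have i: "integrable lborel (\<lambda>x. \<eta> x *\<^sub>R u x)" "\<And>j. integrable lborel (\<lambda>x. \<eta> x *\<^sub>R g x $ j)" "\<And>j. integrable lborel (\<lambda>x. e j x *\<^sub>R u x)"
    using u' by (auto intro!: test_fun_integrable[OF t])
  have loc: "set_integrable lborel K f" if f: "integrable lborel f" and K: "compact K" for K and f :: "real^'n \<Rightarrow> complex"
    unfolding set_integrable_def using borel_compact[OF K] by (intro integrable_mult_indicator f) auto
  show ?thesis
    unfolding weak_grad_def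
  proof (intro conjI allI impI)
    fix K :: "(real^'n) set" assume K: "compact K"
    show "set_integrable lborel K (\<lambda>x. \<eta> x *\<^sub>R u x)" by (rule loc[OF i(1) K])
    show "set_integrable lborel K (\<lambda>x. (\<eta> x *\<^sub>R g x + (\<chi> j. e j x *\<^sub>R u x)) $ j)" for j
      using i by (intro loc[OF _ K]) simp
  next
    fix \<phi> :: "real^'n \<Rightarrow> real" and d j assume t2: "test_fun \<phi> d"
    note [measurable] = test_fun_measurable[OF t2]
    have loc1: "\<And>K. compact K \<Longrightarrow> set_integrable lborel K (\<lambda>x. e j x *\<^sub>R u x)" "\<And>K. compact K \<Longrightarrow> set_integrable lborel K (\<lambda>x. \<eta> x *\<^sub>R u x)"
      "\<And>K. compact K \<Longrightarrow> set_integrable lborel K (\<lambda>x. \<eta> x *\<^sub>R g x $ j)"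
      using loc i by auto
    have i1: "integrable lborel (\<lambda>x. \<phi> x *\<^sub>R e j x *\<^sub>R u x)" by (rule test_fun_integrable(1)[OF t2 loc1(1)]) auto
    have i2: "integrable lborel (\<lambda>x. d j x *\<^sub>R \<eta> x *\<^sub>R u x)" by (rule test_fun_integrable(2)[OF t2 loc1(2)]) auto
    have i3: "integrable lborel (\<lambda>x. \<phi> x *\<^sub>R \<eta> x *\<^sub>R g x $ j)" by (rule test_fun_integrable(1)[OF t2 loc1(3)]) auto
    have "(\<integral>x. (\<phi> x * e j x + d j x * \<eta> x) *\<^sub>R u x \<partial>lborel) = - (\<integral>x. (\<phi> x * \<eta> x) *\<^sub>R g x $ j \<partial>lborel)"
      using u' test_fun_mult[OF t2 t] by blast
    then have "(\<integral>x. \<phi> x *\<^sub>R e j x *\<^sub>R u x \<partial>lborel) + (\<integral>x. d j x *\<^sub>R \<eta> x *\<^sub>R u x \<partial>lborel) = - (\<integral>x. \<phi> x *\<^sub>R \<eta> x *\<^sub>R g x $ j \<partial>lborel)"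
      using Bochner_Integration.integral_add[OF i1 i2] by (simp add: scaleR_add_left)
    then show "(\<integral>x. d j x *\<^sub>R \<eta> x *\<^sub>R u x \<partial>lborel) = - (\<integral>x. \<phi> x *\<^sub>R (\<eta> x *\<^sub>R g x + (\<chi> j. e j x *\<^sub>R u x)) $ j \<partial>lborel)"
    proof -
      assume a: "(\<integral>x. \<phi> x *\<^sub>R e j x *\<^sub>R u x \<partial>lborel) + (\<integral>x. d j x *\<^sub>R \<eta> x *\<^sub>R u x \<partial>lborel) = - (\<integral>x. \<phi> x *\<^sub>R \<eta> x *\<^sub>R g x $ j \<partial>lborel)"
      have "(\<integral>x. \<phi> x *\<^sub>R (\<eta> x *\<^sub>R g x + (\<chi> j. e j x *\<^sub>R u x)) $ j \<partial>lborel)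
        = (\<integral>x. \<phi> x *\<^sub>R \<eta> x *\<^sub>R g x $ j \<partial>lborel) + (\<integral>x. \<phi> x *\<^sub>R e j x *\<^sub>R u x \<partial>lborel)"
        unfolding Bochner_Integration.integral_add[OF i3 i1, symmetric]
        by (simp only: vector_add_component vector_scaleR_component vec_lambda_beta scaleR_add_right)
      moreover have "B = - (C + A)" if "A + B = - C" for A B C :: complex
        using that by (simp add: algebra_simps eq_neg_iff_add_eq_0)
      ultimately show ?thesis using a by (simp only:)
    qed
  qed
qed

section \<open>Radial cutoff functions\<close>

lemma smooth_step:
  obtains \<Theta> \<Theta>' :: "real \<Rightarrow> real" and B where
    "\<And>s. (\<Theta> has_real_derivative \<Theta>' s) (at s)" "continuous_on UNIV \<Theta>'" "\<And>s. 0 \<le> \<Theta> s" "\<And>s. \<Theta> s \<le> 1"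
    "\<And>s. s \<le> 1/4 \<Longrightarrow> \<Theta> s = 1" "\<And>s. s \<ge> 1 \<Longrightarrow> \<Theta> s = 0" "\<And>s. s < 1/4 \<Longrightarrow> \<Theta>' s = 0" "\<And>s. s > 1 \<Longrightarrow> \<Theta>' s = 0"
    "\<And>s. \<bar>\<Theta>' s\<bar> \<le> B" "B \<ge> 0"
proof -
  \<comment> \<open>The step is p / (p + q) with two squared positive parts that never vanish
    together: it is 1 where q is 0 and 0 where p is 0. The threshold 1/4 will mean half the radius,
    because the argument is |x|^2 / R^2.\<close>
  define p where "p s = (max 0 (1 - s))\<^sup>2" for s :: real
  define q where "q s = (max 0 (s - 1/4))\<^sup>2" for s :: real
  define \<Theta> where "\<Theta> s = p s / (p s + q s)" for s
  define p' where "p' s = - 2 * max 0 (1 - s)" for s :: real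
  define q' where "q' s = 2 * max 0 (s - 1/4)" for s :: real
  define \<Theta>' where "\<Theta>' s = (p' s * (p s + q s) - p s * (p' s + q' s)) / ((p s + q s) * (p s + q s))" for s
  have dp: "(p has_real_derivative p' s) (at s)" for s
    unfolding p_def p'_def by (rule DERIV_cong[OF DERIV_chain2[OF DERIV_pos_part_sq, of "\<lambda>s. 1 - s" "-1"]])
       (auto intro!: derivative_eq_intros)
  have dq: "(q has_real_derivative q' s) (at s)" for s
    unfolding q_def q'_def by (rule DERIV_cong[OF DERIV_chain2[OF DERIV_pos_part_sq, of "\<lambda>s. s - 1/4" "1"]])
       (auto intro!: derivative_eq_intros)
  have pq: "p s \<ge> 0" "q s \<ge> 0" for s by (auto simp: p_def q_def)
  have pos: "p s + q s > 0" for s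
  proof (cases "s < 1")
    case True
    then have "p s > 0" by (simp add: p_def)
    then show ?thesis using pq[of s] by simp
  next
    case False
    then have "q s > 0" by (simp add: q_def)
    then show ?thesis using pq[of s] by simp
  qed
  have ne: "p s + q s \<noteq> 0" for s using pos[of s] by simp
  have c: "continuous_on UNIV \<Theta>'"
    unfolding \<Theta>'_def p'_def q'_def
    by (intro continuous_intros) (auto simp: p_def q_def ne[unfolded p_def q_def] intro!: continuous_intros)
  have z1: "\<Theta>' s = 0" if "s < 1/4" for s
    using that by (simp add: \<Theta>'_def q_def q'_def)
  have z2: "\<Theta>' s = 0" if "s > 1" for s
    using that by (simp add: \<Theta>'_def p_def p'_def)
  have "compact (\<Theta>' ` {1/4..1})" by (intro compact_continuous_image continuous_on_subset[OF c]) auto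
  then obtain B0 where B0: "\<And>s. s \<in> {1/4..1} \<Longrightarrow> \<bar>\<Theta>' s\<bar> \<le> B0"
    using compact_imp_bounded[THEN bounded_iff[THEN iffD1]] by fastforce
  show thesis
  proof (rule that[of \<Theta> \<Theta>' "\<bar>B0\<bar>"])
    show "(\<Theta> has_real_derivative \<Theta>' s) (at s)" for s
      unfolding \<Theta>_def \<Theta>'_def by (rule DERIV_divide) (auto intro!: derivative_intros dp dq simp: ne)
    show "0 \<le> \<Theta> s" "\<Theta> s \<le> 1" for s using pq[of s] pos[of s] by (auto simp: \<Theta>_def)
    show "\<Theta> s = 1" if "s \<le> 1/4" for s using that ne[of s] by (simp add: \<Theta>_def q_def)
    show "\<Theta> s = 0" if "s \<ge> 1" for s using that by (simp add: \<Theta>_def p_def)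
    show "\<bar>\<Theta>' s\<bar> \<le> \<bar>B0\<bar>" for s
      using B0[of s] z1[of s] z2[of s] by (cases "s \<in> {1/4..1}") auto
  qed (use c z1 z2 in auto)
qed

lemma test_fun_radial_sq:
  fixes T T' :: "real \<Rightarrow> real"
  assumes d: "\<And>s. (T has_real_derivative T' s) (at s)" and c: "continuous_on UNIV T'"
    and z: "\<And>s. s > R \<Longrightarrow> T s = 0"
  shows "test_fun (\<lambda>x::real^'n. T ((norm x)\<^sup>2)) (\<lambda>j x. 2 * x $ j * T' ((norm x)\<^sup>2))"
  unfolding test_fun_def
proof (intro conjI allI)
  fix x :: "real^'n"
  have dn: "((\<lambda>x::real^'n. (norm x)\<^sup>2) has_derivative (\<lambda>h. 2 * (x \<bullet> h))) (at x)"
    unfolding power2_norm_eq_inner by (auto intro!: derivative_eq_intros simp: inner_commute)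
  have "((\<lambda>x. T ((norm x)\<^sup>2)) has_derivative (\<lambda>h. 2 * (x \<bullet> h) * T' ((norm x)\<^sup>2))) (at x)"
    using DERIV_compose_FDERIV[OF d dn] by simp
  moreover have "(\<lambda>h. 2 * (x \<bullet> h) * T' ((norm x)\<^sup>2)) = (\<lambda>h. \<Sum>j\<in>UNIV. h $ j * (2 * x $ j * T' ((norm x)\<^sup>2)))"
    by (auto simp: fun_eq_iff inner_vec_def sum_distrib_left sum_distrib_right ac_simps intro!: sum.cong)
  ultimately show "((\<lambda>x. T ((norm x)\<^sup>2)) has_derivative (\<lambda>h. \<Sum>j\<in>UNIV. h $ j * (2 * x $ j * T' ((norm x)\<^sup>2)))) (at x)"
    by simp
next
  fix j
  have "continuous_on UNIV (\<lambda>x::real^'n. T' ((norm x)\<^sup>2))"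
    by (rule continuous_on_compose2[OF c]) (auto intro!: continuous_intros)
  then show "continuous_on UNIV (\<lambda>x::real^'n. 2 * x $ j * T' ((norm x)\<^sup>2))" by (intro continuous_intros)
next
  show "\<exists>R. \<forall>x::real^'n. R < norm x \<longrightarrow> T ((norm x)\<^sup>2) = 0"
  proof (intro exI[of _ "max 1 R"] allI impI)
    fix x :: "real^'n" assume x: "max 1 R < norm x"
    have "norm x \<le> (norm x)\<^sup>2" using x by (simp add: self_le_power)
    then show "T ((norm x)\<^sup>2) = 0" using x z by simp
  qed
qed

text \<open>Rescaling one fixed step gives the gradient bound B / R with the same B for every R;
  this uniformity is needed because the radius will depend on time.\<close>

lemma radial_cutoff:
  "\<exists>B\<ge>0. \<forall>R>0. \<exists>(\<eta> :: real^'n \<Rightarrow> real) d. test_fun \<eta> d \<and> radial \<eta> \<and> (\<forall>x. 0 \<le> \<eta> x \<and> \<eta> x \<le> 1) \<and>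
    (\<forall>x. norm x \<le> R / 2 \<longrightarrow> \<eta> x = 1) \<and> (\<forall>x. norm x \<ge> R \<longrightarrow> \<eta> x = 0) \<and>
    (\<forall>x. (\<Sum>j\<in>UNIV. (d j x)\<^sup>2) \<le> (B / R)\<^sup>2) \<and> (\<forall>x j. norm x < R / 2 \<longrightarrow> d j x = 0)"
proof -
  obtain \<Theta> \<Theta>' :: "real \<Rightarrow> real" and B where T:
    "\<And>s. (\<Theta> has_real_derivative \<Theta>' s) (at s)" "continuous_on UNIV \<Theta>'" "\<And>s. 0 \<le> \<Theta> s" "\<And>s. \<Theta> s \<le> 1"
    "\<And>s. s \<le> 1/4 \<Longrightarrow> \<Theta> s = 1" "\<And>s. s \<ge> 1 \<Longrightarrow> \<Theta> s = 0" "\<And>s. s < 1/4 \<Longrightarrow> \<Theta>' s = 0" "\<And>s. s > 1 \<Longrightarrow> \<Theta>' s = 0"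
    "\<And>s. \<bar>\<Theta>' s\<bar> \<le> B" "B \<ge> 0"
    by (rule smooth_step) blast
  show ?thesis
  proof (intro exI[of _ "2 * B"] conjI allI impI)
    fix R :: real assume R: "R > 0"
    define \<eta> :: "real^'n \<Rightarrow> real" where "\<eta> x = \<Theta> ((norm x)\<^sup>2 / R\<^sup>2)" for x
    define d :: "'n \<Rightarrow> real^'n \<Rightarrow> real" where "d j x = 2 * x $ j * (\<Theta>' ((norm x)\<^sup>2 / R\<^sup>2) / R\<^sup>2)" for j x
    have q1: "(norm x)\<^sup>2 / R\<^sup>2 \<ge> 1" if "norm x \<ge> R" for x :: "real^'n"
      using that R by (simp add: power_mono)
    have q1': "(norm x)\<^sup>2 / R\<^sup>2 > 1" if "norm x > R" for x :: "real^'n"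
      using that R by (simp add: power_strict_mono)
    have q2: "(norm x)\<^sup>2 / R\<^sup>2 \<le> 1/4" if "norm x \<le> R / 2" for x :: "real^'n"
    proof -
      have "(norm x)\<^sup>2 \<le> (R / 2)\<^sup>2" using that by (intro power_mono) auto
      then show ?thesis using R by (simp add: field_simps power2_eq_square)
    qed
    have q3: "(norm x)\<^sup>2 / R\<^sup>2 < 1/4" if "norm x < R / 2" for x :: "real^'n"
    proof -
      have "(norm x)\<^sup>2 < (R / 2)\<^sup>2" using that by (intro power_strict_mono) auto
      then show ?thesis using R by (simp add: field_simps power2_eq_square)
    qed
    have tf: "test_fun \<eta> d"
      unfolding \<eta>_def[abs_def] d_def[abs_def]
    proof (rule test_fun_radial_sq[of "\<lambda>s. \<Theta> (s / R\<^sup>2)" "\<lambda>s. \<Theta>' (s / R\<^sup>2) / R\<^sup>2" "R\<^sup>2"])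
      show "((\<lambda>s. \<Theta> (s / R\<^sup>2)) has_real_derivative \<Theta>' (s / R\<^sup>2) / R\<^sup>2) (at s)" for s
        using DERIV_chain2[OF T(1) DERIV_cdivide[OF DERIV_ident, of "R\<^sup>2"]] by simp
      show "continuous_on UNIV (\<lambda>s. \<Theta>' (s / R\<^sup>2) / R\<^sup>2)"
        using R by (intro continuous_intros continuous_on_compose2[OF T(2)]) auto
      show "\<Theta> (s / R\<^sup>2) = 0" if "s > R\<^sup>2" for s using that R by (intro T(6)) simp
    qed
    have dB: "(\<Sum>j\<in>UNIV. (d j x)\<^sup>2) \<le> (2 * B / R)\<^sup>2" for x
    proof -
      define t where "t = 2 / R\<^sup>2 * \<Theta>' ((norm x)\<^sup>2 / R\<^sup>2)"
      have "d j x = t * x $ j" for j by (simp add: d_def t_def)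
      then have "(\<Sum>j\<in>UNIV. (d j x)\<^sup>2) = t\<^sup>2 * (\<Sum>j\<in>UNIV. x $ j * x $ j)"
        by (simp add: sum_distrib_left power2_eq_square ac_simps)
      also have "(\<Sum>j\<in>UNIV. x $ j * x $ j) = (norm x)\<^sup>2" by (simp add: power2_norm_eq_inner inner_vec_def)
      also have "t\<^sup>2 * (norm x)\<^sup>2 = (\<bar>t\<bar> * norm x)\<^sup>2" by (simp add: power_mult_distrib)
      also have "\<bar>t\<bar> = 2 / R\<^sup>2 * \<bar>\<Theta>' ((norm x)\<^sup>2 / R\<^sup>2)\<bar>" by (simp add: t_def abs_mult)
      also have "(2 / R\<^sup>2 * \<bar>\<Theta>' ((norm x)\<^sup>2 / R\<^sup>2)\<bar> * norm x)\<^sup>2 \<le> (2 * B / R)\<^sup>2"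
      proof (rule power_mono)
        have "2 / R\<^sup>2 * \<bar>\<Theta>' ((norm x)\<^sup>2 / R\<^sup>2)\<bar> * norm x \<le> 2 / R\<^sup>2 * (B * R)"
        proof (cases "norm x > R")
          case True
          then show ?thesis using T(8)[OF q1'[OF True]] T(10) R by simp
        next
          case False
          then have "\<bar>\<Theta>' ((norm x)\<^sup>2 / R\<^sup>2)\<bar> * norm x \<le> B * R"
            using T(9,10) by (intro mult_mono) auto
          then show ?thesis unfolding mult.assoc by (intro mult_left_mono) auto
        qed
        also have "\<dots> = 2 * B / R" using R by (simp add: power2_eq_square)
        finally show "2 / R\<^sup>2 * \<bar>\<Theta>' ((norm x)\<^sup>2 / R\<^sup>2)\<bar> * norm x \<le> 2 * B / R" .
      qed simp
      finally show ?thesis .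
    qed
    show "\<exists>(\<eta> :: real^'n \<Rightarrow> real) d. test_fun \<eta> d \<and> radial \<eta> \<and> (\<forall>x. 0 \<le> \<eta> x \<and> \<eta> x \<le> 1) \<and>
      (\<forall>x. norm x \<le> R / 2 \<longrightarrow> \<eta> x = 1) \<and> (\<forall>x. norm x \<ge> R \<longrightarrow> \<eta> x = 0) \<and>
      (\<forall>x. (\<Sum>j\<in>UNIV. (d j x)\<^sup>2) \<le> (2 * B / R)\<^sup>2) \<and> (\<forall>x j. norm x < R / 2 \<longrightarrow> d j x = 0)"
    proof (intro exI[of _ \<eta>] exI[of _ d] conjI allI impI)
      show "radial \<eta>" by (simp add: radial_def \<eta>_def)
      show "\<eta> x = 1" if "norm x \<le> R / 2" for x unfolding \<eta>_def by (rule T(5)[OF q2[OF that]])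
      show "\<eta> x = 0" if "norm x \<ge> R" for x unfolding \<eta>_def by (rule T(6)[OF q1[OF that]])
      show "d j x = 0" if "norm x < R / 2" for x j unfolding d_def using T(7)[OF q3[OF that]] by simp
    qed (use tf dB T(3,4) in \<open>auto simp: \<eta>_def\<close>)
  qed (use T(10) in auto)
qed

section \<open>Mass concentration\<close>

text \<open>Young's inequality with a free weight: as \<open>e\<close> tends to 0 the factor of the
  main term tends to 1, so no loss occurs in a sharp constant.\<close>

lemma norm_add_sq_le:
  fixes a v :: "'a::real_normed_vector"
  assumes "e > 0"
  shows "(norm (a + v))\<^sup>2 \<le> (1 + e) * (norm a)\<^sup>2 + (1 + 1 / e) * (norm v)\<^sup>2"
proof -
  have "(norm (a + v))\<^sup>2 \<le> (norm a + norm v)\<^sup>2" by (intro power_mono norm_triangle_ineq) auto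
  also have "\<dots> = (norm a)\<^sup>2 + 2 * (norm a * norm v) + (norm v)\<^sup>2" by (simp add: power2_eq_square algebra_simps)
  also have "2 * (norm a * norm v) \<le> e * (norm a)\<^sup>2 + 1 / e * (norm v)\<^sup>2"
  proof -
    have "0 \<le> (e * norm a - norm v)\<^sup>2 / e" using assms by simp
    also have "\<dots> = e * (norm a)\<^sup>2 + 1 / e * (norm v)\<^sup>2 - 2 * (norm a * norm v)"
      using assms by (simp add: power2_eq_square field_simps)
    finally show ?thesis by simp
  qed
  finally show ?thesis by (simp add: algebra_simps)
qed

text \<open>The derivative of the cutoff lives where |x| is at least R / 2, and there |x|^b is at
  most (R / 2)^b since b is not positive; the extra term is thus a multiple of R^(b-2) times the
  mass.\<close>

lemma cutoff_Wb:
  fixes u :: "real^'n \<Rightarrow> complex" and \<eta> :: "real^'n \<Rightarrow> real"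
  assumes u: "in_Wb b u" "radial u" and t: "test_fun \<eta> d" and rad: "radial \<eta>"
    and \<eta>: "\<And>x. 0 \<le> \<eta> x" "\<And>x. \<eta> x \<le> 1"
    and d: "\<And>x. (\<Sum>j\<in>UNIV. (d j x)\<^sup>2) \<le> (B / R)\<^sup>2" "\<And>x j. norm x < R / 2 \<Longrightarrow> d j x = 0"
    and R: "R > 0" and b: "b \<le> 0" and e: "e > 0"
  shows "in_Wb b (\<lambda>x. \<eta> x *\<^sub>R u x)" "radial (\<lambda>x. \<eta> x *\<^sub>R u x)"
    "(grad_norm b (\<lambda>x. \<eta> x *\<^sub>R u x))\<^sup>2 \<le> (1 + e) * (grad_norm b u)\<^sup>2 + (1 + 1 / e) * (B\<^sup>2 * (1 / 2) powr b) * R powr (b - 2) * (wnorm 0 2 u)\<^sup>2"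
proof -
  let ?g = "wgrad b u"
  let ?h = "\<lambda>x. \<eta> x *\<^sub>R ?g x + (\<chi> j. d j x *\<^sub>R u x)"
  let ?K = "B\<^sup>2 * (1 / 2) powr b * R powr (b - 2)"
  have iu: "integrable lborel (\<lambda>x. (norm (u x))\<^sup>2)" and [measurable]: "u \<in> borel_measurable borel"
    using u(1) by (auto simp: in_Wb_def wint0_sq)
  have ig: "integrable lborel (\<lambda>x. norm x powr b * (norm (?g x))\<^sup>2)" and [measurable]: "?g \<in> borel_measurable borel"
    using wgrad_props(2)[OF u(1)] by (auto simp: wint_sq)
  note [measurable] = test_fun_measurable[OF t]
  show "radial (\<lambda>x. \<eta> x *\<^sub>R u x)" using rad u(2) unfolding radial_def by metis
  have wg: "weak_grad (\<lambda>x. \<eta> x *\<^sub>R u x) ?h"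
    by (rule weak_grad_mult[OF t wgrad_props(1)[OF u(1)]]) auto
  have w0: "wint 0 2 (\<lambda>x. \<eta> x *\<^sub>R u x)"
    unfolding wint0_sq
  proof (intro conjI)
    show "integrable lborel (\<lambda>x. (norm (\<eta> x *\<^sub>R u x))\<^sup>2)"
      by (rule Bochner_Integration.integrable_bound[OF iu])
         (use \<eta> in \<open>auto simp: power_mult_distrib power_le_one mult_left_le_one_le\<close>)
  qed measurable
  have mh[measurable]: "?h \<in> borel_measurable borel"
  proof -
    have "(\<lambda>x. (\<chi> j. d j x *\<^sub>R u x)) \<in> borel_measurable borel"
      by (subst borel_measurable_euclidean_space) (auto simp: Basis_vec_def inner_axis)
    then show ?thesis by measurable
  qed
  have nv: "norm x powr b * (norm (\<chi> j. d j x *\<^sub>R u x))\<^sup>2 \<le> ?K * (norm (u x))\<^sup>2" for x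
  proof (cases "norm x < R / 2")
    case True
    then have "(\<chi> j. d j x *\<^sub>R u x) = 0" using d(2) by (simp add: vec_eq_iff)
    then show ?thesis by simp
  next
    case False
    have "(norm (\<chi> j. d j x *\<^sub>R u x))\<^sup>2 = (\<Sum>j\<in>UNIV. (d j x)\<^sup>2) * (norm (u x))\<^sup>2"
      by (simp add: norm_vec_def L2_set_def sum_nonneg power_mult_distrib sum_distrib_right)
    also have "\<dots> \<le> (B / R)\<^sup>2 * (norm (u x))\<^sup>2" by (intro mult_right_mono d) auto
    finally have "norm x powr b * (norm (\<chi> j. d j x *\<^sub>R u x))\<^sup>2 \<le> (R / 2) powr b * ((B / R)\<^sup>2 * (norm (u x))\<^sup>2)"
      using False R b by (intro mult_mono powr_mono2') auto
    also have "\<dots> = ?K * (norm (u x))\<^sup>2"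
      using R by (simp add: powr_divide powr_diff powr_minus power_divide field_simps)
    finally show ?thesis .
  qed
  have pt: "norm x powr b * (norm (?h x))\<^sup>2 \<le> (1 + e) * (norm x powr b * (norm (?g x))\<^sup>2) + (1 + 1 / e) * (?K * (norm (u x))\<^sup>2)" for x
  proof -
    have "norm x powr b * (norm (?h x))\<^sup>2 \<le> norm x powr b * ((1 + e) * (norm (\<eta> x *\<^sub>R ?g x))\<^sup>2 + (1 + 1 / e) * (norm (\<chi> j. d j x *\<^sub>R u x))\<^sup>2)"
      by (intro mult_left_mono norm_add_sq_le e) auto
    also have "\<dots> = (1 + e) * (norm x powr b * (norm (\<eta> x *\<^sub>R ?g x))\<^sup>2) + (1 + 1 / e) * (norm x powr b * (norm (\<chi> j. d j x *\<^sub>R u x))\<^sup>2)"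
      by (simp add: algebra_simps)
    also have "\<dots> \<le> (1 + e) * (norm x powr b * (norm (?g x))\<^sup>2) + (1 + 1 / e) * (?K * (norm (u x))\<^sup>2)"
      using e \<eta>[of x] by (intro add_mono mult_left_mono nv power_mono) (auto simp: mult_left_le_one_le)
    finally show ?thesis .
  qed
  have ib: "integrable lborel (\<lambda>x. (1 + e) * (norm x powr b * (norm (?g x))\<^sup>2) + (1 + 1 / e) * (?K * (norm (u x))\<^sup>2))"
    by (intro Bochner_Integration.integrable_add integrable_mult_right ig iu)
  have ih: "integrable lborel (\<lambda>x. norm x powr b * (norm (?h x))\<^sup>2)"
  proof (rule Bochner_Integration.integrable_bound[OF ib])
    show "AE x in lborel. norm (norm x powr b * (norm (?h x))\<^sup>2) \<le> norm ((1 + e) * (norm x powr b * (norm (?g x))\<^sup>2) + (1 + 1 / e) * (?K * (norm (u x))\<^sup>2))"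
      using pt by (intro AE_I2) (simp add: order.trans[OF _ abs_ge_self])
  qed measurable
  have wh: "wint b 2 ?h" using ih mh by (simp add: wint_sq)
  show "in_Wb b (\<lambda>x. \<eta> x *\<^sub>R u x)" by (rule grad_norm_eqI(1)[OF w0 wg wh])
  have "(grad_norm b (\<lambda>x. \<eta> x *\<^sub>R u x))\<^sup>2 = (\<integral>x. norm x powr b * (norm (?h x))\<^sup>2 \<partial>lborel)"
    by (rule grad_norm_eqI(2)[OF w0 wg wh])
  also have "\<dots> \<le> (\<integral>x. (1 + e) * (norm x powr b * (norm (?g x))\<^sup>2) + (1 + 1 / e) * (?K * (norm (u x))\<^sup>2) \<partial>lborel)"
    by (intro integral_mono ih ib pt)
  also have "\<dots> = (1 + e) * (grad_norm b u)\<^sup>2 + (1 + 1 / e) * (?K * (wnorm 0 2 u)\<^sup>2)"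
    unfolding grad_norm_def wnorm_sq[of b] wnorm0_sq
    by (subst Bochner_Integration.integral_add) (auto intro!: integrable_mult_right ig iu)
  finally show "(grad_norm b (\<lambda>x. \<eta> x *\<^sub>R u x))\<^sup>2 \<le> (1 + e) * (grad_norm b u)\<^sup>2 + (1 + 1 / e) * (B\<^sup>2 * (1 / 2) powr b) * R powr (b - 2) * (wnorm 0 2 u)\<^sup>2"
    by (simp add: mult.assoc)
qed

definition ball_mass :: "(real^'n \<Rightarrow> complex) \<Rightarrow> real \<Rightarrow> real" where
  "ball_mass u R = (\<integral>x. indicator (cball 0 R) x * (cmod (u x))\<^sup>2 \<partial>lborel)"

lemma ball_mass_nonneg: "ball_mass u R \<ge> 0"
  unfolding ball_mass_def by (intro Bochner_Integration.integral_nonneg) auto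

text \<open>The cutoff part obeys the given inequality and the rest is covered by the Strauss decay
  outside radius R / 2. \<open>C\<close> is left open: it will be the optimal constant for the first
  claim and the crude one for the second. \<open>K1\<close> and \<open>K2\<close> depend on none of
  \<open>u\<close>, \<open>R\<close>, \<open>e\<close>.\<close>

lemma localized_GN:
  assumes dim: "2 - real CARD('n) < b" and b: "b \<le> 0"
    and p: "0 < p" "p < 4" and c: "c = real CARD('n) * p / 2 - 2 + b"
    and C: "C \<ge> 0" "\<And>w :: real^'n \<Rightarrow> complex. in_Wb b w \<Longrightarrow> radial w \<Longrightarrow> pot c p w \<le> C * (grad_norm b w)\<^sup>2 * wnorm 0 2 w powr p"
  shows "\<exists>K1 K2. K1 \<ge> 0 \<and> K2 \<ge> 0 \<and> (\<forall>(u :: real^'n \<Rightarrow> complex) R e. in_Wb b u \<longrightarrow> radial u \<longrightarrow> R > 0 \<longrightarrow> e > 0 \<longrightarrow>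
     pot c p u \<le> C * ((1 + e) * (grad_norm b u)\<^sup>2 + (1 + 1 / e) * K1 * R powr (b - 2) * (wnorm 0 2 u)\<^sup>2) * sqrt (ball_mass u R) powr p
       + K2 * (R / 2) powr (- ((2 - b) * (1 - p / 4))) * (wnorm 0 2 u * grad_norm b u) powr (p / 2) * (wnorm 0 2 u)\<^sup>2)"
proof -
  obtain B where B: "B \<ge> 0" "\<And>R. R > 0 \<Longrightarrow> \<exists>(\<eta> :: real^'n \<Rightarrow> real) d. test_fun \<eta> d \<and> radial \<eta> \<and> (\<forall>x. 0 \<le> \<eta> x \<and> \<eta> x \<le> 1) \<and>
    (\<forall>x. norm x \<le> R / 2 \<longrightarrow> \<eta> x = 1) \<and> (\<forall>x. norm x \<ge> R \<longrightarrow> \<eta> x = 0) \<and>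
    (\<forall>x. (\<Sum>j\<in>UNIV. (d j x)\<^sup>2) \<le> (B / R)\<^sup>2) \<and> (\<forall>x j. norm x < R / 2 \<longrightarrow> d j x = 0)"
    using radial_cutoff[where 'n='n] by blast
  obtain K where K: "\<And>w :: real^'n \<Rightarrow> complex. in_Wb b w \<Longrightarrow> radial w \<Longrightarrow> integrable lborel (\<lambda>x. norm x powr c * cmod (w x) powr (p + 2))"
    using radial_GN[OF dim b p c] by blast
  let ?K1 = "B\<^sup>2 * (1 / 2) powr b" and ?K2 = "(4 / sphere_area TYPE(real^'n)) powr (p / 2)"
  show ?thesis
  proof (rule exI[of _ ?K1], rule exI[of _ ?K2], intro conjI allI impI)
    fix u :: "real^'n \<Rightarrow> complex" and R e :: real
    assume u: "in_Wb b u" "radial u" and R: "R > 0" and e: "e > 0"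
    let ?M = "wnorm 0 2 u" and ?G = "grad_norm b u"
    let ?out = "?K2 * (R / 2) powr (- ((2 - b) * (1 - p / 4))) * (?M * ?G) powr (p / 2) * ?M\<^sup>2"
    obtain \<eta> :: "real^'n \<Rightarrow> real" and d where \<eta>: "test_fun \<eta> d" "radial \<eta>" "\<And>x. 0 \<le> \<eta> x" "\<And>x. \<eta> x \<le> 1"
      "\<And>x. norm x \<le> R / 2 \<Longrightarrow> \<eta> x = 1" "\<And>x. norm x \<ge> R \<Longrightarrow> \<eta> x = 0"
      "\<And>x. (\<Sum>j\<in>UNIV. (d j x)\<^sup>2) \<le> (B / R)\<^sup>2" "\<And>x j. norm x < R / 2 \<Longrightarrow> d j x = 0"
      using B(2)[OF R] by blast
    let ?w = "\<lambda>x. \<eta> x *\<^sub>R u x"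
    note cw = cutoff_Wb[OF u \<eta>(1-4,7,8) R b e]
    have iu: "integrable lborel (\<lambda>x. (norm (u x))\<^sup>2)" and [measurable]: "u \<in> borel_measurable borel"
      using u(1) by (auto simp: in_Wb_def wint0_sq)
    note [measurable] = test_fun_measurable[OF \<eta>(1)]
    let ?f = "\<lambda>u x. norm x powr c * cmod (u x) powr (p + 2)"
    have fu: "integrable lborel (?f u)" by (rule K[OF u])
    have fo: "integrable lborel (\<lambda>x. ?f u x * indicator {R/2..} (norm x))"
      by (rule Bochner_Integration.integrable_bound[OF fu]) (auto simp: indicator_def)
    have out: "(\<integral>x. ?f u x * indicator {R/2..} (norm x) \<partial>lborel) \<le> ?out"
    proof -
      have "ennreal (\<integral>x. ?f u x * indicator {R/2..} (norm x) \<partial>lborel) = (\<integral>\<^sup>+x. ennreal (?f u x * indicator {R/2..} (norm x)) \<partial>lborel)"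
        by (rule nn_integral_eq_integral[OF fo, symmetric]) auto
      also have "\<dots> = (\<integral>\<^sup>+x. ennreal (?f u x) * indicator {R/2..} (norm x) \<partial>lborel)"
        by (intro nn_integral_cong) (auto simp: indicator_def)
      also have "\<dots> \<le> ennreal ?out"
        using R by (intro radial_Wb_outer[OF u dim b p c]) auto
      finally show ?thesis by (subst (asm) ennreal_le_iff) auto
    qed
    have "pot c p u \<le> (\<integral>x. ?f ?w x + ?f u x * indicator {R/2..} (norm x) \<partial>lborel)"
      unfolding pot_def
    proof (rule integral_mono[OF fu])
      show "integrable lborel (\<lambda>x. ?f ?w x + ?f u x * indicator {R/2..} (norm x))"
        by (intro Bochner_Integration.integrable_add K cw fo)
      \<comment> \<open>Within radius R / 2 the cutoff is 1 and the first term suffices; beyond it,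
        the second does.\<close>
      show "?f u x \<le> ?f ?w x + ?f u x * indicator {R/2..} (norm x)" for x
        using \<eta>(5)[of x] by (cases "norm x \<ge> R / 2") auto
    qed
    also have "\<dots> = pot c p ?w + (\<integral>x. ?f u x * indicator {R/2..} (norm x) \<partial>lborel)"
      unfolding pot_def by (intro Bochner_Integration.integral_add K cw fo)
    also have "\<dots> \<le> pot c p ?w + ?out" using out by simp
    also have "pot c p ?w \<le> C * (grad_norm b ?w)\<^sup>2 * wnorm 0 2 ?w powr p" by (intro C cw)
    also have "\<dots> \<le> C * ((1 + e) * ?G\<^sup>2 + (1 + 1 / e) * ?K1 * R powr (b - 2) * ?M\<^sup>2) * sqrt (ball_mass u R) powr p"
    proof (intro mult_mono)
      show "(grad_norm b ?w)\<^sup>2 \<le> (1 + e) * ?G\<^sup>2 + (1 + 1 / e) * ?K1 * R powr (b - 2) * ?M\<^sup>2" by (rule cw)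
      have "(wnorm 0 2 ?w)\<^sup>2 \<le> ball_mass u R"
        unfolding wnorm0_sq ball_mass_def
      proof (rule integral_mono)
        show "integrable lborel (\<lambda>x. (norm (\<eta> x *\<^sub>R u x))\<^sup>2)" using cw(1) by (simp add: in_Wb_def wint0_sq)
        show "integrable lborel (\<lambda>x. indicator (cball 0 R) x * (norm (u x))\<^sup>2)"
          by (rule Bochner_Integration.integrable_bound[OF iu]) (auto simp: indicator_def)
        show "(norm (\<eta> x *\<^sub>R u x))\<^sup>2 \<le> indicator (cball 0 R) x * (norm (u x))\<^sup>2" for x
        proof (cases "norm x \<le> R")
          case True
          then show ?thesis using \<eta>(3,4)[of x] by (simp add: power_mult_distrib power_le_one mult_left_le_one_le)
        next
          case False
          then show ?thesis using \<eta>(6)[of x] by simp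
        qed
      qed
      then have "wnorm 0 2 ?w \<le> sqrt (ball_mass u R)" by (rule real_le_rsqrt)
      then show "wnorm 0 2 ?w powr p \<le> sqrt (ball_mass u R) powr p"
        using p wnorm_nonneg by (intro powr_mono2) auto
    qed (use C(1) e in auto)
    finally show "pot c p u \<le> C * ((1 + e) * ?G\<^sup>2 + (1 + 1 / e) * ?K1 * R powr (b - 2) * ?M\<^sup>2) * sqrt (ball_mass u R) powr p + ?out"
      by simp
  qed auto
qed

text \<open>Everything is divided by G^2 and expressed through \<kappa> = \<lambda> G^(2/(2-b)). The
  potential energy is (p + 2)(G^2 / 2 - E), the errors are G^2 times quantities that vanish as
  \<kappa> grows, and in the limit (p + 2) / 2 is at most C times the local mass factor.\<close>

lemma mass_concentration:
  fixes u :: "real \<Rightarrow> real^'n \<Rightarrow> complex"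
  assumes dim: "2 - real CARD('n) < b" and b: "b \<le> 0"
    and p: "0 < p" "p < 4" and c: "c = real CARD('n) * p / 2 - 2 + b"
    and C: "C > 0" "\<And>w :: real^'n \<Rightarrow> complex. in_Wb b w \<Longrightarrow> radial w \<Longrightarrow> pot c p w \<le> C * (grad_norm b w)\<^sup>2 * wnorm 0 2 w powr p"
    and u: "\<forall>\<^sub>F t in F. in_Wb b (u t) \<and> radial (u t) \<and> wnorm 0 2 (u t) = M \<and> energy b c p (u t) = E"
    and G: "filterlim (\<lambda>t. grad_norm b (u t)) at_top F"
    and lam: "\<forall>\<^sub>F t in F. lam t > 0"
    and lim: "filterlim (\<lambda>t. lam t * grad_norm b (u t) powr (2 / (2 - b))) at_top F"
    and d: "d < (p + 2) / (2 * C)"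
  shows "\<forall>\<^sub>F t in F. d < sqrt (ball_mass (u t) (lam t)) powr p"
proof -
  obtain K1 K2 where K: "K1 \<ge> 0" "K2 \<ge> 0" and loc: "\<And>(u :: real^'n \<Rightarrow> complex) R e. in_Wb b u \<Longrightarrow> radial u \<Longrightarrow> R > 0 \<Longrightarrow> e > 0 \<Longrightarrow>
     pot c p u \<le> C * ((1 + e) * (grad_norm b u)\<^sup>2 + (1 + 1 / e) * K1 * R powr (b - 2) * (wnorm 0 2 u)\<^sup>2) * sqrt (ball_mass u R) powr p
       + K2 * (R / 2) powr (- ((2 - b) * (1 - p / 4))) * (wnorm 0 2 u * grad_norm b u) powr (p / 2) * (wnorm 0 2 u)\<^sup>2"
    using localized_GN[OF dim b p c _ C(2)] C(1) by (metis less_imp_le)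
  define \<gamma> where "\<gamma> = (2 - b) * (1 - p / 4)"
  have \<gamma>: "\<gamma> > 0" unfolding \<gamma>_def using b p by simp
  define \<kappa> where "\<kappa> t = lam t * grad_norm b (u t) powr (2 / (2 - b))" for t
  \<comment> \<open>With this choice the error (1 + 1/e) \<kappa>^(-(2-b)) equals \<kappa>^(-(2-b))
    + e, so it tends to 0 together with \<open>e\<close>.\<close>
  define e where "e t = \<kappa> t powr (- (2 - b) / 2)" for t
  define A where "A t = (1 + e t) + (\<kappa> t powr (- (2 - b)) + e t) * K1 * M\<^sup>2" for t
  define D where "D t = K2 * (\<kappa> t / 2) powr (- \<gamma>) * M powr (p / 2) * M\<^sup>2" for t
  have \<kappa>: "filterlim \<kappa> at_top F" using lim by (simp add: \<kappa>_def[abs_def])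
  have e0: "(e \<longlongrightarrow> 0) F" unfolding e_def[abs_def] using b by (intro tendsto_neg_powr \<kappa>) auto
  have k0: "((\<lambda>t. \<kappa> t powr (- (2 - b))) \<longlongrightarrow> 0) F" using b by (intro tendsto_neg_powr \<kappa>) auto
  have kk: "filterlim (\<lambda>t. \<kappa> t / 2) at_top F"
    using filterlim_at_top_mult_tendsto_pos[OF tendsto_const[of "1/2"] _ \<kappa>] by simp
  have g0: "((\<lambda>t. (\<kappa> t / 2) powr (- \<gamma>)) \<longlongrightarrow> 0) F" using \<gamma> by (intro tendsto_neg_powr kk) auto
  have A1: "(A \<longlongrightarrow> (1 + 0) + (0 + 0) * K1 * M\<^sup>2) F" unfolding A_def[abs_def] by (intro tendsto_intros e0 k0)
  have D0: "(D \<longlongrightarrow> K2 * 0 * M powr (p / 2) * M\<^sup>2) F" unfolding D_def[abs_def] by (intro tendsto_intros g0)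
  have E0: "((\<lambda>t. E / (grad_norm b (u t))\<^sup>2) \<longlongrightarrow> 0) F"
    by (intro tendsto_divide_0[OF tendsto_const] filterlim_at_top_imp_at_infinity filterlim_pow_at_top G) auto
  have "((\<lambda>t. ((p + 2) * (1 / 2 - E / (grad_norm b (u t))\<^sup>2) - D t) / (C * A t)) \<longlongrightarrow>
     ((p + 2) * (1 / 2 - 0) - K2 * 0 * M powr (p / 2) * M\<^sup>2) / (C * ((1 + 0) + (0 + 0) * K1 * M\<^sup>2))) F"
    using C(1) by (intro tendsto_intros A1 D0 E0) auto
  moreover have "((p + 2) * (1 / 2 - 0) - K2 * 0 * M powr (p / 2) * M\<^sup>2) / (C * ((1 + 0) + (0 + 0) * K1 * M\<^sup>2)) = (p + 2) / (2 * C)"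
    by simp
  ultimately have ev: "\<forall>\<^sub>F t in F. d < ((p + 2) * (1 / 2 - E / (grad_norm b (u t))\<^sup>2) - D t) / (C * A t)"
    using d by (auto dest: order_tendstoD(1))
  have Gpos: "\<forall>\<^sub>F t in F. grad_norm b (u t) > 0" using G by (auto simp: filterlim_at_top_dense)
  show ?thesis
    using ev Gpos u lam
  proof eventually_elim
    case (elim t)
    define G where "G = grad_norm b (u t)"
    define m where "m = sqrt (ball_mass (u t) (lam t)) powr p"
    have G: "G > 0" and L: "lam t > 0" using elim by (auto simp: G_def)
    have W: "in_Wb b (u t)" "radial (u t)" "wnorm 0 2 (u t) = M" "energy b c p (u t) = E" using elim by auto
    have M: "M \<ge> 0" using W(3) wnorm_nonneg by metis
    have kp: "\<kappa> t > 0" unfolding \<kappa>_def using G L by (simp add: G_def)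
    have ep: "e t > 0" unfolding e_def using kp by simp
    have potE: "pot c p (u t) = (p + 2) * (G\<^sup>2 / 2 - E)"
      using W(4) p unfolding energy_def pot_def[symmetric] G_def by (simp add: field_simps)
    have L1: "lam t powr (b - 2) = \<kappa> t powr (- (2 - b)) * G\<^sup>2"
    proof -
      have "2 / d * (- d) = - 2" if "d \<noteq> 0" for d :: real using that by simp
      from this[of "2 - b"] have "2 / (2 - b) * (- (2 - b)) = - 2" using b by simp
      then have "\<kappa> t powr (- (2 - b)) = lam t powr (- (2 - b)) * G powr (- 2)"
        unfolding \<kappa>_def G_def by (simp only: powr_mult powr_powr)
      then show ?thesis using G by (simp add: powr_minus)
    qed
    \<comment> \<open>The powers of G add up to 2: passing from \<lambda> to \<kappa> contributes 2
      - p/2 and the Strauss factor contributes p/2.\<close>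
    have L2: "(lam t / 2) powr (- \<gamma>) * (M * G) powr (p / 2) = (\<kappa> t / 2) powr (- \<gamma>) * M powr (p / 2) * G\<^sup>2"
    proof -
      have "\<kappa> t / 2 = lam t / 2 * G powr (2 / (2 - b))" by (simp add: \<kappa>_def G_def)
      moreover have "2 / (2 - b) * (- \<gamma>) = p / 2 - 2"
      proof -
        have "2 / d * (- (d * q)) = - 2 * q" if "d \<noteq> 0" for d q :: real using that by simp
        from this[of "2 - b" "1 - p / 4"] show ?thesis using b unfolding \<gamma>_def by simp
      qed
      ultimately have "(\<kappa> t / 2) powr (- \<gamma>) = (lam t / 2) powr (- \<gamma>) * G powr (p / 2 - 2)"
        by (simp only: powr_mult powr_powr)
      then show ?thesis using G by (simp add: powr_mult powr_diff)
    qed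
    have e1: "(1 + 1 / e t) * \<kappa> t powr (- (2 - b)) = \<kappa> t powr (- (2 - b)) + e t"
    proof -
      have "\<kappa> t powr (- (2 - b)) = e t * e t" unfolding e_def powr_add[symmetric] by simp
      then show ?thesis using ep by (simp add: field_simps)
    qed
    have A: "(1 + e t) * G\<^sup>2 + (1 + 1 / e t) * K1 * lam t powr (b - 2) * M\<^sup>2 = A t * G\<^sup>2"
    proof -
      have "(1 + 1 / e t) * K1 * lam t powr (b - 2) * M\<^sup>2 = ((1 + 1 / e t) * \<kappa> t powr (- (2 - b))) * K1 * M\<^sup>2 * G\<^sup>2"
        unfolding L1 by (simp only: ac_simps)
      also have "\<dots> = (\<kappa> t powr (- (2 - b)) + e t) * K1 * M\<^sup>2 * G\<^sup>2" unfolding e1 ..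
      finally show ?thesis unfolding A_def distrib_right by (simp only:)
    qed
    have "(p + 2) * (G\<^sup>2 / 2 - E) \<le> C * (A t * G\<^sup>2) * m + D t * G\<^sup>2"
    proof -
      have "K2 * (lam t / 2) powr (- \<gamma>) * (M * G) powr (p / 2) * M\<^sup>2 = K2 * ((lam t / 2) powr (- \<gamma>) * (M * G) powr (p / 2)) * M\<^sup>2"
        by (simp only: mult.assoc)
      also have "\<dots> = D t * G\<^sup>2" unfolding L2 D_def by (simp only: ac_simps)
      finally have "K2 * (lam t / 2) powr (- \<gamma>) * (M * G) powr (p / 2) * M\<^sup>2 = D t * G\<^sup>2" .
      then show ?thesis
        using loc[OF W(1,2) L ep] unfolding W(3) G_def[symmetric] m_def[symmetric] \<gamma>_def[symmetric] A potE by (simp only:)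
    qed
    then have "((p + 2) * (G\<^sup>2 / 2 - E)) / G\<^sup>2 \<le> (C * (A t * G\<^sup>2) * m + D t * G\<^sup>2) / G\<^sup>2"
      by (rule divide_right_mono) simp
    moreover have "((p + 2) * (S / 2 - E)) / S = (p + 2) * (1 / 2 - E / S)" "(C * (A t * S) * m + D t * S) / S = C * A t * m + D t"
      if "S > 0" for S using that by (simp_all add: field_simps)
    ultimately have "(p + 2) * (1 / 2 - E / G\<^sup>2) \<le> C * A t * m + D t"
      using G by (simp only: zero_less_power)
    moreover have "C * A t > 0"
    proof -
      have "A t > 0" unfolding A_def using ep K by (intro add_pos_nonneg mult_nonneg_nonneg) auto
      then show ?thesis using C(1) by simp
    qed
    ultimately have "((p + 2) * (1 / 2 - E / G\<^sup>2) - D t) / (C * A t) \<le> m"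
      by (simp add: divide_le_eq ac_simps)
    then show ?case using elim(1) unfolding G_def m_def by simp
  qed
qed

section \<open>The optimal constant and the ground state\<close>

text \<open>Convexity of t^q, from the mean value theorem on either side of \<open>A\<close>. The
  point W = 0 is treated apart because the derivative of the power is taken at positive
  arguments.\<close>

lemma powr_above_tangent:
  fixes A W q :: real
  assumes A: "A > 0" and W: "W \<ge> 0" and q: "q \<ge> 1"
  shows "A powr q + q * A powr (q - 1) * (W - A) \<le> W powr q"
proof (cases W A rule: linorder_cases)
  case equal then show ?thesis by simp
next
  case greater
  have "\<exists>z. A < z \<and> z < W \<and> W powr q - A powr q = (W - A) * (q * z powr (q - 1))"
    using greater A by (intro MVT2) (auto intro!: derivative_eq_intros simp: powr_diff)
  then obtain z where z: "A < z" "z < W" "W powr q - A powr q = (W - A) * (q * z powr (q - 1))" by blast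
  have "q * A powr (q - 1) * (W - A) \<le> q * z powr (q - 1) * (W - A)"
    using z greater A q by (intro mult_right_mono mult_left_mono powr_mono2) auto
  then show ?thesis using z(3) by (simp add: mult.commute)
next
  case less
  show ?thesis
  proof (cases "W = 0")
    case True
    have "q * A powr (q - 1) * A = q * A powr q" using A by (simp add: powr_diff)
    moreover have "A powr q \<le> q * A powr q" using mult_right_mono[OF q, of "A powr q"] by simp
    moreover have "q * A powr (q - 1) * (W - A) = - (q * A powr (q - 1) * A)" using True by simp
    moreover have "W powr q = 0" using True by simp
    ultimately show ?thesis by linarith
  next
    case False
    then have W0: "W > 0" using W by simp
    have "\<exists>z. W < z \<and> z < A \<and> A powr q - W powr q = (A - W) * (q * z powr (q - 1))"
      using less W0 by (intro MVT2) (auto intro!: derivative_eq_intros simp: powr_diff)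
    then obtain z where z: "W < z" "z < A" "A powr q - W powr q = (A - W) * (q * z powr (q - 1))" by blast
    have "q * z powr (q - 1) * (A - W) \<le> q * A powr (q - 1) * (A - W)"
      using z less W0 q by (intro mult_right_mono mult_left_mono powr_mono2) auto
    then show ?thesis using z(3) by (simp add: algebra_simps)
  qed
qed

text \<open>A one-sided linear bound is all that the Euler-Lagrange equation will need, so the
  potential energy is never differentiated under the integral. It follows from scalar convexity and
  the Cauchy-Schwarz inequality.\<close>

lemma norm_powr_above_tangent:
  fixes a h :: complex
  assumes p: "p > 0"
  shows "norm a powr (p + 2) + (p + 2) * (norm a powr p * (a \<bullet> h)) \<le> norm (a + h) powr (p + 2)"
proof (cases "a = 0")
  case False
  then have a: "norm a > 0" by simp
  have "a \<bullet> h = a \<bullet> (a + h) - (norm a)\<^sup>2" by (simp add: inner_add_right power2_norm_eq_inner)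
  also have "\<dots> \<le> norm a * norm (a + h) - (norm a)\<^sup>2" using norm_cauchy_schwarz[of a "a + h"] by simp
  also have "\<dots> = norm a * (norm (a + h) - norm a)" by (simp add: power2_eq_square algebra_simps)
  finally have "norm a powr p * (a \<bullet> h) \<le> norm a powr p * (norm a * (norm (a + h) - norm a))" by (intro mult_left_mono) auto
  also have "\<dots> = norm a powr (p + 2 - 1) * (norm (a + h) - norm a)"
    using a by (simp add: powr_add powr_diff power2_eq_square)
  finally have "(p + 2) * (norm a powr p * (a \<bullet> h)) \<le> (p + 2) * norm a powr (p + 2 - 1) * (norm (a + h) - norm a)"
    using p mult_left_mono[of _ _ "p + 2"] by (simp add: mult.assoc)
  moreover have "norm a powr (p + 2) + (p + 2) * norm a powr (p + 2 - 1) * (norm (a + h) - norm a) \<le> norm (a + h) powr (p + 2)"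
    using p by (intro powr_above_tangent[OF a]) auto
  ultimately show ?thesis by linarith
qed (use p in simp)

section \<open>The first variation at a maximiser\<close>

lemma local_weight_integrable:
  assumes "s > - real DIM('a)"
  shows "integrable lborel (\<lambda>x::'a::euclidean_space. norm x powr s * indicator (cball 0 R) x)"
proof (rule integrableI_bounded)
  have [measurable]: "indicator (cball (0::'a) R) \<in> borel_measurable borel"
    by (rule borel_measurable_indicator[OF borel_closed[OF closed_cball]])
  show "(\<lambda>x::'a. norm x powr s * indicator (cball 0 R) x) \<in> borel_measurable lborel" by simp
  have "(\<integral>\<^sup>+x. ennreal (norm (norm (x::'a) powr s * indicator (cball 0 R) x)) \<partial>lborel)
    \<le> (\<integral>\<^sup>+(x::'a). ennreal (norm x powr s) * indicator {..max 0 R} (norm x) \<partial>lborel)"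
    by (intro nn_integral_mono) (auto simp: indicator_def)
  also have "\<dots> < \<infinity>" using assms by (subst nn_integral_norm_powr_inside) auto
  finally show "(\<integral>\<^sup>+x. ennreal (norm (norm (x::'a) powr s * indicator (cball 0 R) x)) \<partial>lborel) < \<infinity>" .
qed measurable

text \<open>Along Q + e \<phi> z, the inequality with its potential energy replaced by the linear
  lower bound gives a function of \<open>e\<close> that is nonnegative and vanishes at e = 0, so its
  derivative there is 0. The variation is radial because the inequality is one for radial
  functions.\<close>

lemma GN_maximizer_Euler_Lagrange:
  fixes Q :: "real^'n \<Rightarrow> complex" and \<phi> :: "real^'n \<Rightarrow> real" and z :: complex
  assumes dim: "2 - real CARD('n) < b" and b: "b \<le> 0"
    and p: "0 < p" "p < 4" and c: "c = real CARD('n) * p / 2 - 2 + b"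
    and Q: "in_Wb b Q" "radial Q" "wnorm 0 2 Q > 0"
    and max: "pot c p Q = C * (grad_norm b Q)\<^sup>2 * wnorm 0 2 Q powr p"
    and C: "\<And>w :: real^'n \<Rightarrow> complex. in_Wb b w \<Longrightarrow> radial w \<Longrightarrow> pot c p w \<le> C * (grad_norm b w)\<^sup>2 * wnorm 0 2 w powr p"
    and t: "test_fun \<phi> d" and rad: "radial \<phi>"
  defines "v \<equiv> \<lambda>x. (\<chi> j. d j x *\<^sub>R z)"
  shows "integrable lborel (\<lambda>x. norm x powr b * (wgrad b Q x \<bullet> v x))"
    "integrable lborel (\<lambda>x. Q x \<bullet> (\<phi> x *\<^sub>R z))"
    "integrable lborel (\<lambda>x. norm x powr c * (cmod (Q x) powr p * (Q x \<bullet> (\<phi> x *\<^sub>R z))))"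
    "(p + 2) * (\<integral>x. norm x powr c * (cmod (Q x) powr p * (Q x \<bullet> (\<phi> x *\<^sub>R z))) \<partial>lborel)
     = pot c p Q * (2 * (\<integral>x. norm x powr b * (wgrad b Q x \<bullet> v x) \<partial>lborel) / (grad_norm b Q)\<^sup>2
        + p * (\<integral>x. Q x \<bullet> (\<phi> x *\<^sub>R z) \<partial>lborel) / (wnorm 0 2 Q)\<^sup>2)"
proof -
  let ?g = "wgrad b Q"
  let ?G = "grad_norm b Q" and ?M = "wnorm 0 2 Q" and ?N = "pot c p Q"
  have n: "real CARD('n) > 2" using dim b by simp
  have G0: "?G > 0" by (rule grad_norm_pos[OF Q(1,2) dim Q(3)])
  have iQ: "integrable lborel (\<lambda>x. (norm (Q x))\<^sup>2)" and mQ[measurable]: "Q \<in> borel_measurable borel"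
    using Q(1) by (auto simp: in_Wb_def wint0_sq)
  have ig: "integrable lborel (\<lambda>x. norm x powr b * (norm (?g x))\<^sup>2)" and mg[measurable]: "?g \<in> borel_measurable borel"
    using wgrad_props(2)[OF Q(1)] by (auto simp: wint_sq)
  have iN: "integrable lborel (\<lambda>x. norm x powr c * cmod (w x) powr (p + 2))" if "in_Wb b w" "radial w" for w :: "real^'n \<Rightarrow> complex"
    using radial_GN[OF dim b p c] that by blast
  note [measurable] = test_fun_measurable[OF t]
  have mv[measurable]: "v \<in> borel_measurable borel"
    unfolding v_def by (subst borel_measurable_euclidean_space) (auto simp: Basis_vec_def inner_axis)
  obtain B R where B: "B \<ge> 0" "R \<ge> 0" "\<And>x. \<bar>\<phi> x\<bar> \<le> B * indicator (cball 0 R) x" "\<And>j x. \<bar>d j x\<bar> \<le> B * indicator (cball 0 R) x"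
    by (rule test_fun_bounded[OF t]) blast
  have nv: "(norm (v x))\<^sup>2 \<le> real CARD('n) * B\<^sup>2 * (norm z)\<^sup>2 * indicator (cball 0 R) x" for x
  proof -
    have "(norm (v x))\<^sup>2 = (\<Sum>j\<in>UNIV. (d j x)\<^sup>2 * (norm z)\<^sup>2)"
      by (simp add: v_def norm_vec_def L2_set_def sum_nonneg power_mult_distrib)
    also have "\<dots> \<le> (\<Sum>j\<in>(UNIV::'n set). B\<^sup>2 * (norm z)\<^sup>2 * indicator (cball 0 R) x)"
    proof (rule sum_mono)
      fix j
      have "\<bar>d j x\<bar>\<^sup>2 \<le> (B * indicator (cball 0 R) x)\<^sup>2" by (intro power_mono B) auto
      then have "(d j x)\<^sup>2 \<le> B\<^sup>2 * indicator (cball 0 R) x" by (cases "x \<in> cball 0 R") (auto simp: power_mult_distrib)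
      then have "(d j x)\<^sup>2 * (norm z)\<^sup>2 \<le> (B\<^sup>2 * indicator (cball 0 R) x) * (norm z)\<^sup>2" by (intro mult_right_mono) auto
      then show "(d j x)\<^sup>2 * (norm z)\<^sup>2 \<le> B\<^sup>2 * (norm z)\<^sup>2 * indicator (cball 0 R) x" by (simp only: ac_simps)
    qed
    finally show ?thesis by (simp add: ac_simps)
  qed
  have iv: "integrable lborel (\<lambda>x. norm x powr b * (norm (v x))\<^sup>2)"
  proof (rule Bochner_Integration.integrable_bound)
    show "integrable lborel (\<lambda>x::real^'n. (real CARD('n) * B\<^sup>2 * (norm z)\<^sup>2) * (norm x powr b * indicator (cball 0 R) x))"
      using dim by (intro integrable_mult_right local_weight_integrable) auto
    show "AE x in lborel. norm (norm x powr b * (norm (v x))\<^sup>2) \<le> norm ((real CARD('n) * B\<^sup>2 * (norm z)\<^sup>2) * (norm x powr b * indicator (cball 0 R) x))"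
    proof (rule AE_I2)
      fix x
      have "norm x powr b * (norm (v x))\<^sup>2 \<le> norm x powr b * (real CARD('n) * B\<^sup>2 * (norm z)\<^sup>2 * indicator (cball 0 R) x)"
        by (intro mult_left_mono nv) auto
      then show "norm (norm x powr b * (norm (v x))\<^sup>2) \<le> norm ((real CARD('n) * B\<^sup>2 * (norm z)\<^sup>2) * (norm x powr b * indicator (cball 0 R) x))"
        by (simp add: abs_mult ac_simps)
    qed
  qed measurable
  show iL: "integrable lborel (\<lambda>x. norm x powr b * (?g x \<bullet> v x))"
  proof (rule Bochner_Integration.integrable_bound[OF Bochner_Integration.integrable_add[OF ig iv]])
    show "AE x in lborel. norm (norm x powr b * (?g x \<bullet> v x)) \<le> norm (norm x powr b * (norm (?g x))\<^sup>2 + norm x powr b * (norm (v x))\<^sup>2)"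
    proof (rule AE_I2)
      fix x
      have "\<bar>?g x \<bullet> v x\<bar> \<le> norm (?g x) * norm (v x)" by (rule Cauchy_Schwarz_ineq2)
      also have "\<dots> \<le> (norm (?g x))\<^sup>2 + (norm (v x))\<^sup>2"
        using zero_le_power2[of "norm (?g x) - norm (v x)"] zero_le_power2[of "norm (?g x)"] zero_le_power2[of "norm (v x)"]
        unfolding power2_diff by linarith
      finally have "norm x powr b * \<bar>?g x \<bullet> v x\<bar> \<le> norm x powr b * ((norm (?g x))\<^sup>2 + (norm (v x))\<^sup>2)" by (intro mult_left_mono) auto
      then show "norm (norm x powr b * (?g x \<bullet> v x)) \<le> norm (norm x powr b * (norm (?g x))\<^sup>2 + norm x powr b * (norm (v x))\<^sup>2)"
        by (simp add: abs_mult distrib_left)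
    qed
  qed measurable
  have iB: "integrable lborel (\<lambda>x::real^'n. K * indicator (cball 0 R) x)" for K :: real
    using emeasure_bounded_finite[OF bounded_cball, of "0::real^'n" R]
    by (intro integrable_mult_right) (simp add: integrable_indicator_iff)
  have iz: "integrable lborel (\<lambda>x. (norm (\<phi> x *\<^sub>R z))\<^sup>2)"
  proof (rule Bochner_Integration.integrable_bound[OF iB[of "B\<^sup>2 * (norm z)\<^sup>2"]])
    show "AE x in lborel. norm ((norm (\<phi> x *\<^sub>R z))\<^sup>2) \<le> norm (B\<^sup>2 * (norm z)\<^sup>2 * indicator (cball 0 R) x)"
    proof (rule AE_I2)
      fix x
      have "\<bar>\<phi> x\<bar>\<^sup>2 \<le> (B * indicator (cball 0 R) x)\<^sup>2" by (intro power_mono B) auto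
      then have "(\<phi> x)\<^sup>2 \<le> B\<^sup>2 * indicator (cball 0 R) x" by (cases "x \<in> cball 0 R") (auto simp: power_mult_distrib)
      then have "(\<phi> x)\<^sup>2 * (norm z)\<^sup>2 \<le> (B\<^sup>2 * indicator (cball 0 R) x) * (norm z)\<^sup>2" by (intro mult_right_mono) auto
      then show "norm ((norm (\<phi> x *\<^sub>R z))\<^sup>2) \<le> norm (B\<^sup>2 * (norm z)\<^sup>2 * indicator (cball 0 R) x)"
        by (simp add: power_mult_distrib abs_mult ac_simps)
    qed
  qed measurable
  have CS: "\<bar>a \<bullet> h\<bar> \<le> (norm a)\<^sup>2 + (norm h)\<^sup>2" for a h :: complex
  proof -
    have "\<bar>a \<bullet> h\<bar> \<le> norm a * norm h" by (rule Cauchy_Schwarz_ineq2)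
    also have "\<dots> \<le> (norm a)\<^sup>2 + (norm h)\<^sup>2"
      using zero_le_power2[of "norm a - norm h"] zero_le_power2[of "norm a"] zero_le_power2[of "norm h"]
      unfolding power2_diff by linarith
    finally show ?thesis .
  qed
  show iI: "integrable lborel (\<lambda>x. Q x \<bullet> (\<phi> x *\<^sub>R z))"
  proof (rule Bochner_Integration.integrable_bound[OF Bochner_Integration.integrable_add[OF iQ iz]])
    show "AE x in lborel. norm (Q x \<bullet> (\<phi> x *\<^sub>R z)) \<le> norm ((norm (Q x))\<^sup>2 + (norm (\<phi> x *\<^sub>R z))\<^sup>2)"
    proof (rule AE_I2)
      fix x
      show "norm (Q x \<bullet> (\<phi> x *\<^sub>R z)) \<le> norm ((norm (Q x))\<^sup>2 + (norm (\<phi> x *\<^sub>R z))\<^sup>2)"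
        using CS[of "Q x" "\<phi> x *\<^sub>R z"] unfolding real_norm_def by (rule order.trans[OF _ abs_ge_self])
    qed
  qed measurable
  \<comment> \<open>The weight is locally integrable because c > b - 2 > -n.\<close>
  have wc: "integrable lborel (\<lambda>x::real^'n. norm x powr c * indicator (cball 0 R) x)"
  proof -
    have "- real CARD('n) < b - 2" using dim by simp
    also have "\<dots> < c" unfolding c using p n by simp
    finally show ?thesis by (intro local_weight_integrable) simp
  qed
  show iD: "integrable lborel (\<lambda>x. norm x powr c * (cmod (Q x) powr p * (Q x \<bullet> (\<phi> x *\<^sub>R z))))"
  proof (rule Bochner_Integration.integrable_bound)
    show "integrable lborel (\<lambda>x. (B * norm z) * (norm x powr c * indicator (cball 0 R) x + norm x powr c * cmod (Q x) powr (p + 2)))"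
      by (intro integrable_mult_right Bochner_Integration.integrable_add wc iN Q)
    show "AE x in lborel. norm (norm x powr c * (cmod (Q x) powr p * (Q x \<bullet> (\<phi> x *\<^sub>R z))))
      \<le> norm ((B * norm z) * (norm x powr c * indicator (cball 0 R) x + norm x powr c * cmod (Q x) powr (p + 2)))"
    proof (rule AE_I2)
      fix x
      \<comment> \<open>The power t^(p+1) is at most 1 for t up to 1 and at most t^(p+2) beyond;
        this lets the integrable potential energy density dominate.\<close>
      have q: "cmod (Q x) powr p * cmod (Q x) \<le> 1 + cmod (Q x) powr (p + 2)"
      proof (cases "cmod (Q x) \<le> 1")
        case True
        have "cmod (Q x) powr p \<le> 1 powr p" using True p by (intro powr_mono2) auto
        then have "cmod (Q x) powr p * cmod (Q x) \<le> 1 * 1" using True by (intro mult_mono) auto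
        then show ?thesis by (simp add: add_increasing2)
      next
        case False
        then have "cmod (Q x) powr p * cmod (Q x) = cmod (Q x) powr (p + 1)" by (simp add: powr_add)
        also have "\<dots> \<le> cmod (Q x) powr (p + 2)" using False by (intro powr_mono) auto
        finally show ?thesis by simp
      qed
      have "\<bar>Q x \<bullet> (\<phi> x *\<^sub>R z)\<bar> \<le> cmod (Q x) * (\<bar>\<phi> x\<bar> * norm z)" using Cauchy_Schwarz_ineq2[of "Q x" "\<phi> x *\<^sub>R z"] by simp
      also have "\<dots> \<le> cmod (Q x) * ((B * indicator (cball 0 R) x) * norm z)" by (intro mult_left_mono mult_right_mono B) auto
      finally have "norm x powr c * (cmod (Q x) powr p * \<bar>Q x \<bullet> (\<phi> x *\<^sub>R z)\<bar>) \<le> norm x powr c * (cmod (Q x) powr p * (cmod (Q x) * ((B * indicator (cball 0 R) x) * norm z)))"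
        by (intro mult_left_mono) auto
      also have "\<dots> = (norm x powr c * (cmod (Q x) powr p * cmod (Q x))) * (B * norm z * indicator (cball 0 R) x)" by (simp only: ac_simps)
      also have "\<dots> \<le> (norm x powr c * (1 + cmod (Q x) powr (p + 2))) * (B * norm z * indicator (cball 0 R) x)"
        using B(1) by (intro mult_right_mono mult_left_mono q) auto
      also have "\<dots> \<le> (B * norm z) * (norm x powr c * indicator (cball 0 R) x + norm x powr c * cmod (Q x) powr (p + 2))"
        using B(1) by (cases "x \<in> cball 0 R") (auto simp: algebra_simps)
      finally show "norm (norm x powr c * (cmod (Q x) powr p * (Q x \<bullet> (\<phi> x *\<^sub>R z))))
        \<le> norm ((B * norm z) * (norm x powr c * indicator (cball 0 R) x + norm x powr c * cmod (Q x) powr (p + 2)))"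
        unfolding real_norm_def by (intro order.trans[OF _ abs_ge_self]) (simp add: abs_mult)
    qed
  qed measurable
  define L where "L = (\<integral>x. norm x powr b * (?g x \<bullet> v x) \<partial>lborel)"
  define L2 where "L2 = (\<integral>x. norm x powr b * (norm (v x))\<^sup>2 \<partial>lborel)"
  define I where "I = (\<integral>x. Q x \<bullet> (\<phi> x *\<^sub>R z) \<partial>lborel)"
  define I2 where "I2 = (\<integral>x. (norm (\<phi> x *\<^sub>R z))\<^sup>2 \<partial>lborel)"
  define D where "D = (\<integral>x. norm x powr c * (cmod (Q x) powr p * (Q x \<bullet> (\<phi> x *\<^sub>R z))) \<partial>lborel)"
  \<comment> \<open>The right-hand side of the inequality at Q + e \<phi> z minus the linear lower
    bound of the potential energy; both squared norms are quadratic polynomials in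
    \<open>e\<close>.\<close>
  define H where "H e = C * ((?G\<^sup>2 + 2 * e * L + e\<^sup>2 * L2) * (?M\<^sup>2 + 2 * e * I + e\<^sup>2 * I2) powr (p / 2)) - ?N - (p + 2) * e * D" for e
  have Mp: "(?M\<^sup>2) powr (p / 2) = ?M powr p" using Q(3) by (simp add: powr_powr flip: powr_numeral)
  have H0: "H 0 = 0" unfolding H_def using max by (simp add: Mp)
  have sq: "(norm (a + e *\<^sub>R h))\<^sup>2 = (norm a)\<^sup>2 + 2 * e * (a \<bullet> h) + e\<^sup>2 * (norm h)\<^sup>2" for a h :: "'v::real_inner" and e
    unfolding power2_norm_eq_inner by (simp add: inner_add_left inner_add_right inner_commute algebra_simps power2_eq_square)
  have Hpos: "H e \<ge> 0" for e
  proof -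
    define w where "w x = Q x + e *\<^sub>R (\<phi> x *\<^sub>R z)" for x
    define h where "h x = ?g x + e *\<^sub>R v x" for x
    have wg: "weak_grad w h"
    proof -
      have "weak_grad (\<lambda>x. Q x + \<phi> x *\<^sub>R (e *\<^sub>R z)) (\<lambda>x. ?g x + (\<chi> j. d j x *\<^sub>R (e *\<^sub>R z)))"
      proof (rule weak_grad_add[OF wgrad_props(1)[OF Q(1)] mQ mg weak_grad_test_fun[OF t]])
        show "(\<lambda>x. \<phi> x *\<^sub>R e *\<^sub>R z) \<in> borel_measurable borel" by measurable
        show "(\<lambda>x. \<chi> j. d j x *\<^sub>R e *\<^sub>R z) \<in> borel_measurable borel"
          by (subst borel_measurable_euclidean_space) (auto simp: Basis_vec_def inner_axis)
      qed
      moreover have "(\<lambda>x. Q x + \<phi> x *\<^sub>R (e *\<^sub>R z)) = w" by (simp add: w_def fun_eq_iff mult.commute)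
      moreover have "(\<lambda>x. ?g x + (\<chi> j. d j x *\<^sub>R (e *\<^sub>R z))) = h" by (simp add: h_def v_def fun_eq_iff vec_eq_iff mult.commute)
      ultimately show ?thesis by simp
    qed
    have e1: "(norm (w x))\<^sup>2 = (norm (Q x))\<^sup>2 + 2 * e * (Q x \<bullet> (\<phi> x *\<^sub>R z)) + e\<^sup>2 * (norm (\<phi> x *\<^sub>R z))\<^sup>2" for x
      unfolding w_def by (rule sq)
    have e2: "norm x powr b * (norm (h x))\<^sup>2 = norm x powr b * (norm (?g x))\<^sup>2 + 2 * e * (norm x powr b * (?g x \<bullet> v x)) + e\<^sup>2 * (norm x powr b * (norm (v x))\<^sup>2)" for x
      unfolding h_def sq by (simp add: algebra_simps)
    have iw: "integrable lborel (\<lambda>x. (norm (w x))\<^sup>2)"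
      unfolding e1 by (intro Bochner_Integration.integrable_add integrable_mult_right iQ iI iz)
    have ih: "integrable lborel (\<lambda>x. norm x powr b * (norm (h x))\<^sup>2)"
      unfolding e2 by (intro Bochner_Integration.integrable_add integrable_mult_right ig iL iv)
    have w0: "wint 0 2 w" unfolding wint0_sq using iw by (simp add: w_def[abs_def])
    have wh: "wint b 2 h" unfolding wint_sq using ih by (simp add: h_def[abs_def])
    have W: "in_Wb b w" by (rule grad_norm_eqI(1)[OF w0 wg wh])
    have radw: "radial w" using Q(2) rad unfolding radial_def w_def by metis
    have Gw: "(grad_norm b w)\<^sup>2 = ?G\<^sup>2 + 2 * e * L + e\<^sup>2 * L2"
    proof -
      have "(grad_norm b w)\<^sup>2 = (\<integral>x. norm x powr b * (norm (h x))\<^sup>2 \<partial>lborel)" by (rule grad_norm_eqI(2)[OF w0 wg wh])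
      also have "\<dots> = (\<integral>x. norm x powr b * (norm (?g x))\<^sup>2 \<partial>lborel) + 2 * e * L + e\<^sup>2 * L2"
        unfolding e2 L_def L2_def using ig iL iv by simp
      also have "(\<integral>x. norm x powr b * (norm (?g x))\<^sup>2 \<partial>lborel) = ?G\<^sup>2" by (simp add: grad_norm_def wnorm_sq)
      finally show ?thesis .
    qed
    have Mw: "(wnorm 0 2 w)\<^sup>2 = ?M\<^sup>2 + 2 * e * I + e\<^sup>2 * I2"
      unfolding wnorm0_sq e1 I_def I2_def using iQ iI iz by (simp del: norm_scaleR inner_scaleR_right)
    have Mwp: "wnorm 0 2 w powr p = ((wnorm 0 2 w)\<^sup>2) powr (p / 2)"
      using wnorm_nonneg[of 0 2 w] by (cases "wnorm 0 2 w = 0") (auto simp: powr_powr simp flip: powr_numeral)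
    have "?N + (p + 2) * e * D = (\<integral>x. norm x powr c * cmod (Q x) powr (p + 2) + (p + 2) * e * (norm x powr c * (cmod (Q x) powr p * (Q x \<bullet> (\<phi> x *\<^sub>R z)))) \<partial>lborel)"
      unfolding pot_def D_def using iN[OF Q(1,2)] iD by (simp del: inner_scaleR_right)
    also have "\<dots> \<le> pot c p w"
      unfolding pot_def
    proof (rule integral_mono)
      show "integrable lborel (\<lambda>x. norm x powr c * cmod (Q x) powr (p + 2) + (p + 2) * e * (norm x powr c * (cmod (Q x) powr p * (Q x \<bullet> (\<phi> x *\<^sub>R z)))))"
        by (intro Bochner_Integration.integrable_add integrable_mult_right iN Q iD)
      show "integrable lborel (\<lambda>x. norm x powr c * cmod (w x) powr (p + 2))" by (rule iN[OF W radw])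
      fix x
      have "norm x powr c * (cmod (Q x) powr (p + 2) + (p + 2) * (cmod (Q x) powr p * (Q x \<bullet> (e *\<^sub>R (\<phi> x *\<^sub>R z))))) \<le> norm x powr c * cmod (w x) powr (p + 2)"
        unfolding w_def by (intro mult_left_mono norm_powr_above_tangent p) auto
      then show "norm x powr c * cmod (Q x) powr (p + 2) + (p + 2) * e * (norm x powr c * (cmod (Q x) powr p * (Q x \<bullet> (\<phi> x *\<^sub>R z)))) \<le> norm x powr c * cmod (w x) powr (p + 2)"
        unfolding inner_scaleR_right[of _ e] by (simp only: algebra_simps)
    qed
    also have "\<dots> \<le> C * (grad_norm b w)\<^sup>2 * wnorm 0 2 w powr p" by (rule C[OF W radw])
    also have "\<dots> = C * ((?G\<^sup>2 + 2 * e * L + e\<^sup>2 * L2) * (?M\<^sup>2 + 2 * e * I + e\<^sup>2 * I2) powr (p / 2))"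
      unfolding Mwp Mw Gw by (simp only: mult.assoc)
    finally show ?thesis unfolding H_def by simp
  qed
  have dH: "(H has_real_derivative (C * (2 * L * (?M\<^sup>2) powr (p / 2) + ?G\<^sup>2 * ((p / 2) * (?M\<^sup>2) powr (p / 2 - 1) * (2 * I))) - (p + 2) * D)) (at 0)"
    unfolding H_def[abs_def] using Q(3) by (auto intro!: derivative_eq_intros simp: powr_diff field_simps)
  have "\<forall>e. \<bar>0 - e\<bar> < 1 \<longrightarrow> H 0 \<le> H e" using H0 Hpos by simp
  then have "C * (2 * L * (?M\<^sup>2) powr (p / 2) + ?G\<^sup>2 * ((p / 2) * (?M\<^sup>2) powr (p / 2 - 1) * (2 * I))) - (p + 2) * D = 0"
    by (rule DERIV_local_min[OF dH zero_less_one])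
  moreover have "(?M\<^sup>2) powr (p / 2 - 1) = ?M powr p / ?M\<^sup>2" using Q(3) by (simp add: powr_diff Mp)
  ultimately have "(p + 2) * D = C * (2 * L * ?M powr p + ?G\<^sup>2 * ((p / 2) * (?M powr p / ?M\<^sup>2) * (2 * I)))" by (simp add: Mp)
  also have "\<dots> = ?N * (2 * L / ?G\<^sup>2 + p * I / ?M\<^sup>2)" unfolding max using G0 Q(3) by (simp add: field_simps)
  finally show "(p + 2) * (\<integral>x. norm x powr c * (cmod (Q x) powr p * (Q x \<bullet> (\<phi> x *\<^sub>R z))) \<partial>lborel)
     = ?N * (2 * (\<integral>x. norm x powr b * (?g x \<bullet> v x) \<partial>lborel) / ?G\<^sup>2 + p * (\<integral>x. Q x \<bullet> (\<phi> x *\<^sub>R z) \<partial>lborel) / ?M\<^sup>2)"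
    unfolding D_def L_def I_def .
qed

lemma integrable_complexI:
  fixes f :: "'a \<Rightarrow> complex"
  assumes "\<And>y. integrable M (\<lambda>x. f x \<bullet> y)"
  shows "integrable M f"
proof -
  have "integrable M (\<lambda>x. (f x \<bullet> 1) *\<^sub>R 1 + (f x \<bullet> \<i>) *\<^sub>R \<i>)"
    by (intro Bochner_Integration.integrable_add integrable_scaleR_left assms)
  moreover have "(\<lambda>x. (f x \<bullet> 1) *\<^sub>R 1 + (f x \<bullet> \<i>) *\<^sub>R \<i>) = f"
    by (auto simp: fun_eq_iff complex_eq_iff inner_complex_def)
  ultimately show ?thesis by simp
qed

lemma mass_critical_C_GN:
  fixes Q :: "real^'n \<Rightarrow> complex"
  assumes dim: "2 - real CARD('n) < b" and b: "b \<le> 0"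
    and p: "0 < p" "p < 4" and c: "c = real CARD('n) * p / 2 - 2 + b"
    and gs: "ground_state b c p Q"
  shows "C_GN b c p TYPE('n) = (p + 2) / (2 * wnorm 0 2 Q powr p)"
proof -
  let ?g = "wgrad b Q"
  let ?G = "grad_norm b Q" and ?M = "wnorm 0 2 Q" and ?N = "pot c p Q" and ?C = "C_GN b c p TYPE('n)"
  have Q: "in_Wb b Q" "radial Q" "?M > 0" and gn: "gn_ratio b c p Q = ?C"
    using gs unfolding ground_state_def by auto
  have G0: "?G > 0" by (rule grad_norm_pos[OF Q(1,2) dim Q(3)])
  have max: "?N = ?C * ?G\<^sup>2 * ?M powr p"
    using gn G0 Q(3) unfolding gn_ratio_mass_critical[OF b c] by (auto simp: divide_eq_eq mult.assoc)
  have mQ[measurable]: "Q \<in> borel_measurable borel" using Q(1) by (auto simp: in_Wb_def wint_def)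
  have mg[measurable]: "?g \<in> borel_measurable borel" using wgrad_props(2)[OF Q(1)] by (auto simp: wint_def)
  have Qloc: "\<And>K. compact K \<Longrightarrow> set_integrable lborel K Q"
    using wgrad_props(1)[OF Q(1)] unfolding weak_grad_def by blast
  \<comment> \<open>Write L, I, D for the gradient, mass and potential terms of a test function and
    N for the potential energy of Q. The Euler-Lagrange equation is (p + 2) D = N (2 L / G^2 + p I /
    M^2), the elliptic equation is D = L + I, and eliminating D gives A L + B I = 0. The value of
    the constant follows once A = 0.\<close>
  define A where "A = (p + 2) - 2 * ?N / ?G\<^sup>2"
  define B where "B = (p + 2) - p * ?N / ?M\<^sup>2"
  have "A = 0"
  proof (rule ccontr)
    assume A0: "A \<noteq> 0"
    obtain F where prof: "is_profile b Q F" using radial_Wb_profile[OF Q(1,2) dim] by blast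
    have cF: "continuous_on {0<..} F" and QF: "AE x in lborel. Q x = F (norm x)"
      using prof by (simp_all only: is_profile_def)
    \<comment> \<open>Eliminating L instead leaves A D + (B - A) I = 0, which contains no gradient:
      it says that \<open>W\<close> of |x| is orthogonal to radial test functions.\<close>
    define W where "W r = (A * (r powr c * cmod (F r) powr p) + (B - A)) *\<^sub>R F r" for r
    have ck: "continuous_on {0<..} (\<lambda>r. r powr c * cmod (F r) powr p)"
      using p by (intro continuous_intros cF continuous_on_powr') auto
    have cW: "continuous_on {0<..} W"
      unfolding W_def by (intro continuous_intros cF ck)
    have orth: "integrable lborel (\<lambda>x. \<phi> x * (W (norm x) \<bullet> z)) \<and> (\<integral>x. \<phi> x * (W (norm x) \<bullet> z) \<partial>lborel) = 0"
      if t: "test_fun \<phi> d" and rad: "radial \<phi>" and m: "(\<lambda>x. \<phi> x * (W (norm x) \<bullet> z)) \<in> borel_measurable borel"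
      for \<phi> :: "real^'n \<Rightarrow> real" and d z
    proof -
      note [measurable] = test_fun_measurable[OF t]
      note EL = GN_maximizer_Euler_Lagrange[OF dim b p c Q max C_GN_bound[OF dim b p c] t rad]
      define L where "L = (\<integral>x. norm x powr b * (?g x \<bullet> (\<chi> j. d j x *\<^sub>R z)) \<partial>lborel)"
      define I where "I = (\<integral>x. Q x \<bullet> (\<phi> x *\<^sub>R z) \<partial>lborel)"
      define D where "D = (\<integral>x. norm x powr c * (cmod (Q x) powr p * (Q x \<bullet> (\<phi> x *\<^sub>R z))) \<partial>lborel)"
      have el: "(p + 2) * D = ?N * (2 * L / ?G\<^sup>2 + p * I / ?M\<^sup>2)"
        unfolding D_def L_def I_def by (rule EL(4)[of z])
      have pde: "D = L + I"
      proof -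
        define f1 where "f1 x = norm x powr b *\<^sub>R (\<Sum>j\<in>UNIV. d j x *\<^sub>R ?g x $ j)" for x
        define f2 where "f2 x = (norm x powr c * cmod (Q x) powr p * \<phi> x) *\<^sub>R Q x" for x
        define f3 where "f3 x = \<phi> x *\<^sub>R Q x" for x
        have eq: "- (\<integral>x. f1 x \<partial>lborel) + (\<integral>x. f2 x \<partial>lborel) - (\<integral>x. f3 x \<partial>lborel) = 0"
          using gs t unfolding ground_state_def f1_def f2_def f3_def by blast
        have e1: "f1 x \<bullet> y = norm x powr b * (?g x \<bullet> (\<chi> j. d j x *\<^sub>R y))" for x y
          by (simp add: f1_def inner_vec_def inner_sum_left)
        have e2: "f2 x \<bullet> y = norm x powr c * (cmod (Q x) powr p * (Q x \<bullet> (\<phi> x *\<^sub>R y)))" for x y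
          by (simp add: f2_def)
        have e3: "f3 x \<bullet> y = Q x \<bullet> (\<phi> x *\<^sub>R y)" for x y
          by (simp add: f3_def)
        have i1: "integrable lborel f1" by (rule integrable_complexI) (unfold e1, rule EL(1))
        have i2: "integrable lborel f2" by (rule integrable_complexI) (unfold e2, rule EL(3))
        have i3: "integrable lborel f3" by (rule integrable_complexI) (unfold e3, rule EL(2))
        have "L = (\<integral>x. f1 x \<partial>lborel) \<bullet> z" unfolding L_def e1[symmetric] using i1 by simp
        moreover have "D = (\<integral>x. f2 x \<partial>lborel) \<bullet> z" unfolding D_def e2[symmetric] using i2 by simp
        moreover have "I = (\<integral>x. f3 x \<partial>lborel) \<bullet> z" unfolding I_def e3[symmetric] using i3 by simp
        moreover have "(- (\<integral>x. f1 x \<partial>lborel) + (\<integral>x. f2 x \<partial>lborel) - (\<integral>x. f3 x \<partial>lborel)) \<bullet> z = 0"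
          unfolding eq by simp
        ultimately show ?thesis by (simp add: inner_diff_left inner_add_left)
      qed
      have "A * L + B * I = 0"
        using el unfolding A_def B_def pde by (simp add: algebra_simps)
      then have AB: "A * D + (B - A) * I = 0" unfolding pde by (simp add: algebra_simps)
      have i: "integrable lborel (\<lambda>x. A * (norm x powr c * (cmod (Q x) powr p * (Q x \<bullet> (\<phi> x *\<^sub>R z)))) + (B - A) * (Q x \<bullet> (\<phi> x *\<^sub>R z)))"
        by (intro Bochner_Integration.integrable_add integrable_mult_right EL(2,3))
      have ae: "AE x in lborel. \<phi> x * (W (norm x) \<bullet> z) = A * (norm x powr c * (cmod (Q x) powr p * (Q x \<bullet> (\<phi> x *\<^sub>R z)))) + (B - A) * (Q x \<bullet> (\<phi> x *\<^sub>R z))"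
        using QF by eventually_elim (simp add: W_def algebra_simps)
      have "integrable lborel (\<lambda>x. \<phi> x * (W (norm x) \<bullet> z))"
        using i m by (subst integrable_cong_AE[OF _ _ ae]) auto
      moreover have "(\<integral>x. \<phi> x * (W (norm x) \<bullet> z) \<partial>lborel)
         = (\<integral>x. A * (norm x powr c * (cmod (Q x) powr p * (Q x \<bullet> (\<phi> x *\<^sub>R z)))) + (B - A) * (Q x \<bullet> (\<phi> x *\<^sub>R z)) \<partial>lborel)"
        using m by (intro integral_cong_AE ae) auto
      moreover have "\<dots> = A * D + (B - A) * I"
        unfolding D_def I_def using EL(2,3) by (simp del: inner_scaleR_right)
      ultimately show ?thesis using AB by simp
    qed
    \<comment> \<open>A radial bump near the sphere of radius \<open>r0\<close>, where W keeps a
      positive inner product with W(r0), would have a positive integral. Continuity of the profile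
      thus gives vanishing at every radius.\<close>
    have W0: "W r0 = 0" if r0: "r0 > 0" for r0
    proof (rule ccontr)
      assume ne: "W r0 \<noteq> 0"
      define z where "z = W r0"
      have cWs: "continuous_on {0<..} (\<lambda>s. W (sqrt s) \<bullet> z)"
        by (intro continuous_intros continuous_on_compose2[OF cW]) auto
      have "isCont (\<lambda>s. W (sqrt s) \<bullet> z) (r0\<^sup>2)"
        using cWs r0 by (simp add: continuous_on_eq_continuous_at)
      then have "((\<lambda>s. W (sqrt s) \<bullet> z) \<longlongrightarrow> W (sqrt (r0\<^sup>2)) \<bullet> z) (at (r0\<^sup>2))" by (simp add: isCont_def)
      moreover have "W (sqrt (r0\<^sup>2)) \<bullet> z > 0" using ne r0 by (simp add: z_def)
      ultimately have "\<forall>\<^sub>F s in at (r0\<^sup>2). W (sqrt s) \<bullet> z > 0" by (rule order_tendstoD(1))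
      then obtain \<delta>0 where d0: "\<delta>0 > 0" "\<And>s. s \<noteq> r0\<^sup>2 \<Longrightarrow> dist s (r0\<^sup>2) < \<delta>0 \<Longrightarrow> W (sqrt s) \<bullet> z > 0"
        unfolding eventually_at by auto
      \<comment> \<open>The bound by r0^2 keeps the bump, written in the variable |x|^2, away from
        the origin.\<close>
      define \<delta> where "\<delta> = min \<delta>0 (r0\<^sup>2)"
      have d: "\<delta> > 0" "\<delta> \<le> r0\<^sup>2" using d0(1) r0 by (auto simp: \<delta>_def)
      have Wpos: "W (sqrt s) \<bullet> z > 0" if "\<bar>s - r0\<^sup>2\<bar> < \<delta>" for s
        using d0(2)[of s] that \<open>W (sqrt (r0\<^sup>2)) \<bullet> z > 0\<close> by (cases "s = r0\<^sup>2") (auto simp: dist_real_def \<delta>_def)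
      define T where "T s = (max 0 (\<delta>\<^sup>2 - (s - r0\<^sup>2)\<^sup>2))\<^sup>2" for s
      define T' where "T' s = 2 * max 0 (\<delta>\<^sup>2 - (s - r0\<^sup>2)\<^sup>2) * (- 2 * (s - r0\<^sup>2))" for s
      have dT: "(T has_real_derivative T' s) (at s)" for s
        unfolding T_def T'_def
        by (rule DERIV_cong[OF DERIV_chain2[OF DERIV_pos_part_sq, of "\<lambda>s. \<delta>\<^sup>2 - (s - r0\<^sup>2)\<^sup>2" "- 2 * (s - r0\<^sup>2)"]])
           (auto intro!: derivative_eq_intros)
      have cT: "continuous_on UNIV T'" unfolding T'_def by (intro continuous_intros)
      have T0: "T s = 0" if "\<bar>s - r0\<^sup>2\<bar> \<ge> \<delta>" for s
      proof -
        have "\<delta>\<^sup>2 \<le> \<bar>s - r0\<^sup>2\<bar>\<^sup>2" using that d by (intro power_mono) auto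
        then show ?thesis by (simp add: T_def)
      qed
      have Tpos: "T s > 0" if "\<bar>s - r0\<^sup>2\<bar> < \<delta>" for s
      proof -
        have "\<bar>s - r0\<^sup>2\<bar>\<^sup>2 < \<delta>\<^sup>2" using that by (intro power_strict_mono) auto
        then show ?thesis by (simp add: T_def)
      qed
      let ?\<phi> = "\<lambda>x::real^'n. T ((norm x)\<^sup>2)"
      have tf: "test_fun ?\<phi> (\<lambda>j x. 2 * x $ j * T' ((norm x)\<^sup>2))"
        by (rule test_fun_radial_sq[OF dT cT, of "r0\<^sup>2 + \<delta>"]) (auto intro: T0)
      have eqT: "?\<phi> x * (W (norm x) \<bullet> z) = T ((norm x)\<^sup>2) * (W (sqrt ((norm x)\<^sup>2)) \<bullet> z)" for x :: "real^'n"
        by simp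
      \<comment> \<open>Continuity of \<open>W\<close> is known on positive radii; the bump vanishes
        at the origin, so the value of \<open>W\<close> at radius 0 does not affect the
        product.\<close>
      have m: "(\<lambda>x. ?\<phi> x * (W (norm x) \<bullet> z)) \<in> borel_measurable borel"
      proof -
        have "(\<lambda>r. indicator {0<..} r *\<^sub>R (W r \<bullet> z)) \<in> borel_measurable borel"
          by (rule borel_measurable_continuous_on_indicator) (auto intro!: continuous_intros cW)
        then have "(\<lambda>x::real^'n. ?\<phi> x * (indicator {0<..} (norm x) *\<^sub>R (W (norm x) \<bullet> z))) \<in> borel_measurable borel"
          using test_fun_measurable(1)[OF tf] by measurable
        moreover have "?\<phi> x * (indicator {0<..} (norm x) *\<^sub>R (W (norm x) \<bullet> z)) = ?\<phi> x * (W (norm x) \<bullet> z)" for x :: "real^'n"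
          using T0[of 0] d by (cases "x = 0") auto
        ultimately show ?thesis by (simp only:)
      qed
      have nn: "?\<phi> x * (W (norm x) \<bullet> z) \<ge> 0" for x :: "real^'n"
        unfolding eqT using T0[of "(norm x)\<^sup>2"] Tpos[of "(norm x)\<^sup>2"] Wpos[of "(norm x)\<^sup>2"]
        by (cases "\<bar>(norm x)\<^sup>2 - r0\<^sup>2\<bar> < \<delta>") auto
      have rp: "radial ?\<phi>" by (simp add: radial_def)
      define S where "S = {x::real^'n. \<bar>(norm x)\<^sup>2 - r0\<^sup>2\<bar> < \<delta>}"
      have "AE x in lborel. ?\<phi> x * (W (norm x) \<bullet> z) = 0"
        using integral_nonneg_eq_0_iff_AE[OF conjunct1[OF orth[OF tf rp m]] AE_I2] nn orth[OF tf rp m] by simp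
      then have "AE x in lborel. x \<notin> S"
      proof eventually_elim
        case (elim x)
        show ?case
        proof
          assume "x \<in> S"
          then have "?\<phi> x * (W (norm x) \<bullet> z) > 0"
            unfolding eqT S_def using Tpos[of "(norm x)\<^sup>2"] Wpos[of "(norm x)\<^sup>2"] by auto
          then show False using elim by simp
        qed
      qed
      moreover have oS: "open S" unfolding S_def by (intro open_Collect_less continuous_intros)
      ultimately have "S \<in> null_sets lborel" using AE_iff_null_sets[of S lborel] by simp
      then have "negligible S" by (simp add: negligible_iff_null_sets null_sets_completionI)
      moreover have "r0 *\<^sub>R axis undefined 1 \<in> S" using r0 d by (simp add: S_def)
      ultimately show False using open_not_negligible[OF oS] by auto
    qed
    define k where "k r = r powr c * cmod (F r) powr p" for r
    define \<kappa> where "\<kappa> = (A - B) / A"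
    have kv: "F r = 0 \<or> k r = \<kappa>" if "r > 0" for r
    proof -
      have "A * k r + (B - A) = 0 \<or> F r = 0" using W0[OF that] by (simp add: W_def k_def)
      then show ?thesis using A0 by (auto simp: \<kappa>_def field_simps)
    qed
    have "\<exists>r>0. F r \<noteq> 0"
    proof (rule ccontr)
      assume "\<not> (\<exists>r>0. F r \<noteq> 0)"
      then have "AE x in lborel. Q x = 0"
        using QF AE_lborel_singleton[of 0] by (auto elim!: eventually_elim2)
      then show False using wnorm0_eq_0I[of Q] Q(3) by simp
    qed
    then obtain r1 where r1: "r1 > 0" "F r1 \<noteq> 0" by blast
    have k1: "k r1 = \<kappa>" using kv[OF r1(1)] r1(2) by simp
    have kp: "\<kappa> > 0" unfolding k1[symmetric] k_def using r1 by simp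
    \<comment> \<open>At a zero of F the quantity k is 0, so k takes only the values 0 and \<kappa>;
      if both occurred, the connected half-line would also produce \<kappa> / 2.\<close>
    have all: "k r = \<kappa>" if r: "r > 0" for r
    proof (rule ccontr)
      assume "k r \<noteq> \<kappa>"
      then have "k r = 0" using kv[OF r] p by (auto simp: k_def)
      have "connected (k ` {0<..})" using ck unfolding k_def by (intro connected_continuous_image) auto
      moreover have "0 \<in> k ` {0<..}" using \<open>k r = 0\<close> r by (metis greaterThan_iff image_eqI)
      moreover have "\<kappa> \<in> k ` {0<..}" using k1 r1 by (metis greaterThan_iff image_eqI)
      ultimately have "{0..\<kappa>} \<subseteq> k ` {0<..}" by (rule connected_contains_Icc)
      then obtain s where s: "s > 0" "k s = \<kappa> / 2" using kp by (auto simp: subset_eq dest!: bspec[of _ _ "\<kappa> / 2"])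
      then show False using kv[OF s(1)] kp p by (auto simp: k_def)
    qed
    define \<gamma> where "\<gamma> = (2 - b) * (1 - p / 4)"
    define K where "K = (4 / sphere_area TYPE(real^'n)) powr (p / 2)"
    have "((\<lambda>r. K * r powr (- \<gamma>) * (?M * ?G) powr (p / 2)) \<longlongrightarrow> K * 0 * (?M * ?G) powr (p / 2)) at_top"
      using b p by (intro tendsto_intros tendsto_neg_powr filterlim_ident) (auto simp: \<gamma>_def)
    then have "\<forall>\<^sub>F r in at_top. K * r powr (- \<gamma>) * (?M * ?G) powr (p / 2) < \<kappa>"
      using kp by (intro order_tendstoD(2)) auto
    then have "\<forall>\<^sub>F r::real in at_top. False"
      using eventually_gt_at_top[of 0]
    proof eventually_elim
      case (elim r)
      have "k r \<le> K * r powr (- \<gamma>) * (?M * ?G) powr (p / 2)"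
        unfolding k_def K_def \<gamma>_def by (rule is_profile_decay[OF prof p(1) c elim(2)])
      then show ?case using all[OF elim(2)] elim(1) by simp
    qed
    then show False by simp
  qed
  then have "?N = (p + 2) / 2 * ?G\<^sup>2" using G0 by (simp add: A_def field_simps)
  then have "?C * ?G\<^sup>2 * ?M powr p = (p + 2) / 2 * ?G\<^sup>2" using max by simp
  then have "(?C * ?M powr p) * ?G\<^sup>2 = (p + 2) / 2 * ?G\<^sup>2" by (simp only: ac_simps)
  then have "?C * ?M powr p = (p + 2) / 2" using G0 by simp
  then show ?thesis using Q(3) by (simp add: field_simps)
qed

section \<open>The concentration theorem\<close>

text \<open>|w|^2 is at most twice |w - v|^2 plus twice |v|^2; a single point carries no mass of
  \<open>v\<close>, so the mass of \<open>v\<close> in shrinking balls tends to 0.\<close>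

lemma ball_mass_tendsto_0:
  fixes w :: "nat \<Rightarrow> real^'n \<Rightarrow> complex"
  assumes w: "\<And>k. wint 0 2 (w k)" and v: "wint 0 2 v"
    and conv: "(\<lambda>k. wnorm 0 2 (\<lambda>x. w k x - v x)) \<longlonglongrightarrow> 0" and \<rho>: "\<rho> \<longlonglongrightarrow> 0"
  shows "(\<lambda>k. ball_mass (w k) (\<rho> k)) \<longlonglongrightarrow> 0"
proof -
  have [measurable]: "w k \<in> borel_measurable borel" "v \<in> borel_measurable borel" for k
    using w[of k] v by (auto simp: wint_def)
  have [measurable]: "indicator (cball (0::real^'n) r) \<in> borel_measurable borel" for r
    by (rule borel_measurable_indicator[OF borel_closed[OF closed_cball]])
  have iw: "integrable lborel (\<lambda>x. (norm (w k x))\<^sup>2)" for k using w by (simp add: wint0_sq)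
  have iv: "integrable lborel (\<lambda>x. (norm (v x))\<^sup>2)" using v by (simp add: wint0_sq)
  have sq: "(norm (a + h))\<^sup>2 \<le> 2 * (norm a)\<^sup>2 + 2 * (norm h)\<^sup>2" for a h :: complex
    using norm_add_sq_le[of 1 a h] by simp
  have id: "integrable lborel (\<lambda>x. (norm (w k x - v x))\<^sup>2)" for k
  proof (rule Bochner_Integration.integrable_bound)
    show "integrable lborel (\<lambda>x. 2 * (norm (w k x))\<^sup>2 + 2 * (norm (v x))\<^sup>2)"
      by (intro Bochner_Integration.integrable_add integrable_mult_right iw iv)
    show "AE x in lborel. norm ((norm (w k x - v x))\<^sup>2) \<le> norm (2 * (norm (w k x))\<^sup>2 + 2 * (norm (v x))\<^sup>2)"
      using sq[of "w k _" "- v _"] by (intro AE_I2) simp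
  qed measurable
  have iB: "integrable lborel (\<lambda>x. indicator (cball 0 r) x * (norm (f x))\<^sup>2)"
    if i: "integrable lborel (\<lambda>x. (norm (f x))\<^sup>2)" for f :: "real^'n \<Rightarrow> complex" and r
    by (rule Bochner_Integration.integrable_bound[OF i]) (use borel_measurable_integrable[OF i] in \<open>auto simp: indicator_def\<close>)
  have le: "ball_mass (w k) (\<rho> k) \<le> 2 * (wnorm 0 2 (\<lambda>x. w k x - v x))\<^sup>2 + 2 * ball_mass v (\<rho> k)" for k
  proof -
    have "ball_mass (w k) (\<rho> k) \<le> (\<integral>x. 2 * (norm (w k x - v x))\<^sup>2 + 2 * (indicator (cball 0 (\<rho> k)) x * (norm (v x))\<^sup>2) \<partial>lborel)"
      unfolding ball_mass_def
    proof (rule integral_mono[OF iB[OF iw]])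
      show "integrable lborel (\<lambda>x. 2 * (norm (w k x - v x))\<^sup>2 + 2 * (indicator (cball 0 (\<rho> k)) x * (norm (v x))\<^sup>2))"
        by (intro Bochner_Integration.integrable_add integrable_mult_right id iB iv)
      show "indicator (cball 0 (\<rho> k)) x * (norm (w k x))\<^sup>2 \<le> 2 * (norm (w k x - v x))\<^sup>2 + 2 * (indicator (cball 0 (\<rho> k)) x * (norm (v x))\<^sup>2)" for x
        using sq[of "w k x - v x" "v x"] by (cases "x \<in> cball 0 (\<rho> k)") auto
    qed
    also have "\<dots> = 2 * (wnorm 0 2 (\<lambda>x. w k x - v x))\<^sup>2 + 2 * ball_mass v (\<rho> k)"
      unfolding wnorm0_sq ball_mass_def using id[of k] iB[OF iv, of "\<rho> k"] by simp
    finally show ?thesis .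
  qed
  have "(\<lambda>k. ball_mass v (\<rho> k)) \<longlonglongrightarrow> (\<integral>(x::real^'n). (0::real) \<partial>lborel)"
    unfolding ball_mass_def
  proof (rule integral_dominated_convergence[OF _ _ iv])
    show "AE x in lborel. (\<lambda>k. indicator (cball 0 (\<rho> k)) x * (norm (v x))\<^sup>2) \<longlonglongrightarrow> 0"
      using AE_lborel_singleton[of 0]
    proof eventually_elim
      case (elim x)
      have "\<forall>\<^sub>F k in sequentially. \<rho> k < norm x" using \<rho> elim by (intro order_tendstoD(2)) auto
      then have "\<forall>\<^sub>F k in sequentially. indicator (cball 0 (\<rho> k)) x * (norm (v x))\<^sup>2 = 0"
        by eventually_elim simp
      then show ?case by (rule tendsto_eventually)
    qed
    show "AE x in lborel. norm (indicator (cball 0 (\<rho> k)) x * (norm (v x))\<^sup>2) \<le> (norm (v x))\<^sup>2" for k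
      by (intro AE_I2) (auto simp: indicator_def)
  qed measurable
  then have bv: "(\<lambda>k. ball_mass v (\<rho> k)) \<longlonglongrightarrow> 0" by simp
  have "(\<lambda>k. 2 * (wnorm 0 2 (\<lambda>x. w k x - v x))\<^sup>2 + 2 * ball_mass v (\<rho> k)) \<longlonglongrightarrow> 2 * 0\<^sup>2 + 2 * 0"
    by (intro tendsto_intros conv bv)
  then have "(\<lambda>k. 2 * (wnorm 0 2 (\<lambda>x. w k x - v x))\<^sup>2 + 2 * ball_mass v (\<rho> k)) \<longlonglongrightarrow> 0" by simp
  then show ?thesis
    by (rule tendsto_sandwich[OF _ _ tendsto_const, rotated 2])
       (auto intro!: always_eventually ball_mass_nonneg le)
qed

lemma filterlim_powr_at_top:
  fixes a :: real
  assumes "a > 0"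
  shows "filterlim (\<lambda>x::real. x powr a) at_top at_top"
  unfolding filterlim_at_top
proof
  fix Z :: real
  show "\<forall>\<^sub>F x::real in at_top. Z \<le> x powr a"
    using eventually_ge_at_top[of "(max 1 Z) powr (1 / a)"]
  proof eventually_elim
    case (elim x)
    have "Z \<le> max 1 Z" by simp
    also have "\<dots> = ((max 1 Z) powr (1 / a)) powr a" using assms by (simp add: powr_powr)
    also have "\<dots> \<le> x powr a" using elim assms by (intro powr_mono2) auto
    finally show ?case .
  qed
qed

theorem theorem1p2:
  fixes u :: "real \<Rightarrow> real^'n \<Rightarrow> complex"
    and b c p T :: real
    and lam :: "real \<Rightarrow> real"
  assumes hb: "2 - real CARD('n) < b" "b \<le> 0"
    and hc: "b - 2 < c" "c < b - 2 + 2 * real CARD('n)"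
    and hp: "p = 2 * (2 - b + c) / real CARD('n)"
    and sol: "is_solution b c p u T"
    and rad: "\<forall>t\<in>{0..<T}. radial (u t)"
    and mass: "\<forall>t\<in>{0..<T}. wnorm 0 2 (u t) = wnorm 0 2 (u 0)"
    and ener: "\<forall>t\<in>{0..<T}. energy b c p (u t) = energy b c p (u 0)"
    and Tpos: "T > 0"
    and blowup: "filterlim (\<lambda>t. W_norm b (u t)) at_top (at_left T)"
    and lower: "\<exists>C>0. \<forall>\<^sub>F t in at_left T. grad_norm b (u t) \<ge> C / sqrt (T - t)"
    and lam_cont: "continuous_on {0..<T} lam"
    and lam_pos: "\<forall>t\<in>{0..<T}. lam t > 0"
    and lam_lim: "filterlim (\<lambda>t. lam t * grad_norm b (u t) powr (2 / (2 - b))) at_top (at_left T)"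
  shows "(\<forall>Q :: real^'n \<Rightarrow> complex. ground_state b c p Q \<longrightarrow>
            Liminf (at_left T)
              (\<lambda>t. ereal (integral\<^sup>L lborel (\<lambda>x. indicator (cball 0 (lam t)) x * (cmod (u t x))\<^sup>2)))
            \<ge> ereal ((wnorm 0 2 Q)\<^sup>2))
       \<and> \<not> (\<exists>s :: nat \<Rightarrow> real. \<exists>v :: real^'n \<Rightarrow> complex.
              (\<forall>k. s k \<in> {0..<T}) \<and> s \<longlonglongrightarrow> T \<and> wint 0 2 v \<and>
              (\<lambda>k. wnorm 0 2 (\<lambda>x. u (s k) x - v x)) \<longlonglongrightarrow> 0)"
proof -
  have n: "real CARD('n) > 0" by simp
  have p: "0 < p" "p < 4" unfolding hp using hc n by (auto simp: field_simps)
  have c: "c = real CARD('n) * p / 2 - 2 + b" unfolding hp using n by (simp add: field_simps)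
  have Wb: "in_Wb b (u t)" if "t \<in> {0..<T}" for t using sol that unfolding is_solution_def by blast
  have ev: "\<forall>\<^sub>F t in at_left T. t \<in> {0..<T}"
    using Tpos by (auto simp: eventually_at_left[of 0] intro!: exI[of _ 0])
  have U: "\<forall>\<^sub>F t in at_left T. in_Wb b (u t) \<and> radial (u t) \<and> wnorm 0 2 (u t) = wnorm 0 2 (u 0) \<and> energy b c p (u t) = energy b c p (u 0)"
    using ev by eventually_elim (use Wb rad mass ener in blast)
  \<comment> \<open>The mass is constant in time, so blow-up of the full norm is blow-up of the
    gradient norm.\<close>
  have G: "filterlim (\<lambda>t. grad_norm b (u t)) at_top (at_left T)"
    unfolding filterlim_at_top
  proof
    fix Z
    have "\<forall>\<^sub>F t in at_left T. Z + wnorm 0 2 (u 0) \<le> W_norm b (u t)"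
      using blowup unfolding filterlim_at_top by blast
    with U show "\<forall>\<^sub>F t in at_left T. Z \<le> grad_norm b (u t)"
      by eventually_elim (simp add: W_norm_def)
  qed
  have lam0: "\<forall>\<^sub>F t in at_left T. lam t > 0" using ev by eventually_elim (use lam_pos in blast)
  have part1: "ereal ((wnorm 0 2 Q)\<^sup>2) \<le> Liminf (at_left T) (\<lambda>t. ereal (ball_mass (u t) (lam t)))"
    if gs: "ground_state b c p Q" for Q :: "real^'n \<Rightarrow> complex"
  proof -
    let ?q = "wnorm 0 2 Q" and ?C = "C_GN b c p TYPE('n)"
    have q: "?q > 0" using gs by (simp add: ground_state_def)
    have C: "?C = (p + 2) / (2 * ?q powr p)" by (rule mass_critical_C_GN[OF hb p c gs])
    have C0: "?C > 0" unfolding C using q p by simp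
    \<comment> \<open>With the optimal constant the concentration threshold is the p-th power of the
      mass norm of Q.\<close>
    have Cq: "(p + 2) / (2 * ?C) = ?q powr p" unfolding C using q p by (simp add: field_simps)
    show ?thesis
      unfolding le_Liminf_iff
    proof (intro allI impI)
      fix y assume y: "y < ereal (?q\<^sup>2)"
      show "\<forall>\<^sub>F t in at_left T. y < ereal (ball_mass (u t) (lam t))"
      proof (cases "y < 0")
        \<comment> \<open>\<open>y\<close> is an extended real and may be minus infinity; below 0
          nothing is to be shown since the ball mass is nonnegative, and the remaining values are
          finite.\<close>
        case True
        have "y < ereal (ball_mass (u t) (lam t))" for t
          using True ball_mass_nonneg[of "u t" "lam t"] by (metis ereal_less_eq(5) less_le_trans)
        then show ?thesis by simp
      next
        case False
        then obtain y' where y': "y = ereal y'" "y' \<ge> 0" "y' < ?q\<^sup>2" using y by (cases y) auto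
        have "sqrt y' < ?q" using y' q by (intro real_less_lsqrt) auto
        then have "sqrt y' powr p < (p + 2) / (2 * ?C)"
          unfolding Cq using y' p by (intro powr_less_mono2) auto
        then have "\<forall>\<^sub>F t in at_left T. sqrt y' powr p < sqrt (ball_mass (u t) (lam t)) powr p"
          by (intro mass_concentration[OF hb p c C0 _ U G lam0 lam_lim] C_GN_bound[OF hb p c])
        then show ?thesis
        proof eventually_elim
          case (elim t)
          have "sqrt y' < sqrt (ball_mass (u t) (lam t))"
          proof (rule ccontr)
            assume "\<not> sqrt y' < sqrt (ball_mass (u t) (lam t))"
            then have "sqrt (ball_mass (u t) (lam t)) powr p \<le> sqrt y' powr p"
              using p ball_mass_nonneg by (intro powr_mono2) auto
            then show False using elim by simp
          qed
          then show ?case by (simp add: y')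
        qed
      qed
    qed
  qed
  have part2: False
    if s: "\<And>k. s k \<in> {0..<T}" "s \<longlonglongrightarrow> T" and v: "wint 0 2 v"
      and conv: "(\<lambda>k. wnorm 0 2 (\<lambda>x. u (s k) x - v x)) \<longlonglongrightarrow> 0"
    for s :: "nat \<Rightarrow> real" and v :: "real^'n \<Rightarrow> complex"
  proof -
    \<comment> \<open>With no ground state available the crude constant is used; any positive lower
      bound for the local mass leads to the contradiction.\<close>
    obtain K where K: "K > 0" "\<And>w :: real^'n \<Rightarrow> complex. in_Wb b w \<Longrightarrow> radial w \<Longrightarrow> pot c p w \<le> K * (grad_norm b w)\<^sup>2 * wnorm 0 2 w powr p"
      using radial_GN[OF hb p c] by blast
    \<comment> \<open>The size of the exponent is half the critical one: \<rho> tends to 0, while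
      \<rho> G^(2/(2-b)) = G^(1/(2-b)) still tends to infinity.\<close>
    define \<rho> where "\<rho> t = grad_norm b (u t) powr (- 1 / (2 - b))" for t
    have Gpos: "\<forall>\<^sub>F t in at_left T. grad_norm b (u t) > 0" using G by (auto simp: filterlim_at_top_dense)
    have r0: "\<forall>\<^sub>F t in at_left T. \<rho> t > 0" using Gpos by eventually_elim (simp add: \<rho>_def)
    have rl: "filterlim (\<lambda>t. \<rho> t * grad_norm b (u t) powr (2 / (2 - b))) at_top (at_left T)"
    proof -
      have "\<rho> t * grad_norm b (u t) powr (2 / (2 - b)) = grad_norm b (u t) powr (1 / (2 - b))" for t
        unfolding \<rho>_def powr_add[symmetric] by (simp add: diff_divide_distrib[symmetric])
      moreover have "filterlim (\<lambda>t. grad_norm b (u t) powr (1 / (2 - b))) at_top (at_left T)"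
        using hb(2) by (intro filterlim_compose[OF _ G] filterlim_powr_at_top) auto
      ultimately show ?thesis by simp
    qed
    have d: "(p + 2) / (4 * K) < (p + 2) / (2 * K)" using p K(1) by (intro divide_strict_left_mono) auto
    have dpos: "(p + 2) / (4 * K) > 0" using p K(1) by simp
    \<comment> \<open>Each \<open>s k\<close> is strictly below \<open>T\<close>, so convergence to
      \<open>T\<close> is convergence from the left.\<close>
    have sT: "filterlim s (at_left T) sequentially"
      unfolding filterlim_at using s by (auto intro!: always_eventually simp: less_imp_neq)
    have 1: "\<forall>\<^sub>F k in sequentially. (p + 2) / (4 * K) < sqrt (ball_mass (u (s k)) (\<rho> (s k))) powr p"
      by (rule eventually_compose_filterlim[OF mass_concentration[OF hb p c K U G r0 rl d] sT])
    have "(\<rho> \<longlongrightarrow> 0) (at_left T)"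
      unfolding \<rho>_def[abs_def] using hb(2) by (intro tendsto_neg_powr G) (auto simp: divide_less_0_iff)
    then have "(\<lambda>k. \<rho> (s k)) \<longlonglongrightarrow> 0" by (rule filterlim_compose[OF _ sT])
    then have "(\<lambda>k. ball_mass (u (s k)) (\<rho> (s k))) \<longlonglongrightarrow> 0"
      using Wb[OF s(1)] by (intro ball_mass_tendsto_0[OF _ v conv]) (auto simp: in_Wb_def)
    from tendsto_real_sqrt[OF this] have "(\<lambda>k. sqrt (ball_mass (u (s k)) (\<rho> (s k)))) \<longlonglongrightarrow> 0" by simp
    then have "(\<lambda>k. sqrt (ball_mass (u (s k)) (\<rho> (s k))) powr p) \<longlonglongrightarrow> 0"
      using p by (intro tendsto_zero_powrI[OF _ tendsto_const]) (auto intro!: always_eventually ball_mass_nonneg)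
    then have 2: "\<forall>\<^sub>F k in sequentially. sqrt (ball_mass (u (s k)) (\<rho> (s k))) powr p < (p + 2) / (4 * K)"
      using dpos by (rule order_tendstoD(2))
    from 1 2 have "\<forall>\<^sub>F k::nat in sequentially. False" by eventually_elim simp
    then show False by simp
  qed
  show ?thesis
    using part1 part2 unfolding ball_mass_def by blast
qed

end
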